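(* Let $X$ be a real-valued L\'evy process which is not a compound Poisson process, let $q>0$, $p>-q$, and let $b,y\in\mathbb R$ with $y\ge b$. Put $$V_q(x):=\mathbb E_x\left[e^{-p\int_0^{e(q)}\mathbf 1_{\{X_s\le b\}}ds}\,\mathbf 1_{\{X_{e(q)}>y\}}\right],\qquad x\in\mathbb R .$$ Then for all $x\in\mathbb R$ $$V_q(x)-\mathbb P_x\left(X_{e(q)}>y\right)=J_1(b-x;\,y-b),$$ with $$J_1(x;y-b)=\int_{(-\infty,x)}F_1(x-z+y-b)\,dK_q(z),\qquad x\in\mathbb R,$$ where $K_q$ is the convolution of the probability distribution functions of $\underline X_{e(q)}$ and $\overline X_{e(p+q)}$ under $\mathbb P$, i.e. $$K_q(x)=\int_{(-\infty,\min\{0,x\}]}\mathbb P\left(\overline X_{e(p+q)}\le x-z\right)\mathbb P\left(\underline X_{e(q)}\in dz\right),\qquad x\in\mathbb R,$$ and $F_1$ is a continuous function on $(0,\infty)$ with the Laplace transform $$\int_0^\infty e^{-sx}F_1(x)\,dx=\frac1s\left(\frac{\mathbb E\left[e^{-s\overline X_{e(q)}}\right]}{\mathbb E\left[e^{-s\overline X_{e(p+q)}}\right]}-1\right),\qquad s>0 .$$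
   Context: $\mathbb P_x,\mathbb E_x$ denote the law and expectation of $X$ started at $X_0=x$; $\mathbb P=\mathbb P_0$, $\mathbb E=\mathbb E_0$. $\overline X_T=\sup_{0\le t\le T}X_t$, $\underline X_T=\inf_{0\le t\le T}X_t$. For $q>0$, $e(q)$ is an exponential random variable with rate $q$ independent of $X$. A compound Poisson process means one without drift (the identically zero process counts as a degenerate compound Poisson process). *)

theory Defs
  imports "HOL-Probability.Probability"
begin

(* Time is [0,\<infinity>): the values X t for t < 0 play no role.  Every path (not merely almost
   every path) is right continuous with left limits, as on the canonical path space; this makes
   the path functionals below measurable without completing M. *)
locale levy_process = prob_space M for M :: "'a measure" +
  fixes X :: "real \<Rightarrow> 'a \<Rightarrow> real"
  assumes measurable_X: "\<And>t. 0 \<le> t \<Longrightarrow> X t \<in> borel_measurable M"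
    and start_zero: "AE \<omega> in M. X 0 \<omega> = 0"
    and indep_increments:
      "\<And>(n::nat) \<tau>. 0 \<le> \<tau> 0 \<Longrightarrow> (\<forall>i<n. \<tau> i < \<tau> (Suc i)) \<Longrightarrow>
         indep_vars (\<lambda>_. borel) (\<lambda>i \<omega>. X (\<tau> (Suc i)) \<omega> - X (\<tau> i) \<omega>) {..<n}"
    and stationary_increments:
      "\<And>s t. 0 \<le> s \<Longrightarrow> s \<le> t \<Longrightarrow>
         distr M borel (\<lambda>\<omega>. X t \<omega> - X s \<omega>) = distr M borel (X (t - s))"
    and right_continuous:
      "\<And>\<omega> t. \<omega> \<in> space M \<Longrightarrow> 0 \<le> t \<Longrightarrow> continuous (at_right t) (\<lambda>s. X s \<omega>)"
    and left_limits:
      "\<And>\<omega> t. \<omega> \<in> space M \<Longrightarrow> 0 < t \<Longrightarrow> \<exists>l. ((\<lambda>s. X s \<omega>) \<longlongrightarrow> l) (at_left t)"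

(* Law of the random sum \<xi> 0 + ... + \<xi> (N - 1), where N is Poisson with mean c > 0 and
   the \<xi> i are i.i.d. with law \<mu> and independent of N. *)
definition compound_poisson_distr :: "real \<Rightarrow> real measure \<Rightarrow> real measure" where
  "compound_poisson_distr c \<mu> =
     distr (measure_pmf (poisson_pmf c) \<Otimes>\<^sub>M PiM (UNIV :: nat set) (\<lambda>_. \<mu>)) borel
       (\<lambda>(n, \<xi>). \<Sum>i<n. \<xi> i)"

(* A driftless compound Poisson process, as a property of the law of X: a Levy process whose
   one-dimensional laws are compound Poisson with a common jump law \<mu> and mean number of
   jumps l * t (the law of a Levy process is determined by these marginals).
   \<mu> may have an atom at 0; \<mu> = return borel 0 gives the identically zero process. *)
definition compound_poisson_process :: "'a measure \<Rightarrow> (real \<Rightarrow> 'a \<Rightarrow> real) \<Rightarrow> bool" where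
  "compound_poisson_process M X \<longleftrightarrow>
     levy_process M X \<and>
     (\<exists>l>0. \<exists>\<mu>. prob_space \<mu> \<and> sets \<mu> = sets borel \<and>
        (\<forall>t>0. distr M borel (X t) = compound_poisson_distr (l * t) \<mu>))"

(* Independence is from the whole process, seen as a random element of the product space over
   all times t \<ge> 0.  The clock is nonnegative everywhere, since X is only meaningful at
   nonnegative times. *)
definition indep_exponential ::
    "'a measure \<Rightarrow> (real \<Rightarrow> 'a \<Rightarrow> real) \<Rightarrow> real \<Rightarrow> ('a \<Rightarrow> real) \<Rightarrow> bool" where
  "indep_exponential M X r T \<longleftrightarrow>
     (\<forall>\<omega>\<in>space M. 0 \<le> T \<omega>) \<and>
     distributed M lborel T (exponential_density r) \<and>
     prob_space.indep_set M
       (sets (vimage_algebra (space M) T borel))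
       (sets (vimage_algebra (space M) (\<lambda>\<omega>. \<lambda>t\<in>{0..}. X t \<omega>) (PiM {0..} (\<lambda>_. borel))))"

(* The law P_x of the process started at x is the law of started_at x X under M. *)
definition started_at :: "real \<Rightarrow> (real \<Rightarrow> 'a \<Rightarrow> real) \<Rightarrow> real \<Rightarrow> 'a \<Rightarrow> real" where
  "started_at x X = (\<lambda>t \<omega>. x + X t \<omega>)"

definition running_sup :: "(real \<Rightarrow> 'a \<Rightarrow> real) \<Rightarrow> real \<Rightarrow> 'a \<Rightarrow> real" where
  "running_sup X T \<omega> = (SUP t\<in>{0..T}. X t \<omega>)"

definition running_inf :: "(real \<Rightarrow> 'a \<Rightarrow> real) \<Rightarrow> real \<Rightarrow> 'a \<Rightarrow> real" where
  "running_inf X T \<omega> = (INF t\<in>{0..T}. X t \<omega>)"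

definition occupation_time :: "(real \<Rightarrow> 'a \<Rightarrow> real) \<Rightarrow> real \<Rightarrow> real \<Rightarrow> 'a \<Rightarrow> real" where
  "occupation_time X b T \<omega> = (LINT s:{0..T}|lborel. indicator {..b} (X s \<omega>))"

definition V_integrand ::
    "(real \<Rightarrow> 'a \<Rightarrow> real) \<Rightarrow> ('a \<Rightarrow> real) \<Rightarrow> real \<Rightarrow> real \<Rightarrow> real \<Rightarrow> 'a \<Rightarrow> real" where
  "V_integrand X T p b y \<omega> =
     exp (- p * occupation_time X b (T \<omega>) \<omega>) * indicator {y<..} (X (T \<omega>) \<omega>)"

definition V ::
    "'a measure \<Rightarrow> (real \<Rightarrow> 'a \<Rightarrow> real) \<Rightarrow> (real \<Rightarrow> 'a \<Rightarrow> real) \<Rightarrow>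
     real \<Rightarrow> real \<Rightarrow> real \<Rightarrow> real \<Rightarrow> real \<Rightarrow> real" where
  "V M X e q p b y x = (LINT \<omega>|M. V_integrand (started_at x X) (e q) p b y \<omega>)"

definition K ::
    "'a measure \<Rightarrow> (real \<Rightarrow> 'a \<Rightarrow> real) \<Rightarrow> (real \<Rightarrow> 'a \<Rightarrow> real) \<Rightarrow>
     real \<Rightarrow> real \<Rightarrow> real \<Rightarrow> real" where
  "K M X e q p x =
     (LINT z:{..min 0 x}|distr M borel (\<lambda>\<omega>. running_inf X (e q \<omega>) \<omega>).
        \<P>(\<omega> in M. running_sup X (e (p + q) \<omega>) \<omega> \<le> x - z))"

definition J1 ::
    "'a measure \<Rightarrow> (real \<Rightarrow> 'a \<Rightarrow> real) \<Rightarrow> (real \<Rightarrow> 'a \<Rightarrow> real) \<Rightarrow>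
     real \<Rightarrow> real \<Rightarrow> (real \<Rightarrow> real) \<Rightarrow> real \<Rightarrow> real \<Rightarrow> real" where
  "J1 M X e q p F x c =
     (LINT z:{..<x}|interval_measure (K M X e q p). F (x - z + c))"

definition is_F1 ::
    "'a measure \<Rightarrow> (real \<Rightarrow> 'a \<Rightarrow> real) \<Rightarrow> (real \<Rightarrow> 'a \<Rightarrow> real) \<Rightarrow>
     real \<Rightarrow> real \<Rightarrow> (real \<Rightarrow> real) \<Rightarrow> bool" where
  "is_F1 M X e q p F \<longleftrightarrow>
     continuous_on {0<..} F \<and>
     (\<forall>s>0. set_integrable lborel {0<..} (\<lambda>x. exp (- s * x) * F x) \<and>
        (LINT x:{0<..}|lborel. exp (- s * x) * F x) =
          (1 / s) *
          ((LINT \<omega>|M. exp (- s * running_sup X (e q \<omega>) \<omega>)) /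
           (LINT \<omega>|M. exp (- s * running_sup X (e (p + q) \<omega>) \<omega>)) - 1))"

end

theory Submission
  imports Defs
begin

text \<open>
  Write q' = p + q and let I and S be independent with the laws of the infimum of X up to e(q) and of
  the supremum up to e(q'); let Z be the sum of independent copies of the infimum up to e(q') and the
  supremum up to e(q).  Everything rests on identities between the laws of such suprema and infima,
  and these are first proved for a random walk, where they are pure algebra.

  Random walk.  Let lam be the step law, let \<sigma> and \<iota> be the laws of the maximum and of the minimum of
  the walk, started at 0, at an independent geometric time with parameter z, and let P and N push a
  measure forward under max 0 and min 0.  Looking at the first step gives
  \<sigma> = (1 - z) \<delta> + z P(lam * \<sigma>) and \<iota> = (1 - z) \<delta> + z N(lam * \<iota>), and P(m) + N(m) = m + \<delta> for every
  probability measure m.  Multiplying such equations one obtains an identity between a signed measure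
  on [0, \<infinity>) and one on (-\<infinity>, 0]; both sides are then multiples of \<delta>, and the multiple is found from the
  total masses (lemma signed_char_on_both_const).  This yields the Wiener--Hopf factorisation
  (char_sum_law_eq_max_law_min_law) and, for a second parameter w with laws \<sigma>' and \<iota>', the explicit
  quotients \<sigma> = \<sigma>' * \<nu> and \<iota>' = \<iota> * \<nu>', where \<nu> is a combination of \<delta> and P(\<iota>' * \<sigma>), and \<nu>' one of
  \<delta> and N(\<iota>' * \<sigma>) (max_law_relation, min_law_relation).  A walk that survives a step with
  probability z above b and w below b, and is paid f (the indicator of (y, \<infinity>)) at the end, has an
  expected payoff R which satisfies one resolvent equation with parameter z and another one with
  parameter w.  Up to the payoff itself, the inhomogeneity of the first lives on (-\<infinity>, b], and that of
  the second lives on (b, \<infinity>).  Since \<nu> only moves points up and \<nu>' only down, the quotients separate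
  the two, and R = \<iota> * \<sigma>' acting on the product of the indicator of (b, \<infinity>) with \<nu> f
  (killed_walk_formula).

  Passage to the limit.  The skeleton of X of mesh 2^(-n) is a random walk, and e(q) rounded up to the
  grid is a geometric time independent of it.  As n grows, the grid maxima, minima, end points and
  occupation times converge, because paths are right continuous with left limits.  For the laws of
  maxima, minima and end points this is expressed by characteristic functions (wiener_hopf, sup_law_relation); for
  the payoff it gives V(x) = E k(x + I + S) with k = \<nu> f on (b, \<infinity>) and k = 0 elsewhere, while
  P_x(X at e(q) > y) = E \<nu> f(x + I + S) (killed_value_formula, value_difference).  For u < y one has
  \<nu> f(u) = (p / q') P(Z > y - u), so the difference of the two is the integral of
  F1(y - x - u) = -(p / q') P(Z > y - x - u) over u < b - x against the law of I + S, whose distribution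
  function is K.  The same relation between the laws of the suprema gives the Laplace transform of F1,
  which determines a continuous function on (0, \<infinity>) (laplace_transform_unique).

  Atoms.  Continuity of F1 and the treatment of the level b need that Z and I + S have no atoms.  If X
  visits a point c on a set of times of positive measure, then translating that set slightly shows that
  P(X_t = 0) tends to 1 as t tends to 0; the skeletons then move only boundedly often per unit of time,
  and X is a compound Poisson process (compound_poisson_if_atom).  Otherwise X at e(q) has no atom, so
  by the factorisation either the suprema or the infima have none, and a sum of independent variables
  has no atom as soon as one summand has none.
\<close>

section \<open>Signed combinations of distributions and their characteristic functions\<close>

lemma real_distribution_bounded_integrable:
  fixes g :: "real \<Rightarrow> 'b::{banach, second_countable_topology}"
  assumes "real_distribution m" "g \<in> borel_measurable borel" "\<And>x. norm (g x) \<le> B"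
  shows "integrable m g"
proof -
  interpret real_distribution m by fact
  show ?thesis
    using assms(2,3) by (intro integrable_const_bound[where B=B]) auto
qed

lemma norm_integral_prob_le:
  fixes g :: "'a \<Rightarrow> 'b::{banach, second_countable_topology}"
  assumes "prob_space m" "\<And>x. norm (g x) \<le> B"
  shows "norm (integral\<^sup>L m g) \<le> B"
proof (cases "integrable m g")
  case True
  interpret prob_space m by fact
  have "norm (integral\<^sup>L m g) \<le> (\<integral>x. norm (g x) \<partial>m)"
    by (rule integral_norm_bound)
  also have "\<dots> \<le> (\<integral>x. B \<partial>m)"
    using True assms(2) by (intro integral_mono) auto
  finally show ?thesis by (simp add: prob_space)
next
  case False
  then show ?thesis
    using order_trans[OF norm_ge_zero assms(2)] by (simp add: not_integrable_integral_eq)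
qed

lemma iexp_measurable [measurable]: "(\<lambda>x::real. iexp (t * x)) \<in> borel_measurable borel"
  by (intro borel_measurable_continuous_onI continuous_intros)

lemma real_distribution_convolution:
  assumes "real_distribution m" "real_distribution n"
  shows "real_distribution (convolution m n)"
proof -
  interpret m: real_distribution m by fact
  interpret n: real_distribution n by fact
  interpret P: pair_prob_space m n ..
  show ?thesis
    unfolding convolution_def by (rule P.real_distribution_distr) (auto simp: case_prod_beta)
qed

lemma integral_convolution:
  fixes g :: "real \<Rightarrow> 'b::{banach, second_countable_topology}"
  assumes "real_distribution m" "real_distribution n"
    and [measurable]: "g \<in> borel_measurable borel" and B: "\<And>x. norm (g x) \<le> B"
  shows "integral\<^sup>L (convolution m n) g = (\<integral>x. \<integral>y. g (x + y) \<partial>n \<partial>m)"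
proof -
  interpret m: real_distribution m by fact
  interpret n: real_distribution n by fact
  interpret P: pair_prob_space m n ..
  have "integral\<^sup>L (convolution m n) g = (\<integral>z. g (fst z + snd z) \<partial>(m \<Otimes>\<^sub>M n))"
    unfolding convolution_def by (subst integral_distr) (auto simp: case_prod_beta)
  also have "\<dots> = (\<integral>x. \<integral>y. g (x + y) \<partial>n \<partial>m)"
    by (subst P.integral_fst'[symmetric])
       (auto intro!: P.integrable_const_bound[where B=B] simp: B)
  finally show ?thesis .
qed

lemma integral_convolution_swap:
  fixes g :: "real \<Rightarrow> 'b::{banach, second_countable_topology}"
  assumes "real_distribution m" "real_distribution n"
    and "g \<in> borel_measurable borel" and "\<And>x. norm (g x) \<le> B"
  shows "integral\<^sup>L (convolution m n) g = (\<integral>y. \<integral>x. g (x + y) \<partial>m \<partial>n)"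
proof -
  interpret m: real_distribution m by fact
  interpret n: real_distribution n by fact
  have "convolution m n = convolution n m"
    by (rule convolution_commutative) (auto simp: m.finite_measure_axioms n.finite_measure_axioms)
  then show ?thesis
    using integral_convolution[OF assms(2,1,3,4)] by (simp add: add.commute)
qed

lemma char_convolution:
  assumes "real_distribution m" "real_distribution n"
  shows "char (convolution m n) t = char m t * char n t"
proof -
  have "char (convolution m n) t = (\<integral>x. \<integral>y. iexp (t * (x + y)) \<partial>n \<partial>m)"
    unfolding char_def by (rule integral_convolution[OF assms, where B=1]) auto
  also have "\<dots> = (\<integral>x. \<integral>y. iexp (t * x) * iexp (t * y) \<partial>n \<partial>m)"
    by (simp add: distrib_left exp_add)
  finally show ?thesis by (simp add: char_def)
qed

lemma char_distr:
  assumes "real_distribution m" "g \<in> borel_measurable borel"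
  shows "char (distr m borel g) t = (\<integral>x. iexp (t * g x) \<partial>m)"
proof -
  interpret m: real_distribution m by fact
  show ?thesis unfolding char_def using assms(2) by (subst integral_distr) auto
qed

lemma real_distribution_distr_borel:
  assumes "real_distribution m" "g \<in> borel_measurable borel"
  shows "real_distribution (distr m borel g)"
proof -
  interpret m: real_distribution m by fact
  show ?thesis using assms(2) by (intro m.real_distribution_distr) auto
qed

text \<open>
  This is P(m) + N(m) = m + \<delta> on the level of characteristic functions: of max 0 x and min 0 x, one
  is x and the other is 0.
\<close>

lemma char_max_plus_min:
  assumes "real_distribution m"
  shows "char (distr m borel (max 0)) t + char (distr m borel (min 0)) t = char m t + 1"
proof -
  interpret m: real_distribution m by fact
  have int: "integrable m (\<lambda>x. iexp (t * f x))" if "f \<in> borel_measurable borel" for f :: "real \<Rightarrow> real"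
    using that by (intro m.integrable_const_bound[where B=1]) auto
  have *: "iexp (t * max 0 x) + iexp (t * min 0 x) = iexp (t * x) + 1" for x :: real
    by (cases "x \<ge> 0") (auto simp: max_def min_def)
  have "char (distr m borel (max 0)) t + char (distr m borel (min 0)) t =
     (\<integral>x. iexp (t * max 0 x) + iexp (t * min 0 x) \<partial>m)"
    using int[of "max 0"] int[of "min 0"]
    by (subst Bochner_Integration.integral_add) (auto simp: char_distr[OF assms])
  also have "\<dots> = (\<integral>x. iexp (t * x) + 1 \<partial>m)" by (simp only: *)
  also have "\<dots> = char m t + 1"
    using int[of "\<lambda>x. x"]
    by (subst Bochner_Integration.integral_add) (auto simp: char_def m.prob_space[simplified])
  finally show ?thesis .
qed

definition mixture :: "real \<Rightarrow> real measure \<Rightarrow> real measure \<Rightarrow> real measure" where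
  "mixture r m n = distr (measure_pmf (bernoulli_pmf r) \<Otimes>\<^sub>M (m \<Otimes>\<^sub>M n)) borel
     (\<lambda>z. if fst z then fst (snd z) else snd (snd z))"

lemma mixture:
  assumes "real_distribution m" "real_distribution n" and r: "0 \<le> r" "r \<le> 1"
  shows real_distribution_mixture: "real_distribution (mixture r m n)"
    and integral_mixture: "\<And>g :: real \<Rightarrow> 'b::{banach, second_countable_topology}.
      g \<in> borel_measurable borel \<Longrightarrow> (\<And>x. norm (g x) \<le> B) \<Longrightarrow>
      integral\<^sup>L (mixture r m n) g = r *\<^sub>R integral\<^sup>L m g + (1 - r) *\<^sub>R integral\<^sup>L n g"
proof -
  interpret m: real_distribution m by fact
  interpret n: real_distribution n by fact
  interpret P: pair_prob_space m n ..
  let ?B = "measure_pmf (bernoulli_pmf r)"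
  interpret Q: pair_prob_space ?B "m \<Otimes>\<^sub>M n" ..
  show "real_distribution (mixture r m n)"
    unfolding mixture_def by (rule Q.real_distribution_distr) measurable
  fix g :: "real \<Rightarrow> 'b"
  assume [measurable]: "g \<in> borel_measurable borel" and B: "\<And>x. norm (g x) \<le> B"
  have B0: "0 \<le> B" using B[of 0] norm_ge_zero order_trans by blast
  have "integral\<^sup>L (mixture r m n) g =
      (\<integral>b. \<integral>z. g (if b then fst z else snd z) \<partial>(m \<Otimes>\<^sub>M n) \<partial>?B)"
    unfolding mixture_def
    apply (subst integral_distr)
      apply measurable
    apply (subst Q.integral_fst'[symmetric])
     apply (rule Q.integrable_const_bound[where B=B])
      apply (simp add: B)
     apply measurable
    apply (simp cong: if_cong)
    done
  also have "\<dots> = r *\<^sub>R (\<integral>z. g (fst z) \<partial>(m \<Otimes>\<^sub>M n)) + (1 - r) *\<^sub>R (\<integral>z. g (snd z) \<partial>(m \<Otimes>\<^sub>M n))"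
    using r by (subst integral_measure_pmf[of UNIV]) (auto simp: UNIV_bool)
  also have "(\<integral>z. g (fst z) \<partial>(m \<Otimes>\<^sub>M n)) = (\<integral>x. \<integral>y. g x \<partial>n \<partial>m)"
    by (subst P.integral_fst'[symmetric]) (auto intro!: P.integrable_const_bound[where B=B] simp: B)
  also have "(\<integral>z. g (snd z) \<partial>(m \<Otimes>\<^sub>M n)) = (\<integral>x. \<integral>y. g y \<partial>n \<partial>m)"
    by (subst P.integral_fst'[symmetric]) (auto intro!: P.integrable_const_bound[where B=B] simp: B)
  finally show "integral\<^sup>L (mixture r m n) g = r *\<^sub>R integral\<^sup>L m g + (1 - r) *\<^sub>R integral\<^sup>L n g"
    by (simp add: m.prob_space[simplified] n.prob_space[simplified])
qed

text \<open>
  A finite signed measure is represented by a list of real weights and probability measures, of which it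
  is the weighted sum.  Lists make sums and products of signed measures plain list operations.
\<close>

definition signed_integral :: "(real \<times> real measure) list \<Rightarrow> (real \<Rightarrow> 'b::{banach, second_countable_topology}) \<Rightarrow> 'b" where
  "signed_integral L g = (\<Sum>(c, m)\<leftarrow>L. c *\<^sub>R integral\<^sup>L m g)"

lemma signed_integral_simps [simp]:
  "signed_integral [] g = 0" "signed_integral ((c, m) # L) g = c *\<^sub>R integral\<^sup>L m g + signed_integral L g"
  "signed_integral (L @ L') g = signed_integral L g + signed_integral L' g"
  by (auto simp: signed_integral_def)

lemma signed_integral_scale: "signed_integral (map (\<lambda>(c, m). (k * c, m)) L) g = k *\<^sub>R signed_integral L g"
  by (induction L) (auto simp: scaleR_right_distrib)

text \<open>
  With nonnegative weights the list can be merged into a multiple of a single distribution, to which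
  the uniqueness theorem for characteristic functions applies.
\<close>

lemma signed_integral_nonneg_normal_form:
  assumes "\<forall>(c, m) \<in> set L. real_distribution m \<and> 0 \<le> c"
  shows "\<exists>a u. 0 \<le> a \<and> real_distribution u \<and>
    (\<forall>(g :: real \<Rightarrow> 'b::{banach, second_countable_topology}) B.
       g \<in> borel_measurable borel \<longrightarrow> (\<forall>x. norm (g x) \<le> B) \<longrightarrow> signed_integral L g = a *\<^sub>R integral\<^sup>L u g) \<and>
    (\<forall>t. signed_integral L (\<lambda>x. iexp (t * x)) = a *\<^sub>R char u t)"
  using assms
proof (induction L)
  case Nil
  have "real_distribution (return borel (0::real))"
    by (intro real_distribution.intro prob_space_return real_distribution_axioms.intro) auto
  then show ?case by (intro exI[of _ 0]) auto
next
  case (Cons p L)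
  obtain c m where p: "p = (c, m)" by (cases p)
  have c: "0 \<le> c" and m: "real_distribution m" using Cons.prems p by auto
  obtain a u where a: "0 \<le> a" and u: "real_distribution u"
    and g: "\<And>(g :: real \<Rightarrow> 'b) B.
       g \<in> borel_measurable borel \<Longrightarrow> (\<forall>x. norm (g x) \<le> B) \<Longrightarrow> signed_integral L g = a *\<^sub>R integral\<^sup>L u g"
    and ch: "\<And>t. signed_integral L (\<lambda>x. iexp (t * x)) = a *\<^sub>R char u t"
    using Cons by force
  show ?case
  proof (cases "c + a = 0")
    case True
    then have "c = 0" "a = 0" using c a by auto
    then show ?thesis using g ch u p by (intro exI[of _ 0] exI[of _ u]) auto
  next
    case False
    define r where "r = c / (c + a)"
    have r: "0 \<le> r" "r \<le> 1" using a c False by (auto simp: r_def divide_simps)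
    have rc: "(c + a) * r = c" "(c + a) * (1 - r) = a" using False by (auto simp: r_def field_simps)
    show ?thesis
    proof (intro exI[of _ "c + a"] exI[of _ "mixture r m u"] conjI allI impI)
      show "0 \<le> c + a" using a c by simp
      show "real_distribution (mixture r m u)" by (rule real_distribution_mixture[OF m u r])
      fix g :: "real \<Rightarrow> 'b" and B assume *: "g \<in> borel_measurable borel" "\<forall>x. norm (g x) \<le> B"
      show "signed_integral (p # L) g = (c + a) *\<^sub>R integral\<^sup>L (mixture r m u) g"
        using * by (subst integral_mixture[OF m u r, where B=B])
          (auto simp: p g[OF *] scaleR_right_distrib rc simp del: scaleR_left_distrib)
    next
      fix t
      show "signed_integral (p # L) (\<lambda>x. iexp (t * x)) = (c + a) *\<^sub>R char (mixture r m u) t"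
        unfolding char_def[of "mixture r m u"]
        by (subst integral_mixture[OF m u r, where B=1])
          (auto simp: p ch scaleR_right_distrib rc char_def simp del: scaleR_left_distrib of_real_mult)
    qed
  qed
qed

text \<open>
  Moving the negative weights to the other side turns the hypothesis into an equality of
  characteristic functions of two positive measures.
\<close>

lemma signed_integral_zero_if_char_zero:
  fixes g :: "real \<Rightarrow> 'b::{banach, second_countable_topology}"
  assumes L: "\<forall>(c, m) \<in> set L. real_distribution m"
    and zero: "\<And>t. signed_integral L (\<lambda>x. iexp (t * x)) = 0"
    and g: "g \<in> borel_measurable borel" "\<And>x. norm (g x) \<le> B"
  shows "signed_integral L g = 0"
proof -
  define L1 where "L1 = filter (\<lambda>(c, m). 0 \<le> c) L"
  define L2 where "L2 = map (\<lambda>(c, m). (-1 * c, m)) (filter (\<lambda>(c, m). \<not> 0 \<le> c) L)"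
  have split: "signed_integral L f = signed_integral L1 f - signed_integral L2 f"
    for f :: "real \<Rightarrow> 'c::{banach, second_countable_topology}"
    unfolding L1_def L2_def signed_integral_scale by (induction L) auto
  have "\<forall>(c, m) \<in> set L1. real_distribution m \<and> 0 \<le> c" using L by (auto simp: L1_def)
  from signed_integral_nonneg_normal_form[OF this, where 'b='b] g
  obtain a u where a: "0 \<le> a" "real_distribution u" "signed_integral L1 g = a *\<^sub>R integral\<^sup>L u g"
     "\<And>t. signed_integral L1 (\<lambda>x. iexp (t * x)) = a *\<^sub>R char u t" by metis
  have "\<forall>(c, m) \<in> set L2. real_distribution m \<and> 0 \<le> c" using L by (auto simp: L2_def)
  from signed_integral_nonneg_normal_form[OF this, where 'b='b] g
  obtain b v where b: "0 \<le> b" "real_distribution v" "signed_integral L2 g = b *\<^sub>R integral\<^sup>L v g"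
     "\<And>t. signed_integral L2 (\<lambda>x. iexp (t * x)) = b *\<^sub>R char v t" by metis
  have eq: "a *\<^sub>R char u t = b *\<^sub>R char v t" for t
    using zero[of t] a(4) b(4) by (simp add: split)
  from eq[of 0] have ab: "a = b"
    by (simp add: real_distribution.char_zero[OF a(2)] real_distribution.char_zero[OF b(2)])
  show ?thesis
  proof (cases "a = 0")
    case True then show ?thesis using ab a b by (simp add: split)
  next
    case False
    then have "char u = char v" using eq ab by (auto simp: fun_eq_iff)
    then have "u = v" using Levy_uniqueness a b by blast
    then show ?thesis using ab a b by (simp add: split)
  qed
qed

text \<open>
  Characteristic functions of signed measures carried by H.  For H closed under addition they are
  closed under sums and products, which are pointwise operations on functions; convolution algebra thus
  becomes the algebra of complex numbers.
\<close>

definition signed_char_on :: "real set \<Rightarrow> (real \<Rightarrow> complex) \<Rightarrow> bool" where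
  "signed_char_on H f \<longleftrightarrow> (\<exists>L. (\<forall>(c, m) \<in> set L. real_distribution m \<and> (AE x in m. x \<in> H)) \<and>
     (\<forall>t. f t = signed_integral L (\<lambda>x. iexp (t * x))))"

lemma signed_char_on_char:
  "real_distribution m \<Longrightarrow> AE x in m. x \<in> H \<Longrightarrow> signed_char_on H (char m)"
  unfolding signed_char_on_def by (intro exI[of _ "[(1, m)]"]) (auto simp: char_def)

lemma signed_char_on_add:
  assumes "signed_char_on H f" "signed_char_on H g"
  shows "signed_char_on H (\<lambda>t. f t + g t)"
proof -
  from assms obtain L L' where
   "\<forall>(c, m) \<in> set L. real_distribution m \<and> (AE x in m. x \<in> H)" "\<forall>t. f t = signed_integral L (\<lambda>x. iexp (t * x))"
   "\<forall>(c, m) \<in> set L'. real_distribution m \<and> (AE x in m. x \<in> H)" "\<forall>t. g t = signed_integral L' (\<lambda>x. iexp (t * x))"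
    unfolding signed_char_on_def by blast
  then show ?thesis unfolding signed_char_on_def by (intro exI[of _ "L @ L'"]) auto
qed

lemma signed_char_on_scale:
  assumes "signed_char_on H f"
  shows "signed_char_on H (\<lambda>t. complex_of_real k * f t)"
proof -
  from assms obtain L where
   "\<forall>(c, m) \<in> set L. real_distribution m \<and> (AE x in m. x \<in> H)" "\<forall>t. f t = signed_integral L (\<lambda>x. iexp (t * x))"
    unfolding signed_char_on_def by blast
  then show ?thesis unfolding signed_char_on_def
    by (intro exI[of _ "map (\<lambda>(c, m). (k * c, m)) L"])
      (auto simp: signed_integral_scale scaleR_conv_of_real)
qed

lemma signed_char_on_const:
  assumes "0 \<in> H"
  shows "signed_char_on H (\<lambda>t. complex_of_real k)"
proof -
  have rd: "real_distribution (return borel (0::real))"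
    by (intro real_distribution.intro prob_space_return real_distribution_axioms.intro) auto
  interpret real_distribution "return borel (0::real)" by fact
  have "char (return borel 0) t = 1" for t
    unfolding char_def by (subst integral_return) auto
  moreover have "AE x in return borel 0. x \<in> H"
  proof -
    have "AE x in return borel (0::real). x = 0" by (subst AE_return) auto
    then show ?thesis by eventually_elim (use assms in auto)
  qed
  ultimately show ?thesis
    using signed_char_on_scale[OF signed_char_on_char[OF rd, of H], of k]
    by (simp add: fun_eq_iff)
qed

lemma signed_char_on_mult_char:
  assumes "signed_char_on H f" and m: "real_distribution m" "AE x in m. x \<in> H"
    and H: "\<And>x y. x \<in> H \<Longrightarrow> y \<in> H \<Longrightarrow> x + y \<in> H" and [measurable]: "H \<in> sets borel"
  shows "signed_char_on H (\<lambda>t. char m t * f t)"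
proof -
  from assms obtain L where L: "\<forall>(c, n) \<in> set L. real_distribution n \<and> (AE x in n. x \<in> H)"
    and f: "\<forall>t. f t = signed_integral L (\<lambda>x. iexp (t * x))"
    unfolding signed_char_on_def by blast
  have conv: "AE x in convolution m n. x \<in> H" if n: "real_distribution n" "AE x in n. x \<in> H" for n
  proof -
    interpret m: real_distribution m by fact
    interpret n: real_distribution n by fact
    interpret P: pair_prob_space m n ..
    have [measurable]: "Measurable.pred (m \<Otimes>\<^sub>M n) (\<lambda>z. fst z \<in> H)"
      "Measurable.pred (m \<Otimes>\<^sub>M n) (\<lambda>z. snd z \<in> H)" by measurable
    have 1: "AE z in m \<Otimes>\<^sub>M n. fst z \<in> H"
      by (subst P.AE_pair_iff[symmetric]) (measurable, use m(2) in auto)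
    have 2: "AE z in m \<Otimes>\<^sub>M n. snd z \<in> H"
      by (subst P.AE_pair_iff[symmetric]) (measurable, use n(2) in auto)
    have "AE z in m \<Otimes>\<^sub>M n. fst z + snd z \<in> H"
      using 1 2 by eventually_elim (auto intro: H)
    then show ?thesis
      unfolding convolution_def by (subst AE_distr_iff) (auto simp: case_prod_beta)
  qed
  have "char m t * signed_integral L (\<lambda>x. iexp (t * x)) =
      signed_integral (map (\<lambda>(c, n). (c, convolution m n)) L) (\<lambda>x. iexp (t * x))" for t
    using L
  proof (induction L)
    case (Cons p L)
    then show ?case
      using char_convolution[OF m(1), of "snd p" t]
      by (cases p) (auto simp: distrib_left char_def mult_scaleR_right simp del: of_real_mult)
  qed simp
  moreover have "\<forall>(c, k) \<in> set (map (\<lambda>(c, n). (c, convolution m n)) L).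
     real_distribution k \<and> (AE x in k. x \<in> H)"
    using L conv m by (auto intro: real_distribution_convolution)
  ultimately show ?thesis unfolding signed_char_on_def f[rule_format] by blast
qed

text \<open>
  The key to all factorisations below.  The two representations define the same signed measure, and the
  one on (-\<infinity>, 0] gives no mass to (0, \<infinity>); so what the other one represents is a multiple of the point
  mass at 0.
\<close>

lemma signed_char_on_both_const:
  assumes "signed_char_on {0..} f" "signed_char_on {..0} f"
  shows "f t = f 0"
proof -
  from assms obtain L L' where
   L: "\<forall>(c, m) \<in> set L. real_distribution m \<and> (AE x in m. x \<in> {0..})"
     "\<And>t. f t = signed_integral L (\<lambda>x. iexp (t * x))" and
   L': "\<forall>(c, m) \<in> set L'. real_distribution m \<and> (AE x in m. x \<in> {..0})"
     "\<And>t. f t = signed_integral L' (\<lambda>x. iexp (t * x))"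
    unfolding signed_char_on_def by blast
  (* g vanishes on (-\<infinity>, 0], and equals iexp (t x) - 1 on [0, \<infinity>): its integral is 0 in the second
     representation and f t - f 0 in the first. *)
  define g where "g t x = (indicator {0<..} x *\<^sub>R (iexp (t * x) - 1) :: complex)" for t x
  have g [measurable]: "g t \<in> borel_measurable borel" for t unfolding g_def by measurable
  have gb: "norm (g t x) \<le> 2" for t x
    unfolding g_def using norm_triangle_ineq4[of "iexp (t * x)" 1] by (auto simp: indicator_def)
  define D where "D = L @ map (\<lambda>(c, m). (- 1 * c, m)) L'"
  have D: "\<forall>(c, m) \<in> set D. real_distribution m" using L L' by (auto simp: D_def)
  have "signed_integral D (\<lambda>x. iexp (t * x)) = 0" for t
    unfolding D_def signed_integral_simps signed_integral_scale using L(2)[of t] L'(2)[of t] by simp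
  from signed_integral_zero_if_char_zero[OF D this g gb]
  have "signed_integral L (g t) = signed_integral L' (g t)"
    unfolding D_def signed_integral_simps signed_integral_scale by simp
  also have "signed_integral L' (g t) = 0" using L'(1)
  proof (induction L')
    case (Cons p L')
    obtain c m where p: "p = (c, m)" by (cases p)
    have "AE x in m. g t x = 0" using Cons.prems unfolding p g_def
      by (auto elim!: eventually_mono)
    then have "integral\<^sup>L m (g t) = 0" by (simp add: integral_eq_zero_AE)
    then show ?case using Cons p by auto
  qed simp
  also have "signed_integral L (g t) = signed_integral L (\<lambda>x. iexp (t * x)) - signed_integral L (\<lambda>x. iexp (0 * x))" using L(1)
  proof (induction L)
    case (Cons p L)
    obtain c m where p: "p = (c, m)" by (cases p)
    then have m: "real_distribution m" and ae: "AE x in m. 0 \<le> x" using Cons.prems by auto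
    interpret m: real_distribution m by fact
    have [measurable]: "g t \<in> borel_measurable m" by simp
    have "integral\<^sup>L m (g t) = (\<integral>x. iexp (t * x) - 1 \<partial>m)"
      using ae by (intro integral_cong_AE) (auto elim!: eventually_mono simp: g_def indicator_def)
    also have "\<dots> = (\<integral>x. iexp (t * x) \<partial>m) - 1"
      by (subst Bochner_Integration.integral_diff)
       (auto intro!: real_distribution_bounded_integrable[where B=1] simp: m m.prob_space[simplified])
    finally show ?case using Cons p
      by (auto simp: m.prob_space[simplified] scaleR_diff_right)
  qed simp
  finally show ?thesis using L(2)[of t] L(2)[of 0] by simp
qed

section \<open>Random walks stopped at a geometric time\<close>

lemma
  fixes \<psi> :: "nat \<Rightarrow> 'b::{banach, second_countable_topology}"
  assumes z: "0 < z" "z < 1" and s: "summable (\<lambda>n. z ^ n * norm (\<psi> n))"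
  shows integrable_geometric_pmf: "integrable (measure_pmf (geometric_pmf (1 - z))) \<psi>"
    and sums_geometric_pmf: "(\<lambda>n. ((1 - z) * z ^ n) *\<^sub>R \<psi> n) sums (\<integral>n. \<psi> n \<partial>measure_pmf (geometric_pmf (1 - z)))"
proof -
  have d: "measure_pmf (geometric_pmf (1 - z)) = density (count_space UNIV) (\<lambda>n. ennreal ((1 - z) * z ^ n))"
    unfolding measure_pmf_eq_density using z by (simp add: mult.commute)
  have "summable (\<lambda>n. (1 - z) * (z ^ n * norm (\<psi> n)))" using s by (rule summable_mult)
  then have i: "integrable (count_space UNIV) (\<lambda>n. ((1 - z) * z ^ n) *\<^sub>R \<psi> n)"
    using z by (auto simp: integrable_count_space_nat_iff mult.assoc)
  show "integrable (measure_pmf (geometric_pmf (1 - z))) \<psi>"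
    unfolding d using z i by (subst integrable_density) auto
  have "(\<integral>n. \<psi> n \<partial>measure_pmf (geometric_pmf (1 - z))) = (\<integral>n. ((1 - z) * z ^ n) *\<^sub>R \<psi> n \<partial>count_space UNIV)"
    unfolding d using z by (subst integral_density) auto
  then show "(\<lambda>n. ((1 - z) * z ^ n) *\<^sub>R \<psi> n) sums (\<integral>n. \<psi> n \<partial>measure_pmf (geometric_pmf (1 - z)))"
    using sums_integral_count_space_nat[OF i] by simp
qed

text \<open>
  A geometric time is 0 with probability 1 - z, and otherwise exceeds an independent copy by 1.
\<close>

lemma integral_geometric_pmf_first_step:
  fixes \<psi> :: "nat \<Rightarrow> 'b::{banach, second_countable_topology}"
  assumes z: "0 < z" "z < 1" and B: "\<And>n. norm (\<psi> n) \<le> B"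
  shows "(\<integral>n. \<psi> n \<partial>measure_pmf (geometric_pmf (1 - z))) =
     (1 - z) *\<^sub>R \<psi> 0 + z *\<^sub>R (\<integral>n. \<psi> (Suc n) \<partial>measure_pmf (geometric_pmf (1 - z)))"
proof -
  have s: "summable (\<lambda>n. z ^ n * norm (\<psi> (f n)))" for f
  proof (rule summable_comparison_test')
    show "summable (\<lambda>n. B * z ^ n)" using z by (intro summable_mult summable_geometric) auto
    show "norm (z ^ n * norm (\<psi> (f n))) \<le> B * z ^ n" for n
      using z B[of "f n"] by (auto simp: mult.commute[of B] intro!: mult_left_mono)
  qed
  have "(\<lambda>n. ((1 - z) * z ^ n) *\<^sub>R \<psi> (Suc n)) sums (\<integral>n. \<psi> (Suc n) \<partial>measure_pmf (geometric_pmf (1 - z)))"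
    using sums_geometric_pmf[OF z s[of Suc]] .
  from sums_scaleR_right[OF this, of z]
  have "(\<lambda>n. ((1 - z) * z ^ Suc n) *\<^sub>R \<psi> (Suc n)) sums (z *\<^sub>R (\<integral>n. \<psi> (Suc n) \<partial>measure_pmf (geometric_pmf (1 - z))))"
    by (simp add: algebra_simps)
  from sums_Suc[OF this] sums_geometric_pmf[OF z s[of "\<lambda>n. n"]] show ?thesis
    by (auto dest: sums_unique2 simp: add.commute)
qed

text \<open>
  The recursion peels off the first step.  With g = max 0, min 0 and the identity it computes the
  maximum, the minimum and the end point of the walk with steps \<xi>, so that one first-step lemma serves
  all three.
\<close>

primrec walk :: "(real \<Rightarrow> real) \<Rightarrow> nat \<Rightarrow> (nat \<Rightarrow> real) \<Rightarrow> real" where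
  "walk g 0 \<xi> = 0"
| "walk g (Suc n) \<xi> = g (\<xi> 0 + walk g n (\<lambda>i. \<xi> (Suc i)))"

abbreviation seqs :: "(nat \<Rightarrow> real) measure" where
  "seqs \<equiv> PiM UNIV (\<lambda>_. borel)"

lemma measurable_shift: "(\<lambda>\<xi> i. \<xi> (Suc i)) \<in> seqs \<rightarrow>\<^sub>M seqs"
  by (rule measurable_PiM_single') (auto simp: space_PiM)

lemma measurable_walk:
  assumes [measurable]: "g \<in> borel_measurable borel"
  shows "walk g n \<in> borel_measurable seqs"
proof (induction n)
  case (Suc n)
  have "(\<lambda>\<xi>. \<xi> 0 + walk g n (\<lambda>i. \<xi> (Suc i))) \<in> borel_measurable seqs"
    by (intro borel_measurable_add measurable_compose[OF measurable_shift Suc]) measurable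
  from measurable_compose[OF this assms] show ?case by simp
qed simp

definition geo_seq :: "real \<Rightarrow> real measure \<Rightarrow> (nat \<times> (nat \<Rightarrow> real)) measure" where
  "geo_seq z lam = measure_pmf (geometric_pmf (1 - z)) \<Otimes>\<^sub>M PiM UNIV (\<lambda>_. lam)"

text \<open>
  The geometric time has success probability 1 - z, so z is the probability of surviving a step.
\<close>

definition walk_law :: "real \<Rightarrow> real measure \<Rightarrow> (real \<Rightarrow> real) \<Rightarrow> real measure" where
  "walk_law z lam g = distr (geo_seq z lam) borel (\<lambda>p. walk g (fst p) (snd p))"

lemma sets_iid: "real_distribution lam \<Longrightarrow> sets (PiM UNIV (\<lambda>_::nat. lam)) = sets seqs"
  by (rule sets_PiM_cong) (auto simp: real_distribution.events_eq_borel)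

lemma prob_space_iid: "real_distribution lam \<Longrightarrow> prob_space (PiM UNIV (\<lambda>_::nat. lam))"
  by (rule prob_space_PiM) (simp add: real_distribution_def)

lemma prob_space_geo_seq:
  assumes "real_distribution lam" shows "prob_space (geo_seq z lam)"
proof -
  interpret S: prob_space "PiM UNIV (\<lambda>_::nat. lam)" using prob_space_iid[OF assms] .
  interpret P: pair_prob_space "measure_pmf (geometric_pmf (1 - z))" "PiM UNIV (\<lambda>_::nat. lam)" ..
  show ?thesis unfolding geo_seq_def by (rule P.prob_space_axioms)
qed

lemma sets_geo_seq: "real_distribution lam \<Longrightarrow> sets (geo_seq z lam) = sets (count_space UNIV \<Otimes>\<^sub>M seqs)"
  unfolding geo_seq_def by (rule sets_pair_measure_cong) (auto simp: sets_iid)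

lemma measurable_geo_seq:
  assumes "real_distribution lam" "f \<in> (count_space UNIV \<Otimes>\<^sub>M seqs) \<rightarrow>\<^sub>M N"
  shows "f \<in> geo_seq z lam \<rightarrow>\<^sub>M N"
  unfolding measurable_cong_sets[OF sets_geo_seq[OF assms(1)] refl] by (rule assms(2))

lemma measurable_nat_seq:
  assumes "\<And>n. (\<lambda>\<xi>. f (n, \<xi>)) \<in> seqs \<rightarrow>\<^sub>M N"
  shows "f \<in> (count_space (UNIV::nat set) \<Otimes>\<^sub>M seqs) \<rightarrow>\<^sub>M N"
  using assms by (intro measurable_pair_measure_countable1) auto

lemma integral_pmf_seq:
  fixes f :: "nat \<times> (nat \<Rightarrow> real) \<Rightarrow> 'b::{banach, second_countable_topology}"
  assumes lam: "real_distribution lam" and m: "\<And>n. (\<lambda>\<xi>. f (n, \<xi>)) \<in> borel_measurable seqs" and B: "\<And>x. norm (f x) \<le> B"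
  shows "integral\<^sup>L (measure_pmf p \<Otimes>\<^sub>M PiM UNIV (\<lambda>_. lam)) f =
    (\<integral>n. \<integral>\<xi>. f (n, \<xi>) \<partial>PiM UNIV (\<lambda>_. lam) \<partial>measure_pmf p)"
proof -
  interpret S: prob_space "PiM UNIV (\<lambda>_::nat. lam)" using prob_space_iid[OF lam] .
  interpret P: pair_prob_space "measure_pmf p" "PiM UNIV (\<lambda>_::nat. lam)" ..
  have sets: "sets (measure_pmf p \<Otimes>\<^sub>M PiM UNIV (\<lambda>_. lam)) = sets (count_space UNIV \<Otimes>\<^sub>M seqs)"
    by (rule sets_pair_measure_cong) (auto simp: sets_iid[OF lam])
  have "f \<in> borel_measurable (measure_pmf p \<Otimes>\<^sub>M PiM UNIV (\<lambda>_. lam))"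
    unfolding measurable_cong_sets[OF sets refl] by (rule measurable_nat_seq[OF m])
  then have "integrable (measure_pmf p \<Otimes>\<^sub>M PiM UNIV (\<lambda>_. lam)) f"
    using B by (intro P.integrable_const_bound[where B=B]) auto
  then show ?thesis by (rule P.integral_fst'[symmetric])
qed

lemmas integral_geo_seq = integral_pmf_seq[where p="geometric_pmf (1 - z)" for z, folded geo_seq_def]

lemma integral_iid_first_step:
  fixes f :: "(nat \<Rightarrow> real) \<Rightarrow> 'b::{banach, second_countable_topology}"
  assumes lam: "real_distribution lam" and f: "f \<in> borel_measurable seqs" "\<And>x. norm (f x) \<le> B"
  shows "(\<integral>\<xi>. f \<xi> \<partial>PiM UNIV (\<lambda>_. lam)) = (\<integral>x. \<integral>\<xi>. f (case_nat x \<xi>) \<partial>PiM UNIV (\<lambda>_. lam) \<partial>lam)"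
proof -
  interpret real_distribution lam by fact
  interpret S: sequence_space lam ..
  interpret P: pair_prob_space lam "PiM UNIV (\<lambda>_::nat. lam)" ..
  have sets: "sets (PiM UNIV (\<lambda>_::nat. lam)) = sets seqs" by (rule sets_iid[OF lam])
  have f': "f \<in> borel_measurable (PiM UNIV (\<lambda>_::nat. lam))"
    unfolding measurable_cong_sets[OF sets refl] by (rule f(1))
  have m: "(\<lambda>(s, \<omega>). case_nat s \<omega>) \<in> lam \<Otimes>\<^sub>M (PiM UNIV (\<lambda>_::nat. lam)) \<rightarrow>\<^sub>M PiM UNIV (\<lambda>_::nat. lam)"
    by measurable
  have fm: "(\<lambda>p. f (case_nat (fst p) (snd p))) \<in> borel_measurable (lam \<Otimes>\<^sub>M (PiM UNIV (\<lambda>_::nat. lam)))"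
    using measurable_compose[OF m f'] by (simp add: case_prod_beta)
  have "(\<integral>\<xi>. f \<xi> \<partial>PiM UNIV (\<lambda>_. lam)) = (\<integral>\<xi>. f \<xi> \<partial>distr (lam \<Otimes>\<^sub>M (PiM UNIV (\<lambda>_::nat. lam))) (PiM UNIV (\<lambda>_::nat. lam)) (\<lambda>(s, \<omega>). case_nat s \<omega>))"
    by (simp only: S.PiM_iter)
  also have "\<dots> = (\<integral>p. f (case_nat (fst p) (snd p)) \<partial>(lam \<Otimes>\<^sub>M (PiM UNIV (\<lambda>_::nat. lam))))"
    by (subst integral_distr[OF m f']) (simp add: case_prod_beta)
  also have "\<dots> = (\<integral>x. \<integral>\<xi>. f (case_nat x \<xi>) \<partial>PiM UNIV (\<lambda>_. lam) \<partial>lam)"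
    by (subst P.integral_fst'[symmetric]) (auto intro!: P.integrable_const_bound[where B=B] simp: f fm)
  finally show ?thesis .
qed

lemma measurable_walk_pair:
  assumes "g \<in> borel_measurable borel"
  shows "(\<lambda>p. walk g (fst p) (snd p)) \<in> borel_measurable (count_space UNIV \<Otimes>\<^sub>M seqs)"
  using measurable_walk[OF assms] by (intro measurable_nat_seq) simp

lemma real_distribution_walk_law:
  assumes "real_distribution lam" "g \<in> borel_measurable borel"
  shows "real_distribution (walk_law z lam g)"
proof -
  interpret prob_space "geo_seq z lam" by (rule prob_space_geo_seq[OF assms(1)])
  show ?thesis unfolding walk_law_def
    by (intro real_distribution_distr measurable_geo_seq measurable_walk_pair assms)
qed

lemma integral_walk_law:
  fixes f :: "real \<Rightarrow> 'b::{banach, second_countable_topology}"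
  assumes lam: "real_distribution lam" and g: "g \<in> borel_measurable borel"
   and [measurable]: "f \<in> borel_measurable borel" and B: "\<And>x. norm (f x) \<le> B"
  shows "integral\<^sup>L (walk_law z lam g) f =
    (\<integral>n. \<integral>\<xi>. f (walk g n \<xi>) \<partial>PiM UNIV (\<lambda>_. lam) \<partial>measure_pmf (geometric_pmf (1 - z)))"
proof -
  note measurable_walk[OF g, measurable]
  have "(\<lambda>p. walk g (fst p) (snd p)) \<in> borel_measurable (geo_seq z lam)"
    by (intro measurable_geo_seq measurable_walk_pair lam g)
  then show ?thesis
    unfolding walk_law_def by (subst integral_distr) (auto simp: B integral_geo_seq[OF lam, where B=B])
qed

text \<open>
  The fixed point equation m = (1 - z) \<delta> + z g(lam * m), where g stands for the pushforward.
\<close>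

lemma integral_walk_law_first_step:
  fixes f :: "real \<Rightarrow> 'b::{banach, second_countable_topology}"
  assumes lam: "real_distribution lam" and z: "0 < z" "z < 1"
   and g [measurable]: "g \<in> borel_measurable borel"
   and f [measurable]: "f \<in> borel_measurable borel" and B: "\<And>x. norm (f x) \<le> B"
  shows "integral\<^sup>L (walk_law z lam g) f =
    (1 - z) *\<^sub>R f 0 + z *\<^sub>R (\<integral>x. f (g x) \<partial>convolution lam (walk_law z lam g))"
proof -
  let ?S = "PiM UNIV (\<lambda>_::nat. lam)" and ?G = "measure_pmf (geometric_pmf (1 - z))"
  interpret L: real_distribution lam by fact
  interpret S: prob_space ?S using prob_space_iid[OF lam] .
  interpret P: pair_prob_space ?G lam ..
  note measurable_walk[OF g, measurable]
  note sets_iid[OF lam, measurable_cong]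
  have w: "norm (\<integral>\<xi>. f (h \<xi>) \<partial>?S) \<le> B" for h
    by (rule norm_integral_prob_le) (auto simp: B S.prob_space_axioms)
  have "integral\<^sup>L (walk_law z lam g) f = (\<integral>n. \<integral>\<xi>. f (walk g n \<xi>) \<partial>?S \<partial>?G)"
    by (rule integral_walk_law[OF lam g f B])
  also have "\<dots> = (1 - z) *\<^sub>R f 0 + z *\<^sub>R (\<integral>n. \<integral>\<xi>. f (walk g (Suc n) \<xi>) \<partial>?S \<partial>?G)"
    by (subst integral_geometric_pmf_first_step[OF z, where B=B])
      (auto simp: w S.prob_space)
  also have "(\<lambda>n. \<integral>\<xi>. f (walk g (Suc n) \<xi>) \<partial>?S) = (\<lambda>n. \<integral>x. \<integral>\<xi>. f (g (x + walk g n \<xi>)) \<partial>?S \<partial>lam)"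
  proof
    fix n
    have "(\<integral>\<xi>. f (walk g (Suc n) \<xi>) \<partial>?S) =
        (\<integral>x. \<integral>\<xi>. f (walk g (Suc n) (case_nat x \<xi>)) \<partial>?S \<partial>lam)"
      using measurable_walk[OF g, of "Suc n"]
      by (intro integral_iid_first_step[OF lam, where B=B]) (auto simp: B simp del: walk.simps)
    then show "(\<integral>\<xi>. f (walk g (Suc n) \<xi>) \<partial>?S) = (\<integral>x. \<integral>\<xi>. f (g (x + walk g n \<xi>)) \<partial>?S \<partial>lam)"
      by simp
  qed
  also have "(\<integral>n. \<integral>x. \<integral>\<xi>. f (g (x + walk g n \<xi>)) \<partial>?S \<partial>lam \<partial>?G) =
     (\<integral>x. \<integral>n. \<integral>\<xi>. f (g (x + walk g n \<xi>)) \<partial>?S \<partial>?G \<partial>lam)"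
  proof (rule P.Fubini_integral[symmetric])
    have "(\<lambda>p. \<integral>\<xi>. f (g (snd p + walk g (fst p) \<xi>)) \<partial>?S) \<in> borel_measurable (?G \<Otimes>\<^sub>M lam)"
    proof -
      have "(\<lambda>p. \<integral>\<xi>. f (g (snd p + walk g (fst p) \<xi>)) \<partial>?S) \<in> borel_measurable (count_space UNIV \<Otimes>\<^sub>M lam)"
        by (rule measurable_pair_measure_countable1) auto
      then show ?thesis by (simp cong: measurable_cong_sets sets_pair_measure_cong)
    qed
    then show "integrable (?G \<Otimes>\<^sub>M lam) (\<lambda>(n, x). \<integral>\<xi>. f (g (x + walk g n \<xi>)) \<partial>?S)"
      by (intro P.integrable_const_bound[where B=B]) (auto simp: w case_prod_beta)
  qed
  also have "\<dots> = (\<integral>x. \<integral>y. f (g (x + y)) \<partial>walk_law z lam g \<partial>lam)"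
    by (subst integral_walk_law[OF lam g, where B=B]) (auto simp: B)
  also have "\<dots> = (\<integral>x. f (g x) \<partial>convolution lam (walk_law z lam g))"
    by (rule integral_convolution[symmetric, OF lam real_distribution_walk_law[OF lam g], where B=B])
      (auto simp: B)
  finally show ?thesis .
qed

lemma AE_walk_law:
  assumes "real_distribution lam" "g \<in> borel_measurable borel" "0 \<in> H" "\<And>x. g x \<in> H" "H \<in> sets borel"
  shows "AE x in walk_law z lam g. x \<in> H"
proof -
  have "walk g n \<xi> \<in> H" for n \<xi> using assms by (cases n) auto
  then show ?thesis unfolding walk_law_def
    using assms measurable_geo_seq[OF assms(1) measurable_walk_pair[OF assms(2)]]
    by (subst AE_distr_iff) auto
qed

lemma char_walk_law:
  assumes "real_distribution lam" "0 < z" "z < 1" "g \<in> borel_measurable borel"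
  shows "char (walk_law z lam g) t =
    complex_of_real (1 - z) + complex_of_real z * char (distr (convolution lam (walk_law z lam g)) borel g) t"
proof -
  note rd = real_distribution_convolution[OF assms(1) real_distribution_walk_law[OF assms(1,4)]]
  show ?thesis
    unfolding char_distr[OF rd assms(4)]
    unfolding char_def
    by (subst integral_walk_law_first_step[OF assms, where B=1]) (auto simp: scaleR_conv_of_real)
qed

section \<open>Wiener--Hopf factorisation of a killed random walk\<close>

locale step_law = real_distribution lam for lam
begin

lemma lam: "real_distribution lam" ..

abbreviation "max_law z \<equiv> walk_law z lam (max 0)"
abbreviation "min_law z \<equiv> walk_law z lam (min 0)"
abbreviation "sum_law z \<equiv> walk_law z lam (\<lambda>x. x)"

lemma rd [simp]: "real_distribution (max_law z)" "real_distribution (min_law z)" "real_distribution (sum_law z)"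
  by (auto intro!: real_distribution_walk_law lam)

text \<open>
  These are the parts P and N of the convolutions that occur in the two fixed point equations; the
  other parts are eliminated through char_max_plus_min.
\<close>

abbreviation "overshoot z \<equiv> distr (convolution lam (min_law z)) borel (max 0)"
abbreviation "undershoot z \<equiv> distr (convolution lam (max_law z)) borel (min 0)"

lemma rd2 [simp]: "real_distribution (overshoot z)" "real_distribution (undershoot z)"
  by (auto intro!: real_distribution_distr_borel real_distribution_convolution lam)

lemma AE_max_law: "AE x in max_law z. x \<in> {0..}" and AE_min_law: "AE x in min_law z. x \<in> {..0}"
  by (rule AE_walk_law[OF lam]; simp)+

lemma AE_distr_clamp:
  assumes "real_distribution m"
  shows "AE x in distr m borel (max 0). x \<in> {0..}" "AE x in distr m borel (min 0). x \<in> {..0}"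
proof -
  interpret m: real_distribution m by fact
  show "AE x in distr m borel (max 0). x \<in> {0..}" "AE x in distr m borel (min 0). x \<in> {..0}"
    by (auto simp: AE_distr_iff)
qed

lemma char_max_law_lam:
  assumes "0 < z" "z < 1"
  shows "char (max_law z) t * (1 - complex_of_real z * char lam t) = 1 - complex_of_real z * char (undershoot z) t"
proof -
  let ?m = "convolution lam (max_law z)"
  have "char (max_law z) t = (1 - z) + z * char (distr ?m borel (max 0)) t"
    using char_walk_law[OF lam assms, of "max 0" t] by simp
  moreover have "char (distr ?m borel (max 0)) t + char (distr ?m borel (min 0)) t = char lam t * char (max_law z) t + 1"
    using char_max_plus_min[OF real_distribution_convolution[OF lam rd(1)]] char_convolution[OF lam rd(1)] by metis
  ultimately show ?thesis unfolding of_real_diff of_real_1 by algebra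
qed

lemma char_min_law_lam:
  assumes "0 < z" "z < 1"
  shows "char (min_law z) t * (1 - complex_of_real z * char lam t) = 1 - complex_of_real z * char (overshoot z) t"
proof -
  let ?m = "convolution lam (min_law z)"
  have "char (min_law z) t = (1 - z) + z * char (distr ?m borel (min 0)) t"
    using char_walk_law[OF lam assms, of "min 0" t] by simp
  moreover have "char (distr ?m borel (max 0)) t + char (distr ?m borel (min 0)) t = char lam t * char (min_law z) t + 1"
    using char_max_plus_min[OF real_distribution_convolution[OF lam rd(2)]] char_convolution[OF lam rd(2)] by metis
  ultimately show ?thesis unfolding of_real_diff of_real_1 by algebra
qed

lemma char_sum_law_lam:
  assumes "0 < z" "z < 1"
  shows "char (sum_law z) t * (1 - complex_of_real z * char lam t) = 1 - complex_of_real z"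
  using char_walk_law[OF lam assms, of "\<lambda>x. x" t] char_convolution[OF lam rd(3), of z t]
  by (simp add: algebra_simps distr_id2)

lemma signed_max_law_overshoot:
  "signed_char_on {0..} (\<lambda>t. char (max_law z) t * (1 - complex_of_real w * char (overshoot w) t))"
proof -
  have "signed_char_on {0..} (\<lambda>t. complex_of_real 1 + complex_of_real (- w) * char (overshoot w) t)"
    by (intro signed_char_on_add signed_char_on_const signed_char_on_scale signed_char_on_char AE_distr_clamp
       real_distribution_convolution lam rd rd2) auto
  then have "signed_char_on {0..} (\<lambda>t. char (max_law z) t * (complex_of_real 1 + complex_of_real (- w) * char (overshoot w) t))"
    by (intro signed_char_on_mult_char AE_max_law rd) auto
  then show ?thesis by simp
qed

lemma signed_min_law_undershoot:
  "signed_char_on {..0} (\<lambda>t. char (min_law z) t * (1 - complex_of_real w * char (undershoot w) t))"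
proof -
  have "signed_char_on {..0} (\<lambda>t. complex_of_real 1 + complex_of_real (- w) * char (undershoot w) t)"
    by (intro signed_char_on_add signed_char_on_const signed_char_on_scale signed_char_on_char AE_distr_clamp
       real_distribution_convolution lam rd rd2) auto
  then have "signed_char_on {..0} (\<lambda>t. char (min_law z) t * (complex_of_real 1 + complex_of_real (- w) * char (undershoot w) t))"
    by (intro signed_char_on_mult_char AE_min_law rd) auto
  then show ?thesis by simp
qed

lemma char0 [simp]: "real_distribution m \<Longrightarrow> char m 0 = 1"
  by (rule real_distribution.char_zero)

text \<open>
  Multiplying the equation for the maximum by the characteristic function of the minimum, and vice
  versa, gives the same function; one expression is carried by [0, \<infinity>), the other by (-\<infinity>, 0].
\<close>

lemma
  assumes z: "0 < z" "z < 1"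
  shows char_max_law_overshoot: "char (max_law z) t * (1 - complex_of_real z * char (overshoot z) t) = 1 - complex_of_real z"
    and char_min_law_undershoot: "char (min_law z) t * (1 - complex_of_real z * char (undershoot z) t) = 1 - complex_of_real z"
    and char_max_law_min_law_lam: "char (max_law z) t * char (min_law z) t * (1 - complex_of_real z * char lam t) = 1 - complex_of_real z"
proof -
  have eq: "char (max_law z) t * (1 - complex_of_real z * char (overshoot z) t) = char (min_law z) t * (1 - complex_of_real z * char (undershoot z) t)" for t
    using char_max_law_lam[OF z, of t] char_min_law_lam[OF z, of t] by algebra
  have "signed_char_on {..0} (\<lambda>t. char (max_law z) t * (1 - complex_of_real z * char (overshoot z) t))"
    unfolding eq by (rule signed_min_law_undershoot)
  from signed_char_on_both_const[OF signed_max_law_overshoot this, of t]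
  show 1: "char (max_law z) t * (1 - complex_of_real z * char (overshoot z) t) = 1 - complex_of_real z" by simp
  then show "char (min_law z) t * (1 - complex_of_real z * char (undershoot z) t) = 1 - complex_of_real z" using eq by simp
  show "char (max_law z) t * char (min_law z) t * (1 - complex_of_real z * char lam t) = 1 - complex_of_real z"
    using 1 char_min_law_lam[OF z, of t] by algebra
qed

theorem char_sum_law_eq_max_law_min_law:
  assumes z: "0 < z" "z < 1"
  shows "char (sum_law z) t = char (max_law z) t * char (min_law z) t"
proof -
  have "1 - complex_of_real z \<noteq> 0" using z by (metis eq_iff_diff_eq_0 less_irrefl of_real_1 of_real_eq_iff)
  then have "1 - z * char lam t \<noteq> 0" using char_sum_law_lam[OF z, of t] by auto
  then show ?thesis using char_sum_law_lam[OF z, of t] char_max_law_min_law_lam[OF z, of t]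
    by (metis mult_right_cancel)
qed

text \<open>
  Change of the killing parameter.  The resolvents at z and w are linearly related; inserting the
  factorisation at z for the one and at w for the other, and splitting the cross term into its parts P
  and N, one again meets an identity between the two half-lines.
\<close>

lemma
  assumes z: "0 < z" "z < 1" and w: "0 < w" "w < 1"
  defines "cross_law \<equiv> convolution (min_law w) (max_law z)"
  shows max_law_relation: "complex_of_real (1 - w) * char (max_law z) t = char (max_law w) t *
      (complex_of_real (w / z * (1 - z)) + complex_of_real (1 - w / z) * char (distr cross_law borel (max 0)) t)" (is ?A)
    and min_law_relation: "complex_of_real (w / z * (1 - z)) * char (min_law w) t = char (min_law z) t *
      (complex_of_real (1 - w) - complex_of_real (1 - w / z) * char (distr cross_law borel (min 0)) t)" (is ?B)
proof -
  define r where "r = w / z"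
  have rz: "r * z = w" using z by (simp add: r_def)
  then have rz': "complex_of_real r * complex_of_real z = w" by (metis of_real_mult)
  have cross_law: "real_distribution cross_law" unfolding cross_law_def by (intro real_distribution_convolution rd)
  have k: "char cross_law t = char (min_law w) t * char (max_law z) t" for t
    unfolding cross_law_def by (rule char_convolution) auto
  note kap' = real_distribution_distr_borel[OF cross_law, of "max 0"] real_distribution_distr_borel[OF cross_law, of "min 0"]
  let ?P = "char (distr cross_law borel (max 0))" and ?N = "char (distr cross_law borel (min 0))"
  define f where "f t = char (max_law z) t * (1 - complex_of_real w * char (overshoot w) t) + complex_of_real (- (1 - r)) * ?P t" for t
  have eq: "f t = complex_of_real r * (char (min_law w) t * (1 - complex_of_real z * char (undershoot z) t))
     + complex_of_real (1 - r) * (?N t + complex_of_real (- 1))" for t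
    using char_max_law_lam[OF z, of t] char_min_law_lam[OF w, of t] char_max_plus_min[OF cross_law, of t] rz' k[of t]
    unfolding f_def of_real_diff of_real_minus of_real_1 by algebra
  have 1: "signed_char_on {0..} f"
    unfolding f_def
    by (intro signed_char_on_add signed_max_law_overshoot signed_char_on_scale signed_char_on_char AE_distr_clamp cross_law kap') auto
  have 2: "signed_char_on {..0} f"
    unfolding eq
    by (intro signed_char_on_add signed_min_law_undershoot signed_char_on_scale signed_char_on_char AE_distr_clamp
      cross_law kap' signed_char_on_const) auto
  have f0: "f t = r - w" using signed_char_on_both_const[OF 1 2, of t]
    unfolding f_def using kap' by simp
  show ?A
    unfolding r_def[symmetric] using f0[unfolded f_def] char_max_law_overshoot[OF w, of t] rz'
    unfolding of_real_diff of_real_minus of_real_1 of_real_mult by algebra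
  show ?B
    unfolding r_def[symmetric] using f0[unfolded eq] char_min_law_undershoot[OF z, of t] rz'
    unfolding of_real_diff of_real_minus of_real_1 of_real_mult by algebra
qed

end

section \<open>A random walk with level-dependent killing\<close>

definition bdd_borel :: "(real \<Rightarrow> real) \<Rightarrow> bool" where
  "bdd_borel g \<longleftrightarrow> g \<in> borel_measurable borel \<and> (\<exists>B. \<forall>x. \<bar>g x\<bar> \<le> B)"

text \<open>
  The expectation of g at x plus an m-distributed shift.  These operators commute, and they compose like
  convolutions.
\<close>

definition conv_op :: "real measure \<Rightarrow> (real \<Rightarrow> real) \<Rightarrow> real \<Rightarrow> real" where
  "conv_op m g x = (\<integral>u. g (x + u) \<partial>m)"

lemma bdd_borelI: "g \<in> borel_measurable borel \<Longrightarrow> (\<And>x. \<bar>g x\<bar> \<le> B) \<Longrightarrow> bdd_borel g"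
  by (auto simp: bdd_borel_def)

lemma bdd_borel_add:
  assumes "bdd_borel f" "bdd_borel g" shows "bdd_borel (\<lambda>x. f x + g x)"
proof -
  obtain A where A: "\<And>x. \<bar>f x\<bar> \<le> A" using assms by (auto simp: bdd_borel_def)
  obtain B where B: "\<And>x. \<bar>g x\<bar> \<le> B" using assms by (auto simp: bdd_borel_def)
  have "\<bar>f x + g x\<bar> \<le> A + B" for x using A[of x] B[of x] by linarith
  then show ?thesis using assms by (auto simp: bdd_borel_def)
qed

lemma bdd_borel_mult:
  assumes "bdd_borel f" "bdd_borel g" shows "bdd_borel (\<lambda>x. f x * g x)"
proof -
  obtain A where A: "\<And>x. \<bar>f x\<bar> \<le> A" using assms by (auto simp: bdd_borel_def)
  obtain B where B: "\<And>x. \<bar>g x\<bar> \<le> B" using assms by (auto simp: bdd_borel_def)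
  have "\<bar>f x * g x\<bar> \<le> A * B" for x unfolding abs_mult
    by (intro mult_mono A B) (use order_trans[OF abs_ge_zero A] in auto)
  then show ?thesis using assms by (auto simp: bdd_borel_def)
qed

lemma bdd_borel_const: "bdd_borel (\<lambda>_. c)"
  by (auto simp: bdd_borel_def)

lemma bdd_borel_diff: "bdd_borel f \<Longrightarrow> bdd_borel g \<Longrightarrow> bdd_borel (\<lambda>x. f x - g x)"
  using bdd_borel_add[OF _ bdd_borel_mult[OF bdd_borel_const[of "-1"]], of f g] by simp

lemma bdd_borel_indicator: "A \<in> sets borel \<Longrightarrow> bdd_borel (indicator A)"
  by (rule bdd_borelI[where B=1]) (auto simp: indicator_def)

lemma bdd_borel_shift: "bdd_borel g \<Longrightarrow> bdd_borel (\<lambda>u. g (x + u))"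
  by (auto simp: bdd_borel_def)

lemma bdd_borel_integrable: "real_distribution m \<Longrightarrow> bdd_borel g \<Longrightarrow> integrable m g"
  unfolding bdd_borel_def real_norm_def[symmetric] using real_distribution_bounded_integrable by blast

lemma bdd_borel_conv_op:
  assumes m: "real_distribution m" and g: "bdd_borel g"
  shows "bdd_borel (conv_op m g)"
proof -
  interpret real_distribution m by fact
  obtain B where B: "\<And>x. \<bar>g x\<bar> \<le> B" using g by (auto simp: bdd_borel_def)
  have [measurable]: "g \<in> borel_measurable borel" using g by (auto simp: bdd_borel_def)
  have "norm (conv_op m g x) \<le> B" for x
    unfolding conv_op_def using B by (intro norm_integral_prob_le prob_space_axioms) auto
  moreover have "conv_op m g \<in> borel_measurable borel" unfolding conv_op_def[abs_def] by measurable
  ultimately show ?thesis by (intro bdd_borelI[where B=B]) auto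
qed

lemmas bdd_borel_intros = bdd_borel_add bdd_borel_mult bdd_borel_const bdd_borel_diff bdd_borel_conv_op
  bdd_borel_indicator

lemma conv_op_add:
  assumes "real_distribution m" "bdd_borel f" "bdd_borel g"
  shows "conv_op m (\<lambda>x. f x + g x) = (\<lambda>x. conv_op m f x + conv_op m g x)"
  unfolding conv_op_def[abs_def] using assms
  by (subst Bochner_Integration.integral_add) (auto intro!: bdd_borel_integrable bdd_borel_shift)

lemma conv_op_diff:
  assumes "real_distribution m" "bdd_borel f" "bdd_borel g"
  shows "conv_op m (\<lambda>x. f x - g x) = (\<lambda>x. conv_op m f x - conv_op m g x)"
  unfolding conv_op_def[abs_def] using assms
  by (subst Bochner_Integration.integral_diff) (auto intro!: bdd_borel_integrable bdd_borel_shift)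

lemma conv_op_scale: "conv_op m (\<lambda>x. c * f x) = (\<lambda>x. c * conv_op m f x)"
  unfolding conv_op_def[abs_def] by simp

lemma conv_op_convolution:
  assumes "real_distribution m" "real_distribution n" "bdd_borel g"
  shows "conv_op (convolution m n) g = conv_op m (conv_op n g)" and "conv_op (convolution m n) g = conv_op n (conv_op m g)"
proof -
  obtain B where B: "\<And>x. \<bar>g x\<bar> \<le> B" using assms by (auto simp: bdd_borel_def)
  have [measurable]: "g \<in> borel_measurable borel" using assms by (auto simp: bdd_borel_def)
  show "conv_op (convolution m n) g = conv_op m (conv_op n g)"
    unfolding conv_op_def[abs_def]
    by (subst integral_convolution[OF assms(1,2), where B=B]) (auto simp: B add.assoc)
  show "conv_op (convolution m n) g = conv_op n (conv_op m g)"
    unfolding conv_op_def[abs_def]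
    by (subst integral_convolution_swap[OF assms(1,2), where B=B]) (auto simp: B add.assoc add.commute add.left_commute)
qed

lemma conv_op_commute:
  assumes "real_distribution m" "real_distribution n" "bdd_borel g"
  shows "conv_op m (conv_op n g) = conv_op n (conv_op m g)"
  using conv_op_convolution[OF assms] by simp

lemma conv_op_zero_on_Iic:
  assumes "AE u in m. u \<le> 0" "\<And>v. v \<le> b \<Longrightarrow> g v = 0" "x \<le> b"
  shows "conv_op m g x = 0"
  unfolding conv_op_def using assms(1) by (intro integral_eq_zero_AE) (auto elim!: eventually_mono intro!: assms(2) simp: assms(3) add_decreasing2)

lemma conv_op_zero_on_Ioi:
  assumes "AE u in m. 0 \<le> u" "\<And>v. b < v \<Longrightarrow> g v = 0" "b < x"
  shows "conv_op m g x = 0"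
  unfolding conv_op_def using assms(1)
proof (intro integral_eq_zero_AE, eventually_elim)
  fix u :: real assume "0 \<le> u" then show "g (x + u) = 0" using assms by (intro assms(2)) simp
qed

lemma real_distribution_return: "real_distribution (return borel (c::real))"
  by (intro real_distribution.intro prob_space_return real_distribution_axioms.intro) auto

lemma char_return: "char (return borel c) t = iexp (t * c)"
  unfolding char_def by (subst integral_return) auto

lemma conv_op_return: "bdd_borel g \<Longrightarrow> conv_op (return borel 0) g x = g x"
  unfolding conv_op_def by (subst integral_return) (auto simp: bdd_borel_def)

text \<open>
  Transfers the identities between characteristic functions to arbitrary bounded Borel functions.
\<close>

lemma conv_op_relation:
  assumes rd: "real_distribution m1" "real_distribution m2" "real_distribution m3"
    and ch: "\<And>t. complex_of_real a1 * char m1 t + complex_of_real a2 * char m2 t + complex_of_real a3 * char m3 t = 0"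
    and g: "bdd_borel g"
  shows "a1 * conv_op m1 g x + a2 * conv_op m2 g x + a3 * conv_op m3 g x = 0"
proof -
  obtain B where B: "\<And>x. \<bar>g x\<bar> \<le> B" using g by (auto simp: bdd_borel_def)
  have [measurable]: "g \<in> borel_measurable borel" using g by (auto simp: bdd_borel_def)
  have "signed_integral [(a1, m1), (a2, m2), (a3, m3)] (\<lambda>u. g (x + u)) = 0"
  proof (rule signed_integral_zero_if_char_zero)
    show "signed_integral [(a1, m1), (a2, m2), (a3, m3)] (\<lambda>x. iexp (t * x)) = 0" for t
      using ch[of t] by (simp add: char_def scaleR_conv_of_real add.assoc)
  qed (use rd B in auto)
  then show ?thesis by (simp add: conv_op_def)
qed

context step_law begin

text \<open>
  By the Wiener--Hopf factorisation, (1 - z) times the resolvent of the walk is the composition of the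
  operators of minimum and maximum.
\<close>

lemma conv_op_max_law_min_law_resolvent:
  assumes z: "0 < z" "z < 1" and g: "bdd_borel g"
  shows "conv_op (min_law z) (conv_op (max_law z) g) x - z * conv_op (min_law z) (conv_op (max_law z) (conv_op lam g)) x = (1 - z) * g x"
proof -
  let ?J = "convolution (min_law z) (max_law z)"
  have J: "real_distribution ?J" by (intro real_distribution_convolution rd)
  have "1 * conv_op ?J g x + (- z) * conv_op (convolution ?J lam) g x + (- (1 - z)) * conv_op (return borel 0) g x = 0"
    using char_max_law_min_law_lam[OF z]
    by (intro conv_op_relation J real_distribution_convolution lam real_distribution_return g)
      (simp add: char_convolution J lam char_return algebra_simps)
  then show ?thesis
    by (simp add: conv_op_convolution(1)[OF J lam g] conv_op_convolution(1)[OF rd(2,1)] g bdd_borel_conv_op lam conv_op_return algebra_simps)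
qed

text \<open>
  Completing the composition by the missing factor gives a resolvent, which is injective; this is
  done once for z and once for w.
\<close>

lemma conv_op_max_law_min_law_injective:
  assumes z: "0 < z" "z < 1" and w: "0 < w" "w < 1" and g: "bdd_borel g"
    and zero: "\<And>x. conv_op (min_law z) (conv_op (max_law w) g) x = 0"
  shows "g x = 0"
proof -
  have cancel: "h x = 0" if h: "bdd_borel h" and v: "0 < v" "v < 1"
    and 0: "conv_op (min_law v) (conv_op (max_law v) h) = (\<lambda>_. 0)" for h v x
  proof -
    have "conv_op (min_law v) (conv_op (max_law v) (conv_op lam h)) = conv_op lam (conv_op (min_law v) (conv_op (max_law v) h))"
      by (simp add: conv_op_commute[of lam "min_law v"] conv_op_commute[of lam "max_law v"] lam h bdd_borel_conv_op)
    then have "conv_op (min_law v) (conv_op (max_law v) (conv_op lam h)) = (\<lambda>_. 0)" unfolding 0 by (simp add: conv_op_def[abs_def])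
    then show ?thesis using conv_op_max_law_min_law_resolvent[OF v h, of x] 0 v by simp
  qed
  have g': "bdd_borel (conv_op (max_law w) g)" by (intro bdd_borel_conv_op g rd)
  have "conv_op (min_law z) (conv_op (max_law z) (conv_op (max_law w) g)) = conv_op (max_law z) (conv_op (min_law z) (conv_op (max_law w) g))"
    by (intro conv_op_commute rd g')
  also have "\<dots> = (\<lambda>_. 0)" using zero by (simp add: conv_op_def[abs_def])
  finally have "conv_op (max_law w) g = (\<lambda>_. 0)" using cancel[OF g' z] by blast
  then have "conv_op (min_law w) (conv_op (max_law w) g) = (\<lambda>_. 0)" by (simp add: conv_op_def[abs_def])
  then show ?thesis using cancel[OF g w] by blast
qed

text \<open>
  R is the expected final payoff of a walk that survives a step with probability w when it starts the
  step at or below b, and with probability z above.  Factoring out the laws of the minimum at z and of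
  the maximum at w leaves an identity in which each side is known on one side of b.
\<close>

theorem killed_walk_formula:
  fixes b y z w :: real
  assumes z: "0 < z" "z < 1" and w: "0 < w" "w < 1" and y: "b \<le> y" and R: "bdd_borel R"
    and Req: "\<And>x. R x = (1 - z) * indicator {y<..} x + (if x \<le> b then w else z) * conv_op lam R x"
  defines "cross_law \<equiv> convolution (min_law w) (max_law z)"
  shows "(1 - w) * R x = conv_op (min_law z) (conv_op (max_law w)
    (\<lambda>u. indicator {b<..} u * ((w / z * (1 - z)) * indicator {y<..} u
         + (1 - w / z) * conv_op (distr cross_law borel (max 0)) (indicator {y<..}) u))) x"
proof -
  have cross_law: "real_distribution cross_law" unfolding cross_law_def by (intro real_distribution_convolution rd)
  let ?P = "distr cross_law borel (max 0)" and ?N = "distr cross_law borel (min 0)"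
  have P: "real_distribution ?P" "real_distribution ?N" by (intro real_distribution_distr_borel cross_law; simp)+
  (* A and D are the operators of the quotients of the laws of maxima and of minima, up to
     normalisation; A looks up only, and D looks down only. *)
  define c where "c = w / z * (1 - z)"
  have c: "c > 0" unfolding c_def using z w by simp
  define f where "f = (indicator {y<..} :: real \<Rightarrow> real)"
  define A where "A = (\<lambda>g x. c * g x + (1 - w / z) * conv_op ?P g x)"
  define D where "D = (\<lambda>g x. (1 - w) * g x - (1 - w / z) * conv_op ?N g x)"
  (* \<rho> and G are the images of R under 1 - w lam and 1 - z lam; \<rho> vanishes at or below b, and h, the
     deviation of G from (1 - z) times the payoff, vanishes above b. *)
  define \<rho> where "\<rho> = (\<lambda>x. (1 - z) * f x + (z - w) * (indicator {b<..} x * conv_op lam R x))"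
  define h where "h = (\<lambda>x. (w - z) * (indicator {..b} x * conv_op lam R x))"
  define G where "G = (\<lambda>x. (1 - z) * f x + h x)"
  have bf: "bdd_borel f" unfolding f_def by (intro bdd_borel_intros) auto
  have bh: "bdd_borel h" unfolding h_def by (intro bdd_borel_intros R lam) auto
  have br: "bdd_borel \<rho>" unfolding \<rho>_def by (intro bdd_borel_intros R lam bf) auto
  have bG: "bdd_borel G" unfolding G_def by (intro bdd_borel_intros bf bh)
  have bA: "bdd_borel (A g)" if "bdd_borel g" for g unfolding A_def by (intro bdd_borel_intros that P)
  have bD: "bdd_borel (D g)" if "bdd_borel g" for g unfolding D_def by (intro bdd_borel_intros that P)
  have trA: "(1 - w) * conv_op (max_law z) g x = conv_op (max_law w) (A g) x" if g: "bdd_borel g" for g x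
  proof -
    have "(1 - w) * conv_op (max_law z) g x + (- c) * conv_op (max_law w) g x
        + (- (1 - w / z)) * conv_op (convolution (max_law w) ?P) g x = 0"
      using max_law_relation[OF z w] unfolding cross_law_def[symmetric]
      by (intro conv_op_relation rd P g real_distribution_convolution)
        (simp add: char_convolution P c_def algebra_simps)
    moreover have "conv_op (max_law w) (A g) x = c * conv_op (max_law w) g x + (1 - w / z) * conv_op (max_law w) (conv_op ?P g) x"
      unfolding A_def using g P
      by (subst conv_op_add) (auto intro!: bdd_borel_intros simp: conv_op_scale)
    ultimately show ?thesis by (simp add: conv_op_convolution(1) P g algebra_simps)
  qed
  have trD: "c * conv_op (min_law w) g x = conv_op (min_law z) (D g) x" if g: "bdd_borel g" for g x
  proof -
    have "c * conv_op (min_law w) g x + (- (1 - w)) * conv_op (min_law z) g x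
        + (1 - w / z) * conv_op (convolution (min_law z) ?N) g x = 0"
      using min_law_relation[OF z w] unfolding cross_law_def[symmetric]
      by (intro conv_op_relation rd P g real_distribution_convolution)
        (simp add: char_convolution P c_def algebra_simps)
    moreover have "conv_op (min_law z) (D g) x = (1 - w) * conv_op (min_law z) g x - (1 - w / z) * conv_op (min_law z) (conv_op ?N g) x"
      unfolding D_def using g P
      by (subst conv_op_diff) (auto intro!: bdd_borel_intros simp: conv_op_scale)
    ultimately show ?thesis by (simp add: conv_op_convolution(1) P g algebra_simps)
  qed
  have 1: "(1 - z) * R x = conv_op (min_law z) (conv_op (max_law z) G) x" for x
  proof -
    have "R x - z * conv_op lam R x = G x" for x
      using Req[of x] y unfolding G_def h_def f_def by (auto simp: indicator_def algebra_simps)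
    then have "conv_op (min_law z) (conv_op (max_law z) G) = conv_op (min_law z) (conv_op (max_law z) (\<lambda>x. R x - z * conv_op lam R x))" by simp
    also have "\<dots> = (\<lambda>x. conv_op (min_law z) (conv_op (max_law z) R) x - z * conv_op (min_law z) (conv_op (max_law z) (conv_op lam R)) x)"
      by (subst conv_op_diff conv_op_scale; (intro bdd_borel_intros R lam rd)?)+ simp
    finally show ?thesis using conv_op_max_law_min_law_resolvent[OF z R] by simp
  qed
  have 2: "(1 - w) * R x = conv_op (min_law w) (conv_op (max_law w) \<rho>) x" for x
  proof -
    have "R x - w * conv_op lam R x = \<rho> x" for x
      using Req[of x] y unfolding \<rho>_def f_def by (auto simp: indicator_def algebra_simps)
    then have "conv_op (min_law w) (conv_op (max_law w) \<rho>) = conv_op (min_law w) (conv_op (max_law w) (\<lambda>x. R x - w * conv_op lam R x))" by simp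
    also have "\<dots> = (\<lambda>x. conv_op (min_law w) (conv_op (max_law w) R) x - w * conv_op (min_law w) (conv_op (max_law w) (conv_op lam R)) x)"
      by (subst conv_op_diff conv_op_scale; (intro bdd_borel_intros R lam rd)?)+ simp
    finally show ?thesis using conv_op_max_law_min_law_resolvent[OF w R] by simp
  qed
  have 3: "(1 - w) * ((1 - z) * R x) = conv_op (min_law z) (conv_op (max_law w) (A G)) x" for x
  proof -
    have "(1 - w) * ((1 - z) * R x) = conv_op (min_law z) (\<lambda>x. (1 - w) * conv_op (max_law z) G x) x"
      unfolding 1 conv_op_scale ..
    then show ?thesis using trA[OF bG] by simp
  qed
  have 4: "c * ((1 - w) * R x) = conv_op (min_law z) (conv_op (max_law w) (D \<rho>)) x" for x
  proof -
    have "c * ((1 - w) * R x) = c * conv_op (max_law w) (conv_op (min_law w) \<rho>) x"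
      unfolding 2 by (simp add: conv_op_commute[OF rd(2) rd(1) br])
    also have "\<dots> = conv_op (max_law w) (\<lambda>x. c * conv_op (min_law w) \<rho> x) x" unfolding conv_op_scale ..
    also have "\<dots> = conv_op (max_law w) (conv_op (min_law z) (D \<rho>)) x" using trD[OF br] by simp
    also have "\<dots> = conv_op (min_law z) (conv_op (max_law w) (D \<rho>)) x"
      by (simp add: conv_op_commute[OF rd(1) rd(2) bD[OF br]])
    finally show ?thesis .
  qed
  have 5: "c * A G x = (1 - z) * D \<rho> x" for x
  proof -
    have "c * A G x - (1 - z) * D \<rho> x = 0"
    proof (rule conv_op_max_law_min_law_injective[OF z w, where g = "\<lambda>x. c * A G x - (1 - z) * D \<rho> x"])
      show "bdd_borel (\<lambda>x. c * A G x - (1 - z) * D \<rho> x)"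
        by (intro bdd_borel_intros bA bD bG br)
      have "conv_op (min_law z) (conv_op (max_law w) (\<lambda>x. c * A G x - (1 - z) * D \<rho> x)) x =
         c * conv_op (min_law z) (conv_op (max_law w) (A G)) x - (1 - z) * conv_op (min_law z) (conv_op (max_law w) (D \<rho>)) x" for x
        by (subst conv_op_diff conv_op_scale; (intro bdd_borel_intros bA bD bG br rd)?)+ simp
      then show "conv_op (min_law z) (conv_op (max_law w) (\<lambda>x. c * A G x - (1 - z) * D \<rho> x)) x = 0" for x
        unfolding 3[symmetric] 4[symmetric] by simp
    qed
    then show ?thesis by simp
  qed
  (* At or below b the left side vanishes, as D looks down; above b, A cannot see h, as A looks up. *)
  have D\<rho>: "D \<rho> x = c * (indicator {b<..} x * A f x)" for x
  proof (cases "x \<le> b")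
    case True
    have r0: "\<rho> v = 0" if "v \<le> b" for v using that y unfolding \<rho>_def f_def by auto
    have "conv_op ?N \<rho> x = 0" using AE_distr_clamp(2)[OF cross_law] True r0 by (intro conv_op_zero_on_Iic) auto
    then show ?thesis using r0[OF True] True by (simp add: D_def)
  next
    case False
    have h0: "h v = 0" if "b < v" for v using that unfolding h_def by auto
    have "conv_op ?P h x = 0" using AE_distr_clamp(1)[OF cross_law] False h0 by (intro conv_op_zero_on_Ioi) auto
    moreover have "conv_op ?P G x = (1 - z) * conv_op ?P f x + conv_op ?P h x"
      unfolding G_def by (subst conv_op_add conv_op_scale; (intro bdd_borel_intros bf bh P)?)+ simp
    ultimately have trG: "conv_op ?P G x = (1 - z) * conv_op ?P f x" by simp
    have Gx: "G x = (1 - z) * f x" using h0[of x] False by (simp add: G_def)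
    have "c * ((1 - z) * s) + k * ((1 - z) * s') = (1 - z) * (c * s + k * s')" for k s s' :: real
      by (simp add: algebra_simps)
    then have "A G x = (1 - z) * A f x"
      unfolding A_def trG Gx .
    then have "(1 - z) * D \<rho> x = (1 - z) * (c * A f x)" using 5[of x] by (metis mult.left_commute)
    then show ?thesis using False z by auto
  qed
  have "conv_op (min_law z) (conv_op (max_law w) (D \<rho>)) x = c * conv_op (min_law z) (conv_op (max_law w) (\<lambda>x. indicator {b<..} x * A f x)) x"
    unfolding D\<rho>[abs_def] conv_op_scale ..
  with 4[of x] c have "(1 - w) * R x = conv_op (min_law z) (conv_op (max_law w) (\<lambda>x. indicator {b<..} x * A f x)) x" by simp
  then show ?thesis unfolding A_def f_def c_def .
qed

end

lemma walk_max_eq: "walk (max 0) n \<xi> = Max ((\<lambda>k. \<Sum>i<k. \<xi> i) ` {..n})"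
proof (induction n arbitrary: \<xi>)
  case (Suc n)
  have fin: "finite ((\<lambda>k. \<Sum>i<k. f i) ` {..m::nat})" for f :: "nat \<Rightarrow> real" and m by simp
  have "(\<lambda>k. \<Sum>i<k. \<xi> i) ` {..Suc n} = insert 0 ((\<lambda>x. \<xi> 0 + x) ` (\<lambda>k. \<Sum>i<k. \<xi> (Suc i)) ` {..n})"
    unfolding atMost_Suc_eq_insert_0 image_insert image_image
    by (simp add: sum.lessThan_Suc_shift del: sum.lessThan_Suc)
  then have "Max ((\<lambda>k. \<Sum>i<k. \<xi> i) ` {..Suc n}) =
      max 0 (Max ((\<lambda>x. \<xi> 0 + x) ` (\<lambda>k. \<Sum>i<k. \<xi> (Suc i)) ` {..n}))"
    using fin by (simp del: sum.lessThan_Suc)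
  also have "Max ((\<lambda>x. \<xi> 0 + x) ` (\<lambda>k. \<Sum>i<k. \<xi> (Suc i)) ` {..n}) = \<xi> 0 + Max ((\<lambda>k. \<Sum>i<k. \<xi> (Suc i)) ` {..n})"
    by (rule mono_Max_commute[symmetric]) (auto simp: mono_def)
  finally show ?case by (simp add: Suc)
qed simp

lemma walk_uminus: "walk (min 0) n \<xi> = - walk (max 0) n (\<lambda>i. - \<xi> i)"
  by (induction n arbitrary: \<xi>) (auto simp: min_def max_def)

lemma walk_id_eq: "walk (\<lambda>x. x) n \<xi> = (\<Sum>i<n. \<xi> i)"
  by (induction n arbitrary: \<xi>) (simp_all add: sum.lessThan_Suc_shift del: sum.lessThan_Suc)

section \<open>Right-continuous paths with left limits on dyadic grids\<close>

text \<open>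
  Rounding up matters: the grid points approach t from the right, where paths are continuous.
\<close>

definition grid_up :: "nat \<Rightarrow> real \<Rightarrow> real" where
  "grid_up n t = real (nat \<lceil>t * 2 ^ n\<rceil>) * (1 / 2 ^ n)"

lemma grid_up_bounds:
  assumes "0 \<le> t" shows "t \<le> grid_up n t" "grid_up n t < t + 1 / 2 ^ n"
proof -
  have "0 \<le> \<lceil>t * 2 ^ n\<rceil>" using assms by (simp add: order_less_le_trans[OF _ mult_nonneg_nonneg])
  then have r: "real (nat \<lceil>t * 2 ^ n\<rceil>) = of_int \<lceil>t * 2 ^ n\<rceil>" by simp
  have "t * 2 ^ n \<le> of_int \<lceil>t * 2 ^ n\<rceil>" "of_int \<lceil>t * 2 ^ n\<rceil> < t * 2 ^ n + 1" by linarith+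
  then show "t \<le> grid_up n t" "grid_up n t < t + 1 / 2 ^ n"
    unfolding grid_up_def r by (auto simp: field_simps)
qed

lemma grid_up_tendsto:
  assumes "0 \<le> t" shows "(\<lambda>n. grid_up n t) \<longlonglongrightarrow> t"
proof (rule tendsto_sandwich[of "\<lambda>_. t" _ _ "\<lambda>n. t + 1 / 2 ^ n"])
  have "(\<lambda>n. (1 / 2 :: real) ^ n) \<longlonglongrightarrow> 0" by (rule LIMSEQ_realpow_zero) auto
  then have "(\<lambda>n. t + 1 / 2 ^ n) \<longlonglongrightarrow> t + 0" by (intro tendsto_add tendsto_const) (simp add: power_one_over)
  then show "(\<lambda>n. t + 1 / 2 ^ n) \<longlonglongrightarrow> t" by simp
qed (use grid_up_bounds[OF assms] in \<open>auto intro!: always_eventually less_imp_le\<close>)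

lemma right_continuous_sequentially:
  fixes x :: "real \<Rightarrow> real"
  assumes c: "continuous (at_right t) x" and s: "s \<longlonglongrightarrow> t" "\<And>n. t \<le> s n"
  shows "(\<lambda>n. x (s n)) \<longlonglongrightarrow> x t"
proof -
  have "continuous (at t within {t..}) x"
    using c by (simp add: at_within_Ici_at_right continuous_within)
  then show ?thesis using s
    by (intro continuous_within_tendsto_compose'[of t "{t..}" x s sequentially]) auto
qed

lemma cadlag_grid_tendsto:
  fixes x :: "real \<Rightarrow> real"
  assumes "continuous (at_right t) x" "0 \<le> t"
  shows "(\<lambda>n. x (grid_up n t)) \<longlonglongrightarrow> x t"
  by (rule right_continuous_sequentially[OF assms(1) grid_up_tendsto[OF assms(2)] grid_up_bounds(1)[OF assms(2)]])

lemma cadlag_bounded: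
  fixes x :: "real \<Rightarrow> real"
  assumes rc: "\<And>t. 0 \<le> t \<Longrightarrow> continuous (at_right t) x"
    and ll: "\<And>t. 0 < t \<Longrightarrow> \<exists>l. (x \<longlongrightarrow> l) (at_left t)"
  shows "\<exists>B. \<forall>t\<in>{0..T}. \<bar>x t\<bar> \<le> B"
proof -
  have "\<exists>U B. open U \<and> t \<in> U \<and> (\<forall>s\<in>U. 0 \<le> s \<longrightarrow> \<bar>x s\<bar> \<le> B)" if t: "t \<in> {0..T}" for t
  proof -
    have "(x \<longlongrightarrow> x t) (at_right t)" using rc[of t] t by (simp add: continuous_within)
    then have "eventually (\<lambda>s. dist (x s) (x t) < 1) (at_right t)" by (rule tendstoD) simp
    then obtain b where b: "b > t" "\<And>s. t < s \<Longrightarrow> s < b \<Longrightarrow> dist (x s) (x t) < 1"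
      unfolding eventually_at_right_field by auto
    obtain a l where a: "a < t" "\<And>s. a < s \<Longrightarrow> s < t \<Longrightarrow> 0 \<le> s \<Longrightarrow> dist (x s) l < 1"
    proof (cases "t = 0")
      case True then show ?thesis by (intro that[of "-1"]) auto
    next
      case False
      then obtain l where "(x \<longlongrightarrow> l) (at_left t)" using ll[of t] t by auto
      then have "eventually (\<lambda>s. dist (x s) l < 1) (at_left t)" by (rule tendstoD) simp
      then show ?thesis unfolding eventually_at_left_field using that by auto
    qed
    have "\<bar>x s\<bar> \<le> max (\<bar>x t\<bar>) \<bar>l\<bar> + 1" if "s \<in> {a<..<b}" "0 \<le> s" for s
    proof -
      consider "s < t" | "s = t" | "t < s" by linarith
      then have "\<bar>x s\<bar> \<le> \<bar>l\<bar> + 1 \<or> \<bar>x s\<bar> \<le> \<bar>x t\<bar> + 1"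
      proof cases
        case 1 then show ?thesis using a(2)[of s] that unfolding dist_real_def by auto
      next
        case 3 then show ?thesis using b(2)[of s] that unfolding dist_real_def by auto
      qed auto
      then show ?thesis by linarith
    qed
    then show ?thesis using a b by (intro exI[of _ "{a<..<b}"] exI[of _ "max (\<bar>x t\<bar>) \<bar>l\<bar> + 1"]) auto
  qed
  then obtain U B where U: "\<And>t. t \<in> {0..T} \<Longrightarrow> open (U t) \<and> t \<in> U t \<and> (\<forall>s\<in>U t. 0 \<le> s \<longrightarrow> \<bar>x s\<bar> \<le> B t)"
    by metis
  have cov: "{0..T} \<subseteq> (\<Union>t\<in>{0..T}. U t)" using U by auto
  obtain C where C: "C \<subseteq> {0..T}" "finite C" "{0..T} \<subseteq> (\<Union>t\<in>C. U t)"
    by (rule compactE_image[OF compact_Icc _ cov]) (use U in auto)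
  have "\<bar>x s\<bar> \<le> (\<Sum>t\<in>C. \<bar>B t\<bar>)" if s: "s \<in> {0..T}" for s
  proof -
    obtain t where t: "t \<in> C" "s \<in> U t" using C s by auto
    then have "\<bar>x s\<bar> \<le> B t" using U[of t] C s by auto
    also have "\<dots> \<le> (\<Sum>t\<in>C. \<bar>B t\<bar>)" using member_le_sum[of t C "\<lambda>t. \<bar>B t\<bar>"] t C by auto
    finally show ?thesis .
  qed
  then show ?thesis by blast
qed

text \<open>
  A point where the path nearly attains its supremum is approached from the right by grid points; the
  grid may exceed T by less than one mesh, where right continuity at T controls the path.
\<close>

lemma grid_max_tendsto_sup:
  fixes x :: "real \<Rightarrow> real"
  assumes rc: "\<And>t. 0 \<le> t \<Longrightarrow> continuous (at_right t) x"
    and ll: "\<And>t. 0 < t \<Longrightarrow> \<exists>l. (x \<longlongrightarrow> l) (at_left t)" and T: "0 \<le> T"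
  shows "(\<lambda>n. Max ((\<lambda>k. x (real k * (1 / 2 ^ n))) ` {..nat \<lceil>T * 2 ^ n\<rceil>})) \<longlonglongrightarrow> (SUP t\<in>{0..T}. x t)"
proof -
  obtain B where B: "\<And>t. t \<in> {0..T} \<Longrightarrow> \<bar>x t\<bar> \<le> B" using cadlag_bounded[OF rc ll] by blast
  have bdd: "bdd_above (x ` {0..T})" using B by (intro bdd_aboveI2[where M=B]) fastforce
  let ?M = "\<lambda>n. Max ((\<lambda>k. x (real k * (1 / 2 ^ n))) ` {..nat \<lceil>T * 2 ^ n\<rceil>})"
  show ?thesis
  proof (rule order_tendstoI)
    fix a assume "a < (SUP t\<in>{0..T}. x t)"
    then obtain t where t: "t \<in> {0..T}" "a < x t"
      using less_cSUP_iff[OF _ bdd] T by auto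
    have "eventually (\<lambda>n. a < x (grid_up n t)) sequentially"
      using cadlag_grid_tendsto[of t x] rc t by (intro order_tendstoD) auto
    then show "eventually (\<lambda>n. a < ?M n) sequentially"
    proof eventually_elim
      fix n assume "a < x (grid_up n t)"
      also have "\<dots> \<le> ?M n"
      proof -
        have "nat \<lceil>t * 2 ^ n\<rceil> \<le> nat \<lceil>T * 2 ^ n\<rceil>"
          using t by (intro nat_mono ceiling_mono mult_right_mono) auto
        then show ?thesis unfolding grid_up_def by (intro Max_ge) auto
      qed
      finally show "a < ?M n" .
    qed
  next
    fix a assume a: "(SUP t\<in>{0..T}. x t) < a"
    have le: "x t < a" if "t \<in> {0..T}" for t
      using cSUP_upper[OF that bdd] a by linarith
    have "(x \<longlongrightarrow> x T) (at_right T)" using rc T by (simp add: continuous_within)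
    then have "eventually (\<lambda>s. x s < a) (at_right T)"
      using le[of T] T by (intro order_tendstoD) auto
    then obtain b where b: "b > T" "\<And>s. T < s \<Longrightarrow> s < b \<Longrightarrow> x s < a"
      unfolding eventually_at_right_field by auto
    have "eventually (\<lambda>n. grid_up n T < b) sequentially"
      using grid_up_tendsto[OF T] b by (intro order_tendstoD) auto
    then show "eventually (\<lambda>n. ?M n < a) sequentially"
    proof eventually_elim
      fix n assume n: "grid_up n T < b"
      have "x (real k * (1 / 2 ^ n)) < a" if "k \<le> nat \<lceil>T * 2 ^ n\<rceil>" for k
      proof (cases "real k * (1 / 2 ^ n) \<le> T")
        case True then show ?thesis by (intro le) auto
      next
        case False
        have "real k * (1 / 2 ^ n) \<le> grid_up n T"
          unfolding grid_up_def using that by (intro mult_right_mono) auto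
        then show ?thesis using False n by (intro b) auto
      qed
      then show "?M n < a" by (subst Max_less_iff) auto
    qed
  qed
qed

section \<open>The skeleton of a Levy process and an independent exponential clock\<close>

context levy_process begin

lemma X_measurable [measurable]: "0 \<le> t \<Longrightarrow> X t \<in> borel_measurable M"
  by (rule measurable_X)

definition increments :: "real \<Rightarrow> 'a \<Rightarrow> nat \<Rightarrow> real" where
  "increments h \<omega> i = X (real (Suc i) * h) \<omega> - X (real i * h) \<omega>"

definition increment_law :: "real \<Rightarrow> real measure" where "increment_law h = distr M borel (X h)"

lemma real_distribution_increment_law: "0 \<le> h \<Longrightarrow> real_distribution (increment_law h)"
  unfolding increment_law_def by (intro real_distribution_distr) auto

lemma sum_increments: "(\<Sum>i<n. increments h \<omega> i) = X (real n * h) \<omega> - X 0 \<omega>"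
  by (induction n) (auto simp: increments_def)

lemma increments_component_measurable: "0 < h \<Longrightarrow> (\<lambda>\<omega>. increments h \<omega> i) \<in> borel_measurable M"
  unfolding increments_def by (intro borel_measurable_diff X_measurable) auto

lemma increments_measurable: "0 < h \<Longrightarrow> increments h \<in> M \<rightarrow>\<^sub>M seqs"
  using increments_component_measurable by (intro measurable_PiM_single') (auto simp: space_PiM)

lemma distr_increments_component: "0 < h \<Longrightarrow> distr M borel (\<lambda>\<omega>. increments h \<omega> i) = increment_law h"
  unfolding increments_def increment_law_def
  by (subst stationary_increments) (auto simp: algebra_simps)

lemma indep_grid_increments:
  assumes h: "0 < h"
  shows "indep_vars (\<lambda>_. borel) (\<lambda>i \<omega>. increments h \<omega> i) UNIV"
proof -
  have n: "indep_vars (\<lambda>_. borel) (\<lambda>i \<omega>. increments h \<omega> i) {..<n}" for n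
    using indep_increments[of "\<lambda>i. real i * h" n] h unfolding increments_def by simp
  show ?thesis
    unfolding indep_vars_def2
  proof (intro conjI ballI)
    show "indep_sets (\<lambda>i. {(\<lambda>\<omega>. increments h \<omega> i) -` A \<inter> space M |A. A \<in> sets borel}) UNIV"
    proof (subst indep_sets_finite_index_sets, intro allI impI)
      fix J :: "nat set" assume "J \<subseteq> UNIV" "J \<noteq> {}" "finite J"
      then obtain n where "J \<subseteq> {..<n}" using finite_nat_iff_bounded by auto
      then show "indep_sets (\<lambda>i. {(\<lambda>\<omega>. increments h \<omega> i) -` A \<inter> space M |A. A \<in> sets borel}) J"
        using n[of n] unfolding indep_vars_def2 by (meson indep_sets_mono_index)
    qed
  qed (rule increments_component_measurable[OF h])
qed

lemma distr_increments:
  assumes h: "0 < h" shows "distr M seqs (increments h) = PiM UNIV (\<lambda>_. increment_law h)"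
proof -
  have "distr M seqs (\<lambda>x. \<lambda>i\<in>UNIV. increments h x i) = PiM UNIV (\<lambda>i. distr M borel (\<lambda>\<omega>. increments h \<omega> i))"
    using indep_vars_iff_distr_eq_PiM[where I=UNIV and M'="\<lambda>_. borel" and X="\<lambda>i \<omega>. increments h \<omega> i"] indep_grid_increments[OF h]
      increments_component_measurable[OF h] by simp
  then show ?thesis unfolding distr_increments_component[OF h] by (simp add: restrict_UNIV)
qed

abbreviation "paths \<equiv> PiM {0..} (\<lambda>_::real. borel :: real measure)"
abbreviation "traj \<omega> \<equiv> (\<lambda>t\<in>{0..}. X t \<omega>)"

lemma traj_measurable: "traj \<in> M \<rightarrow>\<^sub>M paths"
  by (intro measurable_restrict) auto

text \<open>
  One less than the index of the first grid point at or after t > 0, so that it counts from 0 like the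
  geometric distribution.
\<close>

definition steps :: "real \<Rightarrow> real \<Rightarrow> nat" where "steps h t = nat \<lceil>t / h\<rceil> - 1"

lemma steps_measurable: "steps h \<in> borel \<rightarrow>\<^sub>M count_space UNIV"
  unfolding steps_def[abs_def] by measurable

end

locale levy_clock = levy_process +
  fixes r :: real and T :: "'a \<Rightarrow> real"
  assumes r: "0 < r" and clock: "indep_exponential M X r T"
begin

lemma T_nonneg: "\<omega> \<in> space M \<Longrightarrow> 0 \<le> T \<omega>"
  using clock by (auto simp: indep_exponential_def)

lemma T_distributed: "distributed M lborel T (exponential_density r)"
  using clock by (auto simp: indep_exponential_def)

lemma T_measurable [measurable]: "T \<in> borel_measurable M"
  using distributed_measurable[OF T_distributed] by simp

lemma T_le: "0 \<le> a \<Longrightarrow> prob {\<omega>\<in>space M. T \<omega> \<le> a} = 1 - exp (- a * r)"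
  using exponential_distributedD_le[OF T_distributed _ r] by simp

lemma T_pos: "AE \<omega> in M. 0 < T \<omega>"
proof -
  have "prob {\<omega>\<in>space M. T \<omega> \<le> 0} = 0" using T_le[of 0] by simp
  then have "AE \<omega> in M. \<not> T \<omega> \<le> 0" by (subst AE_iff_measurable[OF _ refl]) (auto simp: emeasure_eq_measure)
  then show ?thesis by eventually_elim simp
qed

lemma distr_T_traj: "distr M (borel \<Otimes>\<^sub>M paths) (\<lambda>\<omega>. (T \<omega>, traj \<omega>)) = distr M borel T \<Otimes>\<^sub>M distr M paths traj"
proof (rule sym, rule pair_measure_eqI)
  note traj_measurable[measurable]
  interpret A: prob_space "distr M borel T" by (rule prob_space_distr) simp
  interpret B: prob_space "distr M paths traj" by (rule prob_space_distr) simp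
  show "sigma_finite_measure (distr M borel T)" "sigma_finite_measure (distr M paths traj)" by unfold_locales
  fix A B assume "A \<in> sets (distr M borel T)" "B \<in> sets (distr M paths traj)"
  then have [measurable]: "A \<in> sets borel" "B \<in> sets paths" by auto
  have "indep_set (sets (vimage_algebra (space M) T borel)) (sets (vimage_algebra (space M) traj paths))"
    using clock by (auto simp: indep_exponential_def)
  moreover have "T -` A \<inter> space M \<in> sets (vimage_algebra (space M) T borel)" by (intro in_vimage_algebra) simp
  moreover have "traj -` B \<inter> space M \<in> sets (vimage_algebra (space M) traj paths)" by (intro in_vimage_algebra) simp
  ultimately have "prob ((T -` A \<inter> space M) \<inter> (traj -` B \<inter> space M)) = prob (T -` A \<inter> space M) * prob (traj -` B \<inter> space M)"
    by (rule indep_setD)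
  moreover have "(\<lambda>\<omega>. (T \<omega>, traj \<omega>)) -` (A \<times> B) \<inter> space M = (T -` A \<inter> space M) \<inter> (traj -` B \<inter> space M)" by auto
  ultimately show "emeasure (distr M borel T) A * emeasure (distr M paths traj) B =
      emeasure (distr M (borel \<Otimes>\<^sub>M paths) (\<lambda>\<omega>. (T \<omega>, traj \<omega>))) (A \<times> B)"
    by (simp add: emeasure_distr emeasure_eq_measure ennreal_mult)
qed simp

lemma distr_steps:
  assumes h: "0 < h"
  shows "distr M (count_space UNIV) (\<lambda>\<omega>. steps h (T \<omega>)) = measure_pmf (geometric_pmf (1 - exp (- r * h)))"
proof (rule measure_eqI_countable[where A=UNIV])
  fix n :: nat
  define z where "z = exp (- r * h)"
  have z: "0 < z" "z < 1" unfolding z_def using r h by auto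
  have m [measurable]: "(\<lambda>\<omega>. steps h (T \<omega>)) \<in> M \<rightarrow>\<^sub>M count_space UNIV"
    by (rule measurable_compose[OF T_measurable steps_measurable])
  have le: "prob {\<omega>\<in>space M. T \<omega> \<le> real k * h} = 1 - z ^ k" for k
    using T_le[of "real k * h"] h by (simp add: z_def exp_of_nat_mult[symmetric] algebra_simps)
  have steps_le: "steps h t \<le> k \<longleftrightarrow> t \<le> real (Suc k) * h" for t k
  proof -
    have "steps h t \<le> k \<longleftrightarrow> \<lceil>t / h\<rceil> \<le> int (Suc k)" unfolding steps_def by auto
    also have "\<dots> \<longleftrightarrow> t / h \<le> real (Suc k)" by (simp add: ceiling_le_iff)
    also have "\<dots> \<longleftrightarrow> t \<le> real (Suc k) * h" using h by (simp add: pos_divide_le_eq)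
    finally show ?thesis .
  qed
  have P: "prob {\<omega>\<in>space M. steps h (T \<omega>) \<le> k} = 1 - z ^ Suc k" for k
    unfolding steps_le by (rule le)
  have "prob {\<omega>\<in>space M. steps h (T \<omega>) = n} = z ^ n * (1 - z)"
  proof (cases n)
    case 0
    then show ?thesis using P[of 0] by simp
  next
    case (Suc k)
    have "{\<omega>\<in>space M. steps h (T \<omega>) = n} = {\<omega>\<in>space M. steps h (T \<omega>) \<le> n} - {\<omega>\<in>space M. steps h (T \<omega>) \<le> k}"
      using Suc by auto
    also have "prob \<dots> = (1 - z ^ Suc n) - (1 - z ^ Suc k)"
      unfolding P[symmetric] by (rule finite_measure_Diff) (auto simp: Suc)
    finally show ?thesis by (simp add: Suc algebra_simps)
  qed
  moreover have "(\<lambda>\<omega>. steps h (T \<omega>)) -` {n} \<inter> space M = {\<omega>\<in>space M. steps h (T \<omega>) = n}" by auto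
  ultimately have "emeasure (distr M (count_space UNIV) (\<lambda>\<omega>. steps h (T \<omega>))) {n} = z ^ n * (1 - z)"
    by (subst emeasure_distr) (auto simp: emeasure_eq_measure)
  also have "\<dots> = emeasure (measure_pmf (geometric_pmf (1 - z))) {n}"
    using z by (simp add: emeasure_pmf_single)
  finally show "emeasure (distr M (count_space UNIV) (\<lambda>\<omega>. steps h (T \<omega>))) {n} =
      emeasure (measure_pmf (geometric_pmf (1 - exp (- r * h)))) {n}" unfolding z_def .
qed auto

text \<open>
  The link between the two halves of the proof: an exponential clock rounded to the grid is a geometric
  time, independent of the i.i.d. steps of the skeleton.
\<close>

lemma distr_steps_increments:
  assumes h: "0 < h"
  shows "distr M (count_space UNIV \<Otimes>\<^sub>M seqs) (\<lambda>\<omega>. (steps h (T \<omega>), increments h \<omega>)) = geo_seq (exp (- r * h)) (increment_law h)"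
proof -
  define d where "d = (\<lambda>(p :: real \<Rightarrow> real) (i :: nat). p (real (Suc i) * h) - p (real i * h))"
  have e: "d \<in> paths \<rightarrow>\<^sub>M seqs"
    unfolding d_def
  proof (rule measurable_PiM_single')
    show "(\<lambda>p. p (real (Suc i) * h) - p (real i * h)) \<in> borel_measurable paths" for i
      using h by (intro borel_measurable_diff measurable_component_singleton) auto
  qed (auto simp: space_PiM)
  note traj_measurable[measurable] steps_measurable[measurable] e[measurable]
  have d: "d (traj \<omega>) = increments h \<omega>" for \<omega> using h by (auto simp: d_def increments_def fun_eq_iff)
  have "distr M (count_space UNIV \<Otimes>\<^sub>M seqs) (\<lambda>\<omega>. (steps h (T \<omega>), increments h \<omega>)) =
     distr (distr M (borel \<Otimes>\<^sub>M paths) (\<lambda>\<omega>. (T \<omega>, traj \<omega>))) (count_space UNIV \<Otimes>\<^sub>M seqs) (\<lambda>(t, p). (steps h t, d p))"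
    by (subst distr_distr) (auto simp: comp_def d)
  also have "\<dots> = distr (distr M borel T) (count_space UNIV) (steps h) \<Otimes>\<^sub>M distr (distr M paths traj) seqs d"
    unfolding distr_T_traj
  proof (rule pair_measure_distr[symmetric])
    interpret B: prob_space "distr M paths traj" by (rule prob_space_distr) simp
    interpret C: prob_space "distr (distr M paths traj) seqs d" by (rule B.prob_space_distr) simp
    show "sigma_finite_measure (distr (distr M paths traj) seqs d)" by unfold_locales
  qed simp_all
  also have "distr (distr M borel T) (count_space UNIV) (steps h) = distr M (count_space UNIV) (\<lambda>\<omega>. steps h (T \<omega>))"
    by (subst distr_distr) (auto simp: comp_def)
  also have "distr (distr M paths traj) seqs d = distr M seqs (increments h)"
    by (subst distr_distr) (auto simp: comp_def d)
  finally show ?thesis unfolding geo_seq_def distr_increments[OF h] distr_steps[OF h] .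
qed

end

section \<open>Suprema and infima at exponential times\<close>

text \<open>
  The clock rounded up is at least one step long, while the geometric time of the walk starts at 0; the
  two differ by an event of probability 1 - z, which is negligible as the mesh tends to 0.
\<close>

lemma integral_walk_law_Suc:
  fixes f :: "real \<Rightarrow> 'b::{banach, second_countable_topology}"
  assumes lam: "real_distribution lam" and z: "0 < z" "z < 1"
   and g: "g \<in> borel_measurable borel"
   and f [measurable]: "f \<in> borel_measurable borel" and B: "\<And>x. norm (f x) \<le> B"
  shows "integral\<^sup>L (walk_law z lam g) f =
    (1 - z) *\<^sub>R f 0 + z *\<^sub>R (\<integral>p. f (walk g (Suc (fst p)) (snd p)) \<partial>geo_seq z lam)"
proof -
  let ?S = "PiM UNIV (\<lambda>_::nat. lam)"
  interpret S: prob_space ?S using prob_space_iid[OF lam] .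
  have w: "norm (\<integral>\<xi>. f (walk g n \<xi>) \<partial>?S) \<le> B" for n
    by (rule norm_integral_prob_le) (auto simp: B S.prob_space_axioms)
  have "integral\<^sup>L (walk_law z lam g) f = (\<integral>n. \<integral>\<xi>. f (walk g n \<xi>) \<partial>?S \<partial>measure_pmf (geometric_pmf (1 - z)))"
    by (rule integral_walk_law[OF lam g f B])
  also have "\<dots> = (1 - z) *\<^sub>R f 0 + z *\<^sub>R (\<integral>n. \<integral>\<xi>. f (walk g (Suc n) \<xi>) \<partial>?S \<partial>measure_pmf (geometric_pmf (1 - z)))"
    by (subst integral_geometric_pmf_first_step[OF z w]) (simp add: S.prob_space del: walk.simps(2))
  also have "(\<integral>n. \<integral>\<xi>. f (walk g (Suc n) \<xi>) \<partial>?S \<partial>measure_pmf (geometric_pmf (1 - z))) =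
      (\<integral>p. f (walk g (Suc (fst p)) (snd p)) \<partial>geo_seq z lam)"
  proof (subst integral_geo_seq[OF lam, where B=B])
    show "(\<lambda>\<xi>. f (walk g (Suc (fst (n, \<xi>))) (snd (n, \<xi>)))) \<in> borel_measurable seqs" for n
      using measurable_compose[OF measurable_walk[OF g, of "Suc n"] f] by (simp del: walk.simps(2))
  qed (auto simp: B simp del: walk.simps(2))
  finally show ?thesis .
qed

lemma walk_max_path:
  fixes x :: "real \<Rightarrow> real"
  shows "Max ((\<lambda>k. x (real k * h)) ` {..m}) = x 0 + walk (max 0) m (\<lambda>i. x (real (Suc i) * h) - x (real i * h))"
proof -
  have s: "(\<Sum>i<k. x (real (Suc i) * h) - x (real i * h)) = x (real k * h) - x 0" for k
    by (induction k) auto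
  have "(\<lambda>k. x (real k * h)) ` {..m} = (\<lambda>v. x 0 + v) ` (\<lambda>k. x (real k * h) - x 0) ` {..m}"
    by (simp add: image_image)
  also have "Max \<dots> = x 0 + Max ((\<lambda>k. x (real k * h) - x 0) ` {..m})"
    by (rule mono_Max_commute[symmetric]) (auto simp: mono_def)
  finally show ?thesis unfolding walk_max_eq s .
qed

text \<open>
  The discrete identities have coefficients that are differences of discount factors; divided by the mesh
  2^(-n) they tend to the rates.
\<close>

lemma discretisation_rate:
  fixes a :: real
  shows "(\<lambda>n. (1 - exp (- a * (1 / 2 ^ n))) * 2 ^ n) \<longlonglongrightarrow> a"
proof -
  have "((\<lambda>x. exp (- a * x)) has_real_derivative - a) (at 0)"
    by (auto intro!: derivative_eq_intros)
  then have "((\<lambda>h. (exp (- a * (0 + h)) - exp (- a * 0)) / h) \<longlongrightarrow> - a) (at 0)"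
    unfolding DERIV_def .
  moreover have "filterlim (\<lambda>n. 1 / 2 ^ n :: real) (at 0) sequentially"
  proof (rule filterlim_atI)
    show "(\<lambda>n. 1 / 2 ^ n :: real) \<longlonglongrightarrow> 0" using LIMSEQ_realpow_zero[of "1/2"] by (simp add: power_one_over)
  qed auto
  ultimately have "(\<lambda>n. (exp (- a * (0 + 1 / 2 ^ n)) - exp (- a * 0)) / (1 / 2 ^ n)) \<longlonglongrightarrow> - a"
    by (rule filterlim_compose)
  from tendsto_minus[OF this] show ?thesis by (simp add: algebra_simps)
qed

lemma disc_tendsto: "(\<lambda>n. exp (- a * (1 / 2 ^ n))) \<longlonglongrightarrow> (1::real)"
proof -
  have "(\<lambda>n. - a * (1 / 2 ^ n)) \<longlonglongrightarrow> - a * (0::real)"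
    using LIMSEQ_realpow_zero[of "1/2"] by (intro tendsto_mult tendsto_const) (simp add: power_one_over)
  from tendsto_exp[OF this] show ?thesis by simp
qed

context levy_process begin

definition sup_law :: "('a \<Rightarrow> real) \<Rightarrow> real measure" where
  "sup_law T = distr M borel (\<lambda>\<omega>. running_sup X (T \<omega>) \<omega>)"
definition inf_law :: "('a \<Rightarrow> real) \<Rightarrow> real measure" where
  "inf_law T = distr M borel (\<lambda>\<omega>. running_inf X (T \<omega>) \<omega>)"
definition end_law :: "('a \<Rightarrow> real) \<Rightarrow> real measure" where
  "end_law T = distr M borel (\<lambda>\<omega>. X (T \<omega>) \<omega>)"

abbreviation "disc a n \<equiv> exp (- a * (1 / 2 ^ n))"
abbreviation "grid_step n \<equiv> increment_law (1 / 2 ^ n)"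

lemma rd_grid_step: "real_distribution (grid_step n)" by (rule real_distribution_increment_law) simp

lemma step_law_grid_step: "step_law (grid_step n)" by (rule step_law.intro[OF rd_grid_step])

lemma grid_sup:
  assumes "\<omega> \<in> space M" "0 \<le> t"
  shows "(\<lambda>n. X 0 \<omega> + walk (max 0) (nat \<lceil>t * 2 ^ n\<rceil>) (increments (1 / 2 ^ n) \<omega>)) \<longlonglongrightarrow> running_sup X t \<omega>"
  using grid_max_tendsto_sup[of "\<lambda>s. X s \<omega>" t, OF right_continuous[OF assms(1)] left_limits[OF assms(1)] assms(2)]
  unfolding walk_max_path[of "\<lambda>s. X s \<omega>"] running_sup_def increments_def[symmetric] by simp

lemma grid_inf:
  assumes "\<omega> \<in> space M" "0 \<le> t"
  shows "(\<lambda>n. X 0 \<omega> + walk (min 0) (nat \<lceil>t * 2 ^ n\<rceil>) (increments (1 / 2 ^ n) \<omega>)) \<longlonglongrightarrow> running_inf X t \<omega>"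
proof -
  have rc: "continuous (at_right s) (\<lambda>s. - X s \<omega>)" if "0 \<le> s" for s
    using right_continuous[OF assms(1) that] by (rule continuous_minus)
  have ll: "\<exists>l. ((\<lambda>s. - X s \<omega>) \<longlongrightarrow> l) (at_left s)" if "0 < s" for s
    using left_limits[OF assms(1) that] tendsto_minus by blast
  have i: "(\<lambda>i. - X (real (Suc i) * h) \<omega> - - X (real i * h) \<omega>) = (\<lambda>i. - increments h \<omega> i)" for h
    by (auto simp: increments_def)
  have "(\<lambda>n. - (- X 0 \<omega> + walk (max 0) (nat \<lceil>t * 2 ^ n\<rceil>) (\<lambda>i. - increments (1 / 2 ^ n) \<omega> i))) \<longlonglongrightarrow> - (SUP s\<in>{0..t}. - X s \<omega>)"
    using grid_max_tendsto_sup[of "\<lambda>s. - X s \<omega>" t, OF rc ll assms(2)]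
    unfolding walk_max_path[of "\<lambda>s. - X s \<omega>"] i by (intro tendsto_minus) simp
  moreover have "- (SUP s\<in>{0..t}. - X s \<omega>) = running_inf X t \<omega>"
    unfolding running_inf_def Inf_real_def by (simp add: image_image)
  ultimately show ?thesis by (simp add: walk_uminus)
qed

lemma walk_measurable_M:
  assumes "g \<in> borel_measurable borel" "N \<in> M \<rightarrow>\<^sub>M count_space UNIV" "0 < h"
  shows "(\<lambda>\<omega>. walk g (N \<omega>) (increments h \<omega>)) \<in> borel_measurable M"
proof (rule measurable_compose_countable[OF _ assms(2)])
  fix n show "(\<lambda>\<omega>. walk g n (increments h \<omega>)) \<in> borel_measurable M"
    by (rule measurable_compose[OF increments_measurable[OF assms(3)] measurable_walk[OF assms(1)]])
qed

lemma X0_measurable: "X 0 \<in> borel_measurable M" by simp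

end

context levy_clock begin

lemma ceil_measurable: "(\<lambda>\<omega>. nat \<lceil>T \<omega> * 2 ^ n\<rceil>) \<in> M \<rightarrow>\<^sub>M count_space UNIV"
  by measurable

lemma sup_measurable: "(\<lambda>\<omega>. running_sup X (T \<omega>) \<omega>) \<in> borel_measurable M"
  by (rule borel_measurable_LIMSEQ_real[OF grid_sup[OF _ T_nonneg]])
    (auto intro!: borel_measurable_add X0_measurable walk_measurable_M ceil_measurable)

lemma inf_measurable: "(\<lambda>\<omega>. running_inf X (T \<omega>) \<omega>) \<in> borel_measurable M"
  by (rule borel_measurable_LIMSEQ_real[OF grid_inf[OF _ T_nonneg]])
    (auto intro!: borel_measurable_add X0_measurable walk_measurable_M ceil_measurable)

lemma grid_end:
  assumes "\<omega> \<in> space M"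
  shows "(\<lambda>n. X 0 \<omega> + walk (\<lambda>x. x) (nat \<lceil>T \<omega> * 2 ^ n\<rceil>) (increments (1 / 2 ^ n) \<omega>)) \<longlonglongrightarrow> X (T \<omega>) \<omega>"
  unfolding walk_id_eq sum_increments
  using cadlag_grid_tendsto[of "T \<omega>" "\<lambda>s. X s \<omega>"] right_continuous[OF assms] T_nonneg[OF assms]
  by (simp add: grid_up_def)

lemma end_measurable: "(\<lambda>\<omega>. X (T \<omega>) \<omega>) \<in> borel_measurable M"
  by (rule borel_measurable_LIMSEQ_real[OF grid_end])
    (auto intro!: borel_measurable_add X0_measurable walk_measurable_M ceil_measurable)

lemma rd_laws [simp]: "real_distribution (sup_law T)" "real_distribution (inf_law T)" "real_distribution (end_law T)"
  unfolding sup_law_def inf_law_def end_law_def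
  by (intro real_distribution_distr sup_measurable inf_measurable end_measurable)+

lemma steps_Suc:
  assumes "0 < t" shows "Suc (steps (1 / 2 ^ n) t) = nat \<lceil>t * 2 ^ n\<rceil>"
proof -
  have "0 < \<lceil>t * 2 ^ n\<rceil>" using assms by simp
  then show ?thesis unfolding steps_def by simp
qed

lemma integral_geo_seq_M:
  fixes f :: "nat \<times> (nat \<Rightarrow> real) \<Rightarrow> 'b::{banach, second_countable_topology}"
  assumes "0 < h" "f \<in> borel_measurable (count_space UNIV \<Otimes>\<^sub>M seqs)"
  shows "integral\<^sup>L (geo_seq (exp (- r * h)) (increment_law h)) f = (\<integral>\<omega>. f (steps h (T \<omega>), increments h \<omega>) \<partial>M)"
proof -
  note increments_measurable[OF assms(1), measurable] measurable_compose[OF T_measurable steps_measurable, measurable]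
  show ?thesis
    unfolding distr_steps_increments[OF assms(1), symmetric]
    by (rule integral_distr[OF _ assms(2)]) measurable
qed

lemma disc_bounds: "0 < disc r n" "disc r n < 1"
  using r by auto

text \<open>
  Dominated convergence; the hypothesis on Y is pathwise convergence along the dyadic grids.
\<close>

lemma char_walk_law_tendsto:
  assumes g: "g \<in> borel_measurable borel"
    and lim: "\<And>\<omega>. \<omega> \<in> space M \<Longrightarrow>
      (\<lambda>n. X 0 \<omega> + walk g (nat \<lceil>T \<omega> * 2 ^ n\<rceil>) (increments (1 / 2 ^ n) \<omega>)) \<longlonglongrightarrow> Y \<omega>"
    and Y: "Y \<in> borel_measurable M"
  shows "(\<lambda>n. char (walk_law (disc r n) (grid_step n) g) t) \<longlonglongrightarrow> char (distr M borel Y) t"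
proof -
  have h: "0 < 1 / (2::real) ^ n" for n by simp
  note m = measurable_compose[OF T_measurable steps_measurable]
  have wm: "(\<lambda>\<omega>. walk g (Suc (steps (1 / 2 ^ n) (T \<omega>))) (increments (1 / 2 ^ n) \<omega>)) \<in> borel_measurable M" for n
    by (intro walk_measurable_M[OF g _ h] measurable_compose[OF m measurable_count_space])
  have E: "char (walk_law (disc r n) (grid_step n) g) t =
     (1 - disc r n) *\<^sub>R 1 + disc r n *\<^sub>R (\<integral>\<omega>. iexp (t * walk g (Suc (steps (1 / 2 ^ n) (T \<omega>))) (increments (1 / 2 ^ n) \<omega>)) \<partial>M)" for n
  proof -
    have mm: "(\<lambda>p. iexp (t * walk g (Suc (fst p)) (snd p))) \<in> borel_measurable (count_space UNIV \<Otimes>\<^sub>M seqs)"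
      using measurable_compose[OF measurable_walk[OF g] iexp_measurable] by (intro measurable_nat_seq) (simp del: walk.simps)
    show ?thesis
      unfolding char_def
      by (subst integral_walk_law_Suc[OF rd_grid_step disc_bounds g, where B=1])
        (use integral_geo_seq_M[OF h[of n] mm] in \<open>auto simp del: walk.simps\<close>)
  qed
  have "(\<lambda>n. \<integral>\<omega>. iexp (t * walk g (Suc (steps (1 / 2 ^ n) (T \<omega>))) (increments (1 / 2 ^ n) \<omega>)) \<partial>M) \<longlonglongrightarrow> (\<integral>\<omega>. iexp (t * Y \<omega>) \<partial>M)"
  proof (rule integral_dominated_convergence[where w="\<lambda>_. 1"])
    show "(\<lambda>\<omega>. iexp (t * Y \<omega>)) \<in> borel_measurable M"
      by (rule measurable_compose[OF Y iexp_measurable])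
    show "(\<lambda>\<omega>. iexp (t * walk g (Suc (steps (1 / 2 ^ n) (T \<omega>))) (increments (1 / 2 ^ n) \<omega>))) \<in> borel_measurable M" for n
      by (rule measurable_compose[OF wm iexp_measurable])
    show "AE \<omega> in M. (\<lambda>n. iexp (t * walk g (Suc (steps (1 / 2 ^ n) (T \<omega>))) (increments (1 / 2 ^ n) \<omega>))) \<longlonglongrightarrow> iexp (t * Y \<omega>)"
      using T_pos start_zero AE_space
    proof eventually_elim
      case (elim \<omega>)
      have "(\<lambda>n. walk g (Suc (steps (1 / 2 ^ n) (T \<omega>))) (increments (1 / 2 ^ n) \<omega>)) \<longlonglongrightarrow> Y \<omega>"
        using lim[OF elim(3)] unfolding steps_Suc[OF elim(1)] elim(2) by simp
      then show ?case by (intro tendsto_intros)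
    qed
  qed auto
  then have "(\<lambda>n. (1 - disc r n) *\<^sub>R 1 + disc r n *\<^sub>R (\<integral>\<omega>. iexp (t * walk g (Suc (steps (1 / 2 ^ n) (T \<omega>))) (increments (1 / 2 ^ n) \<omega>)) \<partial>M)) \<longlonglongrightarrow>
      (1 - 1) *\<^sub>R 1 + 1 *\<^sub>R (\<integral>\<omega>. iexp (t * Y \<omega>) \<partial>M)"
    by (intro tendsto_intros disc_tendsto)
  moreover have "char (distr M borel Y) t = (\<integral>\<omega>. iexp (t * Y \<omega>) \<partial>M)"
    unfolding char_def using Y by (subst integral_distr) auto
  ultimately show ?thesis unfolding E by simp
qed

abbreviation "grid_sup_law n \<equiv> walk_law (disc r n) (grid_step n) (max 0)"
abbreviation "grid_inf_law n \<equiv> walk_law (disc r n) (grid_step n) (min 0)"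

lemma grid_sup_law_tendsto: "(\<lambda>n. char (grid_sup_law n) t) \<longlonglongrightarrow> char (sup_law T) t"
  unfolding sup_law_def
  by (rule char_walk_law_tendsto[OF _ grid_sup[OF _ T_nonneg] sup_measurable]) auto

lemma grid_inf_law_tendsto: "(\<lambda>n. char (grid_inf_law n) t) \<longlonglongrightarrow> char (inf_law T) t"
  unfolding inf_law_def
  by (rule char_walk_law_tendsto[OF _ grid_inf[OF _ T_nonneg] inf_measurable]) auto

lemma grid_end_law_tendsto: "(\<lambda>n. char (walk_law (disc r n) (grid_step n) (\<lambda>x. x)) t) \<longlonglongrightarrow> char (end_law T) t"
  unfolding end_law_def
  by (rule char_walk_law_tendsto[OF _ grid_end end_measurable]) auto

lemma rd_grid_sup_law [simp]: "real_distribution (grid_sup_law n)" "real_distribution (grid_inf_law n)"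
  using step_law.rd[OF step_law_grid_step] by auto

theorem wiener_hopf: "char (end_law T) t = char (sup_law T) t * char (inf_law T) t"
proof (rule LIMSEQ_unique)
  show "(\<lambda>n. char (walk_law (disc r n) (grid_step n) (\<lambda>x. x)) t) \<longlonglongrightarrow> char (end_law T) t" by (rule grid_end_law_tendsto)
  show "(\<lambda>n. char (walk_law (disc r n) (grid_step n) (\<lambda>x. x)) t) \<longlonglongrightarrow> char (sup_law T) t * char (inf_law T) t"
    unfolding step_law.char_sum_law_eq_max_law_min_law[OF step_law_grid_step disc_bounds]
    by (intro tendsto_mult grid_sup_law_tendsto grid_inf_law_tendsto)
qed

end

locale two_clocks = A: levy_clock M X q S + B: levy_clock M X q' T for M :: "'a measure" and X q q' S T
begin

text \<open>
  The law of Z, the sum of independent copies of the infimum at rate q' and the supremum at rate q.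
\<close>

definition cross_law where "cross_law = convolution (A.inf_law T) (A.sup_law S)"
definition grid_cross_law where "grid_cross_law n = convolution (B.grid_inf_law n) (A.grid_sup_law n)"

lemma rd_cross_law [simp]: "real_distribution cross_law" "real_distribution (grid_cross_law n)"
  unfolding cross_law_def grid_cross_law_def
  by (intro real_distribution_convolution A.rd_laws B.rd_laws A.rd_grid_sup_law B.rd_grid_sup_law)+

lemma grid_cross_law_weak: "weak_conv_m grid_cross_law cross_law"
proof (rule levy_continuity)
  show "(\<lambda>n. char (grid_cross_law n) t) \<longlonglongrightarrow> char cross_law t" for t
    unfolding cross_law_def grid_cross_law_def
    unfolding char_convolution[OF B.rd_laws(2) A.rd_laws(1)] char_convolution[OF B.rd_grid_sup_law(2) A.rd_grid_sup_law(1)]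
    by (intro tendsto_mult A.grid_sup_law_tendsto B.grid_inf_law_tendsto)
qed auto

lemma grid_cross_law_clamp:
  assumes "continuous_on UNIV g"
  shows "(\<lambda>n. char (distr (grid_cross_law n) borel g) t) \<longlonglongrightarrow> char (distr cross_law borel g) t"
proof -
  have g: "g \<in> borel_measurable borel" using assms by (rule borel_measurable_continuous_onI)
  show ?thesis
    unfolding char_distr[OF rd_cross_law(1) g] char_distr[OF rd_cross_law(2) g]
  proof (rule weak_conv_imp_integral_bdd_continuous_conv[OF _ _ grid_cross_law_weak, where B=1])
    show "isCont (\<lambda>x. iexp (t * g x)) x" for x
      using assms by (intro continuous_intros) (auto simp: continuous_on_eq_continuous_at)
  qed auto
qed

lemma rates:
  "(\<lambda>n. (1 - A.disc q' n) * 2 ^ n) \<longlonglongrightarrow> q'"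
  "(\<lambda>n. (A.disc q' n / A.disc q n * (1 - A.disc q n)) * 2 ^ n) \<longlonglongrightarrow> q"
  "(\<lambda>n. (1 - A.disc q' n / A.disc q n) * 2 ^ n) \<longlonglongrightarrow> q' - q"
proof -
  show "(\<lambda>n. (1 - A.disc q' n) * 2 ^ n) \<longlonglongrightarrow> q'" by (rule discretisation_rate)
  have "(\<lambda>n. A.disc q' n / A.disc q n * ((1 - A.disc q n) * 2 ^ n)) \<longlonglongrightarrow> 1 / 1 * q"
    by (intro tendsto_intros disc_tendsto discretisation_rate) auto
  then show "(\<lambda>n. (A.disc q' n / A.disc q n * (1 - A.disc q n)) * 2 ^ n) \<longlonglongrightarrow> q" by (simp add: mult.assoc)
  have "A.disc q' n / A.disc q n = A.disc (q' - q) n" for n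
    by (simp add: exp_diff[symmetric] algebra_simps diff_divide_distrib)
  then show "(\<lambda>n. (1 - A.disc q' n / A.disc q n) * 2 ^ n) \<longlonglongrightarrow> q' - q"
    using discretisation_rate[of "q' - q"] by simp
qed

text \<open>
  The law of the supremum at rate q is the convolution of the one at rate q' with a combination of the
  point mass at 0 and the law of the positive part of Z; for q > q' the combination is signed.
\<close>

theorem sup_law_relation:
  "complex_of_real q' * char (A.sup_law S) t = char (A.sup_law T) t *
    (complex_of_real q + complex_of_real (q' - q) * char (distr cross_law borel (max 0)) t)"
proof (rule LIMSEQ_unique)
  let ?c = "\<lambda>a n. complex_of_real (a * 2 ^ n)"
  show "(\<lambda>n. ?c (1 - A.disc q' n) n * char (A.grid_sup_law n) t) \<longlonglongrightarrow> complex_of_real q' * char (A.sup_law S) t"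
    by (intro tendsto_mult tendsto_of_real rates A.grid_sup_law_tendsto)
  have "?c (1 - A.disc q' n) n * char (A.grid_sup_law n) t = char (B.grid_sup_law n) t *
     (?c (A.disc q' n / A.disc q n * (1 - A.disc q n)) n + ?c (1 - A.disc q' n / A.disc q n) n * char (distr (grid_cross_law n) borel (max 0)) t)" for n
    using arg_cong[OF step_law.max_law_relation[OF A.step_law_grid_step A.disc_bounds B.disc_bounds, of n n n t], of "\<lambda>v. 2 ^ n * v"]
    unfolding grid_cross_law_def of_real_mult of_real_power of_real_numeral by (simp only: algebra_simps)
  moreover have "(\<lambda>n. char (B.grid_sup_law n) t *
     (?c (A.disc q' n / A.disc q n * (1 - A.disc q n)) n + ?c (1 - A.disc q' n / A.disc q n) n * char (distr (grid_cross_law n) borel (max 0)) t)) \<longlonglongrightarrow>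
      char (A.sup_law T) t * (complex_of_real q + complex_of_real (q' - q) * char (distr cross_law borel (max 0)) t)"
    by (intro tendsto_mult tendsto_add tendsto_of_real rates B.grid_sup_law_tendsto grid_cross_law_clamp continuous_intros)
  ultimately show "(\<lambda>n. ?c (1 - A.disc q' n) n * char (A.grid_sup_law n) t) \<longlonglongrightarrow>
      char (A.sup_law T) t * (complex_of_real q + complex_of_real (q' - q) * char (distr cross_law borel (max 0)) t)"
    by simp
qed

theorem inf_law_relation:
  "complex_of_real q * char (A.inf_law T) t = char (A.inf_law S) t *
    (complex_of_real q' - complex_of_real (q' - q) * char (distr cross_law borel (min 0)) t)"
proof (rule LIMSEQ_unique)
  let ?c = "\<lambda>a n. complex_of_real (a * 2 ^ n)"
  show "(\<lambda>n. ?c (A.disc q' n / A.disc q n * (1 - A.disc q n)) n * char (B.grid_inf_law n) t) \<longlonglongrightarrow> complex_of_real q * char (A.inf_law T) t"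
    by (intro tendsto_mult tendsto_of_real rates B.grid_inf_law_tendsto)
  have "?c (A.disc q' n / A.disc q n * (1 - A.disc q n)) n * char (B.grid_inf_law n) t = char (A.grid_inf_law n) t *
     (?c (1 - A.disc q' n) n - ?c (1 - A.disc q' n / A.disc q n) n * char (distr (grid_cross_law n) borel (min 0)) t)" for n
    using arg_cong[OF step_law.min_law_relation[OF A.step_law_grid_step A.disc_bounds B.disc_bounds, of n n n t], of "\<lambda>v. 2 ^ n * v"]
    unfolding grid_cross_law_def of_real_mult of_real_power of_real_numeral by (simp only: algebra_simps)
  moreover have "(\<lambda>n. char (A.grid_inf_law n) t *
     (?c (1 - A.disc q' n) n - ?c (1 - A.disc q' n / A.disc q n) n * char (distr (grid_cross_law n) borel (min 0)) t)) \<longlonglongrightarrow>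
      char (A.inf_law S) t * (complex_of_real q' - complex_of_real (q' - q) * char (distr cross_law borel (min 0)) t)"
    by (intro tendsto_mult tendsto_diff tendsto_of_real rates A.grid_inf_law_tendsto grid_cross_law_clamp continuous_intros)
  ultimately show "(\<lambda>n. ?c (A.disc q' n / A.disc q n * (1 - A.disc q n)) n * char (B.grid_inf_law n) t) \<longlonglongrightarrow>
      char (A.inf_law S) t * (complex_of_real q' - complex_of_real (q' - q) * char (distr cross_law borel (min 0)) t)"
    by simp
qed

end

section \<open>A process that stays at 0 is compound Poisson\<close>

lemma integral_iid_walk_id:
  assumes "real_distribution lam"
  shows "(\<integral>\<xi>. iexp (t * walk (\<lambda>x. x) n \<xi>) \<partial>PiM UNIV (\<lambda>_. lam)) = char lam t ^ n"
proof (induction n)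
  case 0
  interpret S: prob_space "PiM UNIV (\<lambda>_::nat. lam)" using prob_space_iid[OF assms] .
  show ?case by (simp add: S.prob_space)
next
  case (Suc n)
  have m: "(\<lambda>\<xi>. iexp (t * walk (\<lambda>x. x) (Suc n) \<xi>)) \<in> borel_measurable seqs"
    by (rule measurable_compose[OF measurable_walk iexp_measurable]) simp
  have "(\<integral>\<xi>. iexp (t * walk (\<lambda>x. x) (Suc n) \<xi>) \<partial>PiM UNIV (\<lambda>_. lam)) =
    (\<integral>x. \<integral>\<xi>. iexp (t * x) * iexp (t * walk (\<lambda>x. x) n \<xi>) \<partial>PiM UNIV (\<lambda>_. lam) \<partial>lam)"
    unfolding integral_iid_first_step[OF assms m, where B=1, unfolded norm_exp_i_times, OF order_refl]
    by (simp add: distrib_left exp_add)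
  then show ?case using Suc by (simp add: char_def)
qed

lemma real_distribution_compound_poisson:
  assumes "real_distribution m"
  shows "real_distribution (compound_poisson_distr c m)"
    and "0 < c \<Longrightarrow> char (compound_poisson_distr c m) t = exp (complex_of_real c * (char m t - 1))"
proof -
  let ?P = "measure_pmf (poisson_pmf c)" and ?S = "PiM UNIV (\<lambda>_::nat. m)"
  interpret S: prob_space ?S using prob_space_iid[OF assms] .
  interpret P: pair_prob_space ?P ?S ..
  have sets: "sets (?P \<Otimes>\<^sub>M ?S) = sets (count_space UNIV \<Otimes>\<^sub>M seqs)"
    by (rule sets_pair_measure_cong) (auto simp: sets_iid[OF assms])
  have eq: "(\<lambda>(n, \<xi>). \<Sum>i<n. \<xi> i) = (\<lambda>p. walk (\<lambda>x. x) (fst p) (snd p))"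
    by (auto simp: walk_id_eq)
  have m: "(\<lambda>(n, \<xi>). \<Sum>i<n. \<xi> i) \<in> borel_measurable (?P \<Otimes>\<^sub>M ?S)"
    unfolding measurable_cong_sets[OF sets refl] eq by (rule measurable_walk_pair) simp
  show "real_distribution (compound_poisson_distr c m)"
    unfolding compound_poisson_distr_def by (rule P.real_distribution_distr[OF m])
  assume c: "0 < c"
  have "char (compound_poisson_distr c m) t = (\<integral>p. iexp (t * walk (\<lambda>x. x) (fst p) (snd p)) \<partial>(?P \<Otimes>\<^sub>M ?S))"
    unfolding char_def compound_poisson_distr_def
    by (subst integral_distr[OF m]) (auto simp: walk_id_eq case_prod_beta)
  also have "\<dots> = (\<integral>n. char m t ^ n \<partial>?P)"
  proof (subst integral_pmf_seq[OF assms, where B=1])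
    show "(\<lambda>\<xi>. iexp (t * walk (\<lambda>x. x) (fst (n, \<xi>)) (snd (n, \<xi>)))) \<in> borel_measurable seqs" for n
      unfolding fst_conv snd_conv by (rule measurable_compose[OF measurable_walk iexp_measurable]) simp
  qed (simp_all only: fst_conv snd_conv integral_iid_walk_id[OF assms] norm_exp_i_times order_refl)
  also have "\<dots> = exp (complex_of_real c * (char m t - 1))"
  proof -
    let ?w = "char m t"
    have d: "?P = density (count_space UNIV) (\<lambda>n. ennreal (c ^ n / fact n * exp (- c)))"
      unfolding measure_pmf_eq_density using c by simp
    have s: "(\<lambda>n. (complex_of_real c * ?w) ^ n /\<^sub>R fact n) sums exp (complex_of_real c * ?w)" by (rule exp_converges)
    have eqn: "(c ^ n / fact n * exp (- c)) *\<^sub>R ?w ^ n = exp (- c) *\<^sub>R ((complex_of_real c * ?w) ^ n /\<^sub>R fact n)" for n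
      by (simp add: scaleR_conv_of_real power_mult_distrib field_simps)
    have "summable (\<lambda>n. norm ((complex_of_real c * ?w) ^ n /\<^sub>R fact n))" by (rule summable_norm_exp)
    then have i: "integrable (count_space UNIV) (\<lambda>n. (c ^ n / fact n * exp (- c)) *\<^sub>R ?w ^ n)"
      unfolding eqn integrable_count_space_nat_iff norm_scaleR[of "exp (- c)"] by (rule summable_mult)
    have "(\<integral>n. ?w ^ n \<partial>?P) = (\<integral>n. (c ^ n / fact n * exp (- c)) *\<^sub>R ?w ^ n \<partial>count_space UNIV)"
      unfolding d using c by (subst integral_density) auto
    also have "\<dots> = exp (- c) *\<^sub>R exp (complex_of_real c * ?w)"
      using sums_unique2[OF sums_integral_count_space_nat[OF i] sums_scaleR_right[OF s, of "exp (- c)", folded eqn]] .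
    also have "\<dots> = exp (complex_of_real c * (?w - 1))"
      by (simp add: scaleR_conv_of_real exp_of_real[symmetric] mult_exp_exp algebra_simps)
    finally show ?thesis .
  qed
  finally show "char (compound_poisson_distr c m) t = exp (complex_of_real c * (char m t - 1))" .
qed

text \<open>
  Writes lam as a mixture of \<delta> and a distribution \<rho> with a prescribed weight k of the latter.  Keeping k
  free, instead of conditioning on a nonzero value, lets \<rho> have an atom at 0 and covers a
  degenerate lam.
\<close>

lemma remove_atom_at_zero:
  fixes k :: real
  assumes lam: "real_distribution lam" and k: "0 < k" and a: "0 < measure lam {0}" "1 - k \<le> measure lam {0}"
  obtains \<rho> where "real_distribution \<rho>"
    "\<And>(g :: real \<Rightarrow> real) B. g \<in> borel_measurable borel \<Longrightarrow> (\<And>x. \<bar>g x\<bar> \<le> B) \<Longrightarrow>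
       integral\<^sup>L lam g = (1 - k) * g 0 + k * integral\<^sup>L \<rho> g"
    "\<And>t. char lam t = complex_of_real (1 - k) + complex_of_real k * char \<rho> t"
proof -
  interpret real_distribution lam by fact
  define w where "w = measure lam {0}"
  define f where "f x = 1 / k - (1 - k) / (k * w) * indicator {0} x" for x :: real
  have w: "0 < w" "1 - k \<le> w" using a by (auto simp: w_def)
  have f0: "0 \<le> f x" for x
  proof -
    have "(1 - k) / w \<le> 1" using w by (simp add: field_simps)
    then have "(1 - k) / w / k \<le> 1 / k" using k by (intro divide_right_mono) auto
    then show ?thesis unfolding f_def using k by (auto simp: indicator_def mult.commute)
  qed
  have [measurable]: "f \<in> borel_measurable borel" unfolding f_def by measurable
  define \<rho> where "\<rho> = density lam (\<lambda>x. ennreal (f x))"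
  have j: "integrable lam (\<lambda>x. indicator {0} x :: real)"
    by (rule real_distribution_bounded_integrable[OF lam, where B=1]) (auto simp: indicator_def)
  have fi: "integrable lam f"
    unfolding f_def[abs_def] by (intro Bochner_Integration.integrable_diff integrable_mult_right j) simp
  have int: "k *\<^sub>R integral\<^sup>L \<rho> g = integral\<^sup>L lam g - (1 - k) *\<^sub>R g 0"
    if g[measurable]: "g \<in> borel_measurable borel" and B: "\<And>x. norm (g x) \<le> B"
    for g :: "real \<Rightarrow> 'b :: {banach, second_countable_topology}" and B
  proof -
    have i: "integrable lam g" using lam g B by (rule real_distribution_bounded_integrable)
    have "integral\<^sup>L \<rho> g = (\<integral>x. f x *\<^sub>R g x \<partial>lam)"
      unfolding \<rho>_def using f0 by (intro integral_density) auto
    also have "(\<lambda>x. f x *\<^sub>R g x) = (\<lambda>x. (1 / k) *\<^sub>R g x - indicator {0} x *\<^sub>R (((1 - k) / (k * w)) *\<^sub>R g 0))"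
      by (auto simp: f_def fun_eq_iff indicator_def algebra_simps)
    also have "integral\<^sup>L lam \<dots> = (1 / k) *\<^sub>R integral\<^sup>L lam g - w *\<^sub>R (((1 - k) / (k * w)) *\<^sub>R g 0)"
      using i j unfolding w_def
      by (subst Bochner_Integration.integral_diff) (auto simp del: scaleR_scaleR)
    finally show ?thesis using k w by (simp add: scaleR_diff_right)
  qed
  have "(\<integral>\<^sup>+x. ennreal (f x) \<partial>lam) = ennreal (\<integral>x. f x \<partial>lam)"
    using f0 fi by (intro nn_integral_eq_integral) auto
  also have "(\<integral>x. f x \<partial>lam) = 1 / k - (1 - k) / (k * w) * w"
    unfolding f_def w_def using j by (subst Bochner_Integration.integral_diff) (auto simp: prob_space[simplified])
  also have "\<dots> = 1" using k w by (simp add: field_simps)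
  finally have "emeasure \<rho> (space \<rho>) = 1" unfolding \<rho>_def by (subst emeasure_density) auto
  then have p: "real_distribution \<rho>"
    by (intro real_distribution.intro prob_spaceI real_distribution_axioms.intro) (auto simp: \<rho>_def)
  show ?thesis
  proof (rule that[OF p])
    show "integral\<^sup>L lam g = (1 - k) * g 0 + k * integral\<^sup>L \<rho> g"
      if "g \<in> borel_measurable borel" "\<And>x. \<bar>g x\<bar> \<le> B" for g :: "real \<Rightarrow> real" and B
      using int[of g B] that by simp
    show "char lam t = complex_of_real (1 - k) + complex_of_real k * char \<rho> t" for t
      using int[of "\<lambda>x. iexp (t * x)" 1] unfolding char_def
      by (simp add: scaleR_conv_of_real algebra_simps)
  qed
qed

lemma exp_minus_one_bound:
  fixes u :: complex assumes "norm u \<le> 1"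
  shows "norm (exp u - (1 + u)) \<le> 3 * (norm u)\<^sup>2"
proof -
  have "norm (exp u - (1 + u)) \<le> exp \<bar>Re u\<bar> * (norm u)\<^sup>2"
    using Taylor_exp[of u 1] by (simp add: power2_eq_square mult.assoc)
  also have "exp \<bar>Re u\<bar> \<le> exp 1" using abs_Re_le_cmod[of u] assms by simp
  also have "exp (1::real) \<le> 3" by (rule exp_le)
  finally show ?thesis by (simp add: mult_right_mono)
qed

text \<open>
  The law of rare events: m steps, each of which moves with probability L h, with m h near t.
\<close>

lemma compound_poisson_char_limit:
  fixes p :: "nat \<Rightarrow> complex" and h :: "nat \<Rightarrow> real" and m :: "nat \<Rightarrow> nat"
  assumes L: "0 < L" and p: "\<And>n. norm (p n) \<le> 1" "p \<longlonglongrightarrow> \<psi>" and h: "h \<longlonglongrightarrow> 0" "\<And>n. 0 \<le> h n" "\<And>n. L * h n \<le> 1"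
    and mh: "(\<lambda>n. real (m n) * h n) \<longlonglongrightarrow> t"
  shows "(\<lambda>n. (complex_of_real (1 - L * h n) + complex_of_real (L * h n) * p n) ^ m n) \<longlonglongrightarrow> exp (complex_of_real (L * t) * (\<psi> - 1))"
proof -
  define a where "a n = complex_of_real (1 - L * h n) + complex_of_real (L * h n) * p n" for n
  define b where "b n = exp (complex_of_real (L * h n) * (\<psi> - 1))" for n
  have \<psi>: "norm \<psi> \<le> 1" using tendsto_norm[OF p(2)] by (rule LIMSEQ_le_const2) (auto intro: p)
  have \<psi>2: "norm (\<psi> - 1) \<le> 2" using norm_triangle_ineq4[of \<psi> 1] \<psi> by simp
  have na: "norm (a n) \<le> 1" for n
  proof -
    have "norm (a n) \<le> norm (complex_of_real (1 - L * h n)) + norm (complex_of_real (L * h n)) * norm (p n)"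
      unfolding a_def by (metis norm_mult norm_triangle_ineq)
    also have "\<dots> \<le> (1 - L * h n) + L * h n * 1"
      using h(2,3)[of n] L p(1)[of n] by (intro add_mono mult_mono) (auto simp del: of_real_diff of_real_mult)
    finally show ?thesis by simp
  qed
  have nb: "norm (b n) \<le> 1" for n
  proof -
    have "Re \<psi> \<le> 1" using complex_Re_le_cmod[of \<psi>] \<psi> by linarith
    then have "L * h n * (Re \<psi> - 1) \<le> 0" using h(2)[of n] L by (intro mult_nonneg_nonpos) auto
    then show ?thesis unfolding b_def by simp
  qed
  have 1: "(\<lambda>n. a n ^ m n - b n ^ m n) \<longlonglongrightarrow> 0"
  proof (rule Lim_null_comparison)
    have lim: "(\<lambda>n. L * (real (m n) * h n) * norm (p n - \<psi>) + 12 * L\<^sup>2 * (real (m n) * h n) * h n) \<longlonglongrightarrow> L * t * norm (\<psi> - \<psi>) + 12 * L\<^sup>2 * t * 0"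
      by (intro tendsto_intros mh p h)
    then show "(\<lambda>n. L * (real (m n) * h n) * norm (p n - \<psi>) + 12 * L\<^sup>2 * (real (m n) * h n) * h n) \<longlonglongrightarrow> 0" by simp
    have "eventually (\<lambda>n. h n < 1 / (2 * L)) sequentially"
      using h(1) L by (intro order_tendstoD) auto
    then show "eventually (\<lambda>n. norm (a n ^ m n - b n ^ m n) \<le> L * (real (m n) * h n) * norm (p n - \<psi>) + 12 * L\<^sup>2 * (real (m n) * h n) * h n) sequentially"
    proof eventually_elim
      fix n assume n: "h n < 1 / (2 * L)"
      let ?u = "complex_of_real (L * h n) * (\<psi> - 1)"
      have Lh: "0 \<le> L * h n" "L * h n \<le> 1 / 2" using n L h(2)[of n] by (auto simp: field_simps)
      have nu: "norm ?u \<le> 2 * (L * h n)"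
        using mult_left_mono[OF \<psi>2 Lh(1)] Lh(1) by (simp add: norm_mult mult.commute del: of_real_mult)
      have "norm (a n - b n) \<le> norm (complex_of_real (L * h n) * (p n - \<psi>)) + norm (exp ?u - (1 + ?u))"
      proof -
        have "a n - b n = complex_of_real (L * h n) * (p n - \<psi>) - (exp ?u - (1 + ?u))"
          unfolding a_def b_def by (simp add: algebra_simps)
        then show ?thesis by (simp only: norm_triangle_ineq4)
      qed
      also have "\<dots> \<le> L * h n * norm (p n - \<psi>) + 3 * (2 * (L * h n))\<^sup>2"
        using exp_minus_one_bound[of ?u] nu Lh power_mono[OF nu, of 2]
        by (intro add_mono) (auto simp: norm_mult simp del: of_real_mult)
      finally have ab: "norm (a n - b n) \<le> L * h n * norm (p n - \<psi>) + 3 * (2 * (L * h n))\<^sup>2" .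
      have "norm (a n ^ m n - b n ^ m n) \<le> real (m n) * norm (a n - b n)"
        by (rule norm_power_diff[OF na nb])
      also have "\<dots> \<le> real (m n) * (L * h n * norm (p n - \<psi>) + 3 * (2 * (L * h n))\<^sup>2)"
        by (intro mult_left_mono ab) auto
      finally show "norm (a n ^ m n - b n ^ m n) \<le> L * (real (m n) * h n) * norm (p n - \<psi>) + 12 * L\<^sup>2 * (real (m n) * h n) * h n"
        by (simp add: algebra_simps power2_eq_square)
    qed
  qed
  have "b n ^ m n = exp (complex_of_real (L * (real (m n) * h n)) * (\<psi> - 1))" for n
    unfolding b_def exp_of_nat_mult[symmetric] by (simp add: algebra_simps)
  then have 2: "(\<lambda>n. b n ^ m n) \<longlonglongrightarrow> exp (complex_of_real (L * t) * (\<psi> - 1))"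
    by (auto intro!: tendsto_intros mh simp del: of_real_mult)
  from tendsto_add[OF 1 2] show ?thesis by (simp add: a_def)
qed

lemma tight_char_limit_point:
  assumes "tight \<mu>"
  obtains s m where "strict_mono s" "real_distribution m" "\<And>t. (\<lambda>n. char (\<mu> (s n)) t) \<longlonglongrightarrow> char m t"
proof -
  obtain s m where s: "strict_mono s" "real_distribution m" "weak_conv_m (\<mu> \<circ> id \<circ> s) m"
    using tight_imp_convergent_subsubsequence[OF assms, of id] by (auto simp: strict_mono_def)
  have "(\<lambda>n. char ((\<mu> \<circ> s) n) t) \<longlonglongrightarrow> char m t" for t
    using s assms by (intro levy_continuity1) (auto simp: tight_def comp_def)
  then show ?thesis using that s by simp
qed

context levy_process begin

lemma indep_increment_pair:
  assumes "0 < s" "0 < t" and [measurable]: "A \<in> sets borel" "B \<in> sets borel"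
  shows "prob {\<omega>\<in>space M. X s \<omega> \<in> A \<and> X (s + t) \<omega> - X s \<omega> \<in> B} =
    prob {\<omega>\<in>space M. X s \<omega> \<in> A} * prob {\<omega>\<in>space M. X t \<omega> \<in> B}"
proof -
  define \<tau> where "\<tau> i = (if i = 0 then 0 else if i = 1 then s else s + t)" for i :: nat
  have [measurable]: "X s \<in> borel_measurable M" "X t \<in> borel_measurable M" "X (s + t) \<in> borel_measurable M" "X 0 \<in> borel_measurable M"
    using assms by auto
  have "indep_vars (\<lambda>_. borel) (\<lambda>i \<omega>. X (\<tau> (Suc i)) \<omega> - X (\<tau> i) \<omega>) {..<2}"
    using assms by (intro indep_increments) (auto simp: \<tau>_def less_2_cases_iff)
  from indep_varsD[OF this, of "{..<2}" "\<lambda>i. if i = 0 then A else B"]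
  have 1: "prob (\<Inter>i\<in>{..<2}. (\<lambda>\<omega>. X (\<tau> (Suc i)) \<omega> - X (\<tau> i) \<omega>) -` (if i = 0 then A else B) \<inter> space M) =
    prob ((\<lambda>\<omega>. X s \<omega> - X 0 \<omega>) -` A \<inter> space M) * prob ((\<lambda>\<omega>. X (s + t) \<omega> - X s \<omega>) -` B \<inter> space M)"
    by (auto simp: \<tau>_def numeral_2_eq_2 lessThan_Suc)
  have "(\<Inter>i\<in>{..<2}. (\<lambda>\<omega>. X (\<tau> (Suc i)) \<omega> - X (\<tau> i) \<omega>) -` (if i = 0 then A else B) \<inter> space M) =
     {\<omega>\<in>space M. X s \<omega> - X 0 \<omega> \<in> A \<and> X (s + t) \<omega> - X s \<omega> \<in> B}"
    by (auto simp: \<tau>_def numeral_2_eq_2 lessThan_Suc)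
  also have "prob \<dots> = prob {\<omega>\<in>space M. X s \<omega> \<in> A \<and> X (s + t) \<omega> - X s \<omega> \<in> B}"
    using start_zero by (intro finite_measure_eq_AE) (auto elim!: eventually_mono)
  finally have 2: "prob {\<omega>\<in>space M. X s \<omega> \<in> A \<and> X (s + t) \<omega> - X s \<omega> \<in> B} =
    prob ((\<lambda>\<omega>. X s \<omega> - X 0 \<omega>) -` A \<inter> space M) * prob ((\<lambda>\<omega>. X (s + t) \<omega> - X s \<omega>) -` B \<inter> space M)"
    using 1 by simp
  have "prob ((\<lambda>\<omega>. X s \<omega> - X 0 \<omega>) -` A \<inter> space M) = prob {\<omega>\<in>space M. X s \<omega> \<in> A}"
    using start_zero by (intro finite_measure_eq_AE) (auto elim!: eventually_mono)
  moreover have "prob ((\<lambda>\<omega>. X (s + t) \<omega> - X s \<omega>) -` B \<inter> space M) = prob {\<omega>\<in>space M. X t \<omega> \<in> B}"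
  proof -
    have "measure (distr M borel (\<lambda>\<omega>. X (s + t) \<omega> - X s \<omega>)) B = measure (distr M borel (X t)) B"
      using stationary_increments[of s "s + t"] assms by simp
    then show ?thesis by (simp add: measure_distr vimage_def Int_def conj_commute)
  qed
  ultimately show ?thesis using 2 by simp
qed

abbreviation "prob_zero t \<equiv> prob {\<omega>\<in>space M. X t \<omega> = 0}"
abbreviation "prob_large \<kappa> t \<equiv> prob {\<omega>\<in>space M. \<kappa> < \<bar>X t \<omega>\<bar>}"

text \<open>
  At time s + t the value 0 is taken by staying at 0 or by a jump away and a jump back, which needs
  a nonzero increment after a nonzero value.
\<close>

lemma prob_zero_step:
  assumes "0 < s" "0 < t"
  shows "prob_zero (s + t) \<le> prob_zero s - (1 - prob_zero t) * (2 * prob_zero s - 1)"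
proof -
  have [measurable]: "X s \<in> borel_measurable M" "X t \<in> borel_measurable M" "X (s + t) \<in> borel_measurable M"
    using assms by auto
  have neg: "prob {\<omega>\<in>space M. X u \<omega> \<noteq> 0} = 1 - prob_zero u" if [measurable]: "X u \<in> borel_measurable M" for u
  proof -
    have "{\<omega>\<in>space M. X u \<omega> \<noteq> 0} = space M - {\<omega>\<in>space M. X u \<omega> = 0}" by auto
    then show ?thesis by (simp add: prob_compl)
  qed
  have "prob_zero (s + t) \<le> prob ({\<omega>\<in>space M. X s \<omega> \<in> {0} \<and> X (s + t) \<omega> - X s \<omega> \<in> {0}} \<union>
      {\<omega>\<in>space M. X s \<omega> \<in> - {0} \<and> X (s + t) \<omega> - X s \<omega> \<in> - {0}})"
    by (intro finite_measure_mono) auto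
  also have "\<dots> \<le> prob {\<omega>\<in>space M. X s \<omega> \<in> {0} \<and> X (s + t) \<omega> - X s \<omega> \<in> {0}} +
      prob {\<omega>\<in>space M. X s \<omega> \<in> - {0} \<and> X (s + t) \<omega> - X s \<omega> \<in> - {0}}"
    by (intro measure_Un_le) measurable
  also have "\<dots> = prob_zero s * prob_zero t + (1 - prob_zero s) * (1 - prob_zero t)"
    by (subst (1 2) indep_increment_pair[OF assms]) (auto simp: neg)
  finally show ?thesis by (simp add: algebra_simps)
qed

text \<open>
  Two disjoint ways of being far from 0 at time s + t: already far at time s and no move, or at 0 at time
  s and a far move.
\<close>

lemma prob_large_step:
  assumes "0 < s" "0 < t" "0 \<le> \<kappa>"
  shows "prob_large \<kappa> s * prob_zero t + prob_zero s * prob_large \<kappa> t \<le> prob_large \<kappa> (s + t)"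
proof -
  have [measurable]: "X s \<in> borel_measurable M" "X t \<in> borel_measurable M" "X (s + t) \<in> borel_measurable M"
    using assms by auto
  let ?L = "{x::real. \<kappa> < \<bar>x\<bar>}"
  have L: "?L \<in> sets borel" by measurable
  have "prob_large \<kappa> s * prob_zero t + prob_zero s * prob_large \<kappa> t =
    prob {\<omega>\<in>space M. X s \<omega> \<in> ?L \<and> X (s + t) \<omega> - X s \<omega> \<in> {0}} +
    prob {\<omega>\<in>space M. X s \<omega> \<in> {0} \<and> X (s + t) \<omega> - X s \<omega> \<in> ?L}"
    using L by (subst (1 2) indep_increment_pair[OF assms(1,2)]) auto
  also have "\<dots> = prob ({\<omega>\<in>space M. X s \<omega> \<in> ?L \<and> X (s + t) \<omega> - X s \<omega> \<in> {0}} \<union>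
    {\<omega>\<in>space M. X s \<omega> \<in> {0} \<and> X (s + t) \<omega> - X s \<omega> \<in> ?L})"
    using L assms(3) by (intro finite_measure_Union[symmetric]) auto
  also have "\<dots> \<le> prob_large \<kappa> (s + t)" by (intro finite_measure_mono) auto
  finally show ?thesis .
qed

lemma char_grid_point:
  assumes h: "0 < h" shows "(\<integral>\<omega>. iexp (t * X (real m * h) \<omega>) \<partial>M) = char (increment_law h) t ^ m"
proof -
  have w: "(\<lambda>\<xi>. iexp (t * walk (\<lambda>x. x) m \<xi>)) \<in> borel_measurable seqs"
    by (rule measurable_compose[OF measurable_walk iexp_measurable]) simp
  have "(\<integral>\<omega>. iexp (t * X (real m * h) \<omega>) \<partial>M) = (\<integral>\<omega>. iexp (t * walk (\<lambda>x. x) m (increments h \<omega>)) \<partial>M)"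
  proof (rule integral_cong_AE)
    show "AE \<omega> in M. iexp (t * X (real m * h) \<omega>) = iexp (t * walk (\<lambda>x. x) m (increments h \<omega>))"
      using start_zero by eventually_elim (simp add: walk_id_eq sum_increments)
    show "(\<lambda>\<omega>. iexp (t * X (real m * h) \<omega>)) \<in> borel_measurable M"
      using h by (intro measurable_compose[OF _ iexp_measurable] X_measurable) auto
    show "(\<lambda>\<omega>. iexp (t * walk (\<lambda>x. x) m (increments h \<omega>))) \<in> borel_measurable M"
      by (rule measurable_compose[OF increments_measurable[OF h] w])
  qed
  also have "\<dots> = (\<integral>\<xi>. iexp (t * walk (\<lambda>x. x) m \<xi>) \<partial>distr M seqs (increments h))"
    by (rule integral_distr[OF increments_measurable[OF h] w, symmetric])
  also have "\<dots> = char (increment_law h) t ^ m"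
    unfolding distr_increments[OF h] using h by (intro integral_iid_walk_id real_distribution_increment_law) simp
  finally show ?thesis .
qed

text \<open>
  The bounds on the probability of 0 force the skeletons to make a bounded expected number of moves
  up to time 1 / 2^n0, and then the normalised step laws are tight.  A limit point of them is the jump law.
\<close>

theorem compound_poisson_if_stays_at_zero:
  assumes stay: "\<And>s. 0 < s \<Longrightarrow> s \<le> 1 / 2 ^ n0 \<Longrightarrow> 3 / 4 \<le> prob_zero s"
  shows "compound_poisson_process M X"
proof -
  define L where "L = (2::real) ^ n0"
  define h where "h n = 1 / (2::real) ^ (n + n0)" for n
  have h0: "0 < h n" for n by (simp add: h_def)
  have Lh: "L * h n = 1 / 2 ^ n" for n by (simp add: L_def h_def power_add)
  have hle: "real k * h n \<le> 1 / 2 ^ n0" if "k \<le> 2 ^ n" for k n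
  proof -
    have "real k \<le> 2 ^ n" using that by (metis of_nat_le_iff of_nat_numeral of_nat_power)
    then have "real k * h n \<le> 2 ^ n * h n" using h0[of n] by (intro mult_right_mono) auto
    then show ?thesis by (simp add: h_def power_add)
  qed
  have pzk: "3 / 4 \<le> prob_zero (real k * h n)" if "0 < k" "k \<le> 2 ^ n" for k n
    using that h0[of n] hle[OF that(2)] by (intro stay) auto
  (* As 2 prob_zero - 1 is at least 1/2, each further step lowers prob_zero by at least half the
     probability of a move; as prob_zero never falls below 3/4, there is little room for moves. *)
  have e: "real k * (1 - prob_zero (h n)) / 2 \<le> 1 - prob_zero (real k * h n)" if "0 < k" "k \<le> 2 ^ n" for k n
    using that
  proof (induction k rule: nat_induct_non_zero)
    case 1
    have "prob_zero (h n) \<le> 1" by (rule prob_le_1)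
    then show ?case by simp
  next
    case (Suc k)
    have "prob_zero (real (Suc k) * h n) \<le> prob_zero (real k * h n) - (1 - prob_zero (h n)) * (2 * prob_zero (real k * h n) - 1)"
      using prob_zero_step[of "real k * h n" "h n"] h0[of n] Suc by (simp add: algebra_simps)
    also have "\<dots> \<le> prob_zero (real k * h n) - (1 - prob_zero (h n)) * (1 / 2)"
      using pzk[of k n] Suc by (intro diff_left_mono mult_left_mono) auto
    finally show ?case using Suc by (simp add: field_simps)
  qed
  have eN: "2 ^ n * (1 - prob_zero (h n)) \<le> 1 / 2" for n
    using e[of "2 ^ n" n] pzk[of "2 ^ n" n] by simp
  (* A single far move among k steps makes the sum far.  The factor 3/4 is a lower bound for the
     probability of being at 0 before it, and 3/8 leaves room for a move after it. *)
  have b: "3 / 8 * real k * prob_large \<kappa> (h n) \<le> prob_large \<kappa> (real k * h n)" if "0 < k" "k \<le> 2 ^ n" "0 \<le> \<kappa>" for k n \<kappa>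
    using that
  proof (induction k rule: nat_induct_non_zero)
    case 1
    have "0 \<le> prob_large \<kappa> (h n)" by simp
    then show ?case by simp
  next
    case (Suc k)
    let ?d = "prob_large \<kappa> (h n)" and ?e = "1 - prob_zero (h n)"
    have e0: "0 \<le> ?e" by simp
    have "real k \<le> 2 ^ n" using Suc.prems by (metis Suc_leD of_nat_le_iff of_nat_numeral of_nat_power)
    then have ke: "real k * ?e \<le> 1 / 2" using eN[of n] mult_right_mono[OF _ e0, of "real k" "2 ^ n"] by linarith
    have "3 / 8 * real (Suc k) * ?d \<le> 3 / 8 * real k * ?d * prob_zero (h n) + 3 / 4 * ?d"
    proof -
      have 1: "3 / 8 * ?d * (real k * ?e) \<le> 3 / 8 * ?d * (1 / 2)" by (intro mult_left_mono ke) auto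
      have 2: "0 \<le> ?d" by simp
      have 3: "3 / 8 * real (Suc k) * ?d = 3 / 8 * real k * ?d * prob_zero (h n) + 3 / 8 * ?d * (real k * ?e) + 3 / 8 * ?d"
        by (simp add: field_simps)
      show ?thesis using 1 2 unfolding 3 by linarith
    qed
    also have "\<dots> \<le> prob_large \<kappa> (real k * h n) * prob_zero (h n) + prob_zero (real k * h n) * ?d"
      using Suc pzk[of k n] by (intro add_mono mult_right_mono) auto
    also have "\<dots> \<le> prob_large \<kappa> (real (Suc k) * h n)"
      using prob_large_step[of "real k * h n" "h n" \<kappa>] h0[of n] Suc by (simp add: algebra_simps)
    finally show ?case .
  qed
  have bN: "3 / 8 * 2 ^ n * prob_large \<kappa> (h n) \<le> prob_large \<kappa> (1 / 2 ^ n0)" if "0 \<le> \<kappa>" for n \<kappa>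
    using b[of "2 ^ n" n \<kappa>] that by (simp add: h_def power_add)
  have rdh: "real_distribution (increment_law (h n))" for n using h0[of n] by (intro real_distribution_increment_law) simp
  have slaw0: "measure (increment_law (h n)) {0} = prob_zero (h n)" for n
    unfolding increment_law_def using h0[of n] by (subst measure_distr) (auto intro!: arg_cong[where f=prob])
  have "\<exists>\<rho>. real_distribution \<rho> \<and>
    (\<forall>(g :: real \<Rightarrow> real) B. g \<in> borel_measurable borel \<longrightarrow> (\<forall>x. \<bar>g x\<bar> \<le> B) \<longrightarrow>
       integral\<^sup>L (increment_law (h n)) g = (1 - L * h n) * g 0 + L * h n * integral\<^sup>L \<rho> g) \<and>
    (\<forall>t. char (increment_law (h n)) t = complex_of_real (1 - L * h n) + complex_of_real (L * h n) * char \<rho> t)" for n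
  proof (rule remove_atom_at_zero[OF rdh, of "L * h n" n])
    show "0 < L * h n" unfolding Lh by simp
    show "0 < measure (increment_law (h n)) {0}" using pzk[of 1 n] unfolding slaw0 by simp
    show "1 - L * h n \<le> measure (increment_law (h n)) {0}" using eN[of n] unfolding slaw0 Lh by (simp add: field_simps)
  qed blast
  then obtain \<rho> where rd: "\<And>n. real_distribution (\<rho> n)"
    and int: "\<And>n (g :: real \<Rightarrow> real) B. g \<in> borel_measurable borel \<Longrightarrow> (\<And>x. \<bar>g x\<bar> \<le> B) \<Longrightarrow>
       integral\<^sup>L (increment_law (h n)) g = (1 - L * h n) * g 0 + L * h n * integral\<^sup>L (\<rho> n) g"
    and ch: "\<And>n t. char (increment_law (h n)) t = complex_of_real (1 - L * h n) + complex_of_real (L * h n) * char (\<rho> n) t"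
    by metis
  have tail: "3 / 8 * measure (\<rho> n) {x. \<kappa> < \<bar>x\<bar>} \<le> prob_large \<kappa> (1 / 2 ^ n0)" if "0 \<le> \<kappa>" for n \<kappa>
  proof -
    interpret R: real_distribution "\<rho> n" by (rule rd)
    interpret R2: real_distribution "increment_law (h n)" by (rule rdh)
    have L: "{x::real. \<kappa> < \<bar>x\<bar>} \<in> sets borel" by measurable
    have "measure (increment_law (h n)) {x. \<kappa> < \<bar>x\<bar>} = L * h n * measure (\<rho> n) {x. \<kappa> < \<bar>x\<bar>}"
      using int[of "indicator {x. \<kappa> < \<bar>x\<bar>}" 1 n] L that by (simp add: indicator_def[of _ "0::real"])
    moreover have "measure (increment_law (h n)) {x. \<kappa> < \<bar>x\<bar>} = prob_large \<kappa> (h n)"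
      unfolding increment_law_def using h0[of n] L by (subst measure_distr) (auto intro!: arg_cong[where f=prob])
    ultimately show ?thesis using bN[OF that, of n] by (simp add: Lh)
  qed
  have "tight \<rho>"
    unfolding tight_def
  proof (intro conjI allI impI rd)
    fix \<epsilon> :: real assume \<epsilon>: "0 < \<epsilon>"
    let ?D = "distr M borel (X (1 / 2 ^ n0))"
    have X1: "X (1 / 2 ^ n0) \<in> borel_measurable M" by simp
    have "(\<lambda>\<kappa>. prob {\<omega>\<in>space M. real \<kappa> < \<bar>X (1 / 2 ^ n0) \<omega>\<bar>}) \<longlonglongrightarrow> prob (\<Inter>\<kappa>. {\<omega>\<in>space M. real \<kappa> < \<bar>X (1 / 2 ^ n0) \<omega>\<bar>})"
      using X1 by (intro finite_Lim_measure_decseq) (auto simp: decseq_def)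
    moreover have "(\<Inter>\<kappa>. {\<omega>\<in>space M. real \<kappa> < \<bar>X (1 / 2 ^ n0) \<omega>\<bar>}) = {}"
    proof safe
      fix \<omega> assume *: "\<omega> \<in> (\<Inter>\<kappa>. {\<omega>\<in>space M. real \<kappa> < \<bar>X (1 / 2 ^ n0) \<omega>\<bar>})"
      obtain k where "\<bar>X (1 / 2 ^ n0) \<omega>\<bar> < real k" using reals_Archimedean2 by blast
      with * show "\<omega> \<in> {}" by (auto dest!: spec[of _ k])
    qed
    ultimately have "(\<lambda>\<kappa>. prob_large (real \<kappa>) (1 / 2 ^ n0)) \<longlonglongrightarrow> 0" by simp
    then have "eventually (\<lambda>\<kappa>. prob_large (real \<kappa>) (1 / 2 ^ n0) < 3 / 8 * \<epsilon>) sequentially"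
      using \<epsilon> by (intro order_tendstoD) auto
    then obtain \<kappa> where \<kappa>: "prob_large (real \<kappa>) (1 / 2 ^ n0) < 3 / 8 * \<epsilon>" by (auto simp: eventually_sequentially)
    show "\<exists>a b. a < b \<and> (\<forall>n. 1 - \<epsilon> < measure (\<rho> n) {a<..b})"
    proof (intro exI conjI allI)
      show "- real \<kappa> - 1 < real \<kappa>" by simp
      fix n
      interpret R: real_distribution "\<rho> n" by (rule rd)
      have "measure (\<rho> n) {x. real \<kappa> < \<bar>x\<bar>} < \<epsilon>" using tail[of "real \<kappa>" n] \<kappa> by simp
      moreover have "1 - measure (\<rho> n) {x. real \<kappa> < \<bar>x\<bar>} = measure (\<rho> n) (space (\<rho> n) - {x. real \<kappa> < \<bar>x\<bar>})"
        by (subst R.prob_compl) auto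
      moreover have "\<dots> \<le> measure (\<rho> n) {- real \<kappa> - 1<..real \<kappa>}"
        by (intro R.finite_measure_mono) auto
      ultimately show "1 - \<epsilon> < measure (\<rho> n) {- real \<kappa> - 1<..real \<kappa>}" by simp
    qed
  qed
  then obtain s m where s: "strict_mono s" and m: "real_distribution m"
    and lim: "\<And>t. (\<lambda>n. char (\<rho> (s n)) t) \<longlonglongrightarrow> char m t"
    using tight_char_limit_point[of \<rho>] by blast
  have "distr M borel (X t) = compound_poisson_distr (L * t) m" if t: "0 < t" for t
  proof (rule Levy_uniqueness)
    show "real_distribution (distr M borel (X t))" using t by (intro real_distribution_distr) auto
    show "real_distribution (compound_poisson_distr (L * t) m)" by (rule real_distribution_compound_poisson[OF m])
    show "char (distr M borel (X t)) = char (compound_poisson_distr (L * t) m)"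
    proof
      fix u
      have sn: "filterlim (\<lambda>n. s n + n0) at_top sequentially"
        by (intro filterlim_at_top_mono[OF filterlim_subseq[OF s]]) auto
      let ?k = "\<lambda>n. nat \<lceil>t * 2 ^ (s n + n0)\<rceil>"
      have kh: "real (?k n) * h (s n) = grid_up (s n + n0) t" for n
        by (simp add: grid_up_def h_def)
      have g: "(\<lambda>n. grid_up (s n + n0) t) \<longlonglongrightarrow> t"
        using filterlim_compose[OF grid_up_tendsto[of t] sn] t by simp
      have hl: "(\<lambda>n. h (s n)) \<longlonglongrightarrow> 0"
      proof -
        have "(\<lambda>n. 1 / (2::real) ^ n) \<longlonglongrightarrow> 0" using LIMSEQ_realpow_zero[of "1/2"] by (simp add: power_one_over)
        from filterlim_compose[OF this sn] show ?thesis by (simp add: h_def)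
      qed
      have "(\<lambda>n. (complex_of_real (1 - L * h (s n)) + complex_of_real (L * h (s n)) * char (\<rho> (s n)) u) ^ ?k n)
          \<longlonglongrightarrow> exp (complex_of_real (L * t) * (char m u - 1))"
      proof (rule compound_poisson_char_limit)
        show "0 < L" by (simp add: L_def)
        show "norm (char (\<rho> (s n)) u) \<le> 1" for n by (rule real_distribution.cmod_char_le_1[OF rd])
        show "(\<lambda>n. real (?k n) * h (s n)) \<longlonglongrightarrow> t" unfolding kh by (rule g)
        show "0 \<le> h (s n)" for n using h0[of "s n"] by simp
        show "L * h (s n) \<le> 1" for n unfolding Lh by simp
      qed (rule lim hl)+
      then have "(\<lambda>n. \<integral>\<omega>. iexp (u * X (grid_up (s n + n0) t) \<omega>) \<partial>M) \<longlonglongrightarrow> exp (complex_of_real (L * t) * (char m u - 1))"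
        unfolding ch[symmetric] char_grid_point[OF h0, symmetric] kh .
      moreover have "(\<lambda>n. \<integral>\<omega>. iexp (u * X (grid_up (s n + n0) t) \<omega>) \<partial>M) \<longlonglongrightarrow> (\<integral>\<omega>. iexp (u * X t \<omega>) \<partial>M)"
      proof (rule integral_dominated_convergence[where w="\<lambda>_. 1"])
        show "(\<lambda>\<omega>. iexp (u * X t \<omega>)) \<in> borel_measurable M"
          using t by (intro measurable_compose[OF _ iexp_measurable] X_measurable) auto
        show "(\<lambda>\<omega>. iexp (u * X (grid_up (s n + n0) t) \<omega>)) \<in> borel_measurable M" for n
          using t grid_up_bounds(1)[of t "s n + n0"] by (intro measurable_compose[OF _ iexp_measurable] X_measurable) auto
        show "AE \<omega> in M. (\<lambda>n. iexp (u * X (grid_up (s n + n0) t) \<omega>)) \<longlonglongrightarrow> iexp (u * X t \<omega>)"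
        proof (rule AE_I2)
          fix \<omega> assume "\<omega> \<in> space M"
          then have "(\<lambda>n. X (grid_up n t) \<omega>) \<longlonglongrightarrow> X t \<omega>"
            using cadlag_grid_tendsto[of t "\<lambda>s. X s \<omega>"] right_continuous t by simp
          from filterlim_compose[OF this sn]
          show "(\<lambda>n. iexp (u * X (grid_up (s n + n0) t) \<omega>)) \<longlonglongrightarrow> iexp (u * X t \<omega>)" by (intro tendsto_intros)
        qed
      qed auto
      ultimately have "(\<integral>\<omega>. iexp (u * X t \<omega>) \<partial>M) = exp (complex_of_real (L * t) * (char m u - 1))"
        by (rule LIMSEQ_unique[symmetric])
      moreover have "char (distr M borel (X t)) u = (\<integral>\<omega>. iexp (u * X t \<omega>) \<partial>M)"
        unfolding char_def using t by (subst integral_distr) auto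
      ultimately show "char (distr M borel (X t)) u = char (compound_poisson_distr (L * t) m) u"
        using t by (subst real_distribution_compound_poisson(2)[OF m]) (auto simp: L_def)
    qed
  qed
  moreover have "prob_space m" "sets m = sets borel" using m by (auto simp: real_distribution_def real_distribution_axioms_def)
  moreover have "0 < L" by (simp add: L_def)
  ultimately show ?thesis
    unfolding compound_poisson_process_def using levy_process_axioms by blast
qed

end

section \<open>Atoms occur for compound Poisson processes only\<close>

text \<open>
  Continuous functions that decrease to the indicator of {c}.
\<close>

definition bump :: "real \<Rightarrow> nat \<Rightarrow> real \<Rightarrow> real" where
  "bump c k x = max 0 (1 - real k * \<bar>x - c\<bar>)"

lemma bump_bounds: "indicator {c} x \<le> bump c k x" "0 \<le> bump c k x" "bump c k x \<le> 1"
  by (auto simp: bump_def indicator_def)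

lemma bump_self [simp]: "bump c k c = 1" by (simp add: bump_def)

lemma bump_continuous [continuous_intros]: "continuous_on A (bump c k)"
  unfolding bump_def by (intro continuous_intros)

lemma bump_measurable [measurable]: "bump c k \<in> borel_measurable borel"
  by (intro borel_measurable_continuous_onI continuous_intros)

lemma bump_tendsto_at: "isCont (bump c k) x"
  using bump_continuous[of UNIV c k] by (simp add: continuous_on_eq_continuous_at)

lemma bump_tendsto: "(\<lambda>k. bump c k x) \<longlonglongrightarrow> indicator {c} x"
proof (cases "x = c")
  case False
  then obtain N where N: "1 / \<bar>x - c\<bar> < real N" using reals_Archimedean2 by blast
  have "bump c k x = 0" if "N \<le> k" for k
  proof -
    have "1 < real N * \<bar>x - c\<bar>" using N False by (simp add: field_simps)
    also have "\<dots> \<le> real k * \<bar>x - c\<bar>" using that by (intro mult_right_mono) auto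
    finally show ?thesis by (simp add: bump_def)
  qed
  then have "eventually (\<lambda>k. bump c k x = 0) sequentially" by (auto simp: eventually_sequentially)
  then show ?thesis using False by (auto intro: tendsto_eventually)
qed (simp add: bump_def)

context levy_process begin

text \<open>
  Negative times are mapped to 0, since X carries no information there.
\<close>

lemma measurable_X_pair: "(\<lambda>p. X (max 0 (fst p :: real)) (snd p)) \<in> borel_measurable (borel \<Otimes>\<^sub>M M)"
proof (rule borel_measurable_LIMSEQ_real)
  fix p :: "real \<times> 'a" assume "p \<in> space (borel \<Otimes>\<^sub>M M)"
  then show "(\<lambda>n. X (grid_up n (max 0 (fst p))) (snd p)) \<longlonglongrightarrow> X (max 0 (fst p)) (snd p)"
    using cadlag_grid_tendsto[of "max 0 (fst p)" "\<lambda>s. X s (snd p)"] right_continuous[of "snd p"]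
    by (auto simp: space_pair_measure)
next
  fix n
  have "(\<lambda>p. X (real (nat \<lceil>max 0 (fst p :: real) * 2 ^ n\<rceil>) * (1 / 2 ^ n)) (snd p)) \<in> borel_measurable (borel \<Otimes>\<^sub>M M)"
  proof (rule measurable_compose_countable[of "\<lambda>k p. X (real k * (1 / 2 ^ n)) (snd p)"])
    show "(\<lambda>p. X (real k * (1 / 2 ^ n)) (snd p)) \<in> borel_measurable (borel \<Otimes>\<^sub>M M)" for k
      by (rule measurable_compose[OF measurable_snd X_measurable]) simp
  qed measurable
  then show "(\<lambda>p. X (grid_up n (max 0 (fst p :: real))) (snd p)) \<in> borel_measurable (borel \<Otimes>\<^sub>M M)"
    by (simp add: grid_up_def)
qed

lemma X_pair_measurable':
  assumes "f \<in> borel_measurable N" "g \<in> N \<rightarrow>\<^sub>M M"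
  shows "(\<lambda>p. X (max 0 (f p)) (g p)) \<in> borel_measurable N"
  using measurable_compose[OF measurable_Pair[OF assms] measurable_X_pair] by simp

text \<open>
  Weight times by a standard exponential density, and let U be the weighted time spent at c.  The
  weighted time of visits to c at both s and s + t is U P(X_t = 0) by independence of increments, and it
  tends to U as t tends to 0, as translation is continuous in L1.  Hence P(X_t = 0) tends to 1.  Continuity
  of translation is made explicit by the bump functions, along which right continuity can be used.
\<close>

theorem compound_poisson_if_atom:
  assumes atom: "\<not> (AE s in lborel. 0 \<le> s \<longrightarrow> prob {\<omega>\<in>space M. X s \<omega> = c} = 0)"
  shows "compound_poisson_process M X"
proof -
  define E1 where "E1 = density lborel (exponential_density 1)"
  interpret E: prob_space E1 unfolding E1_def by (rule prob_space_exponential_density) simp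
  interpret Q: pair_prob_space E1 M ..
  define Z where "Z t p = X (max 0 (fst p + t)) (snd p)" for t :: real and p :: "real \<times> 'a"
  have [measurable_cong]: "sets E1 = sets borel" by (simp add: E1_def)
  have Zm [measurable]: "Z t \<in> borel_measurable (E1 \<Otimes>\<^sub>M M)" for t
    unfolding Z_def by (rule X_pair_measurable') measurable
  have AE_E1: "AE s in E1. P s" if "AE s in lborel. 0 < s \<longrightarrow> P s" for P
  proof -
    have "AE s in lborel. s \<noteq> (0::real)" by (rule AE_lborel_singleton)
    with that have "AE s in lborel. 0 < ennreal (exponential_density 1 s) \<longrightarrow> P s"
      by eventually_elim (auto simp: exponential_density_def)
    then show ?thesis unfolding E1_def by (subst AE_density) auto
  qed
  have pos: "AE s in E1. 0 < s" by (rule AE_E1) simp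
  define U where "U = (\<integral>p. (indicator {c} (Z 0 p) :: real) \<partial>(E1 \<Otimes>\<^sub>M M))"
  have bint: "integrable (E1 \<Otimes>\<^sub>M M) f" if "f \<in> borel_measurable (E1 \<Otimes>\<^sub>M M)" "\<And>p. \<bar>f p\<bar> \<le> 1" for f :: "real \<times> 'a \<Rightarrow> real"
    using that by (intro Q.integrable_const_bound[where B=1]) auto
  have b1: "\<bar>bump c k x\<bar> \<le> 1" "\<bar>indicator {c} x\<bar> \<le> (1::real)" "\<bar>bump c k x - indicator {c} x\<bar> \<le> 1"
     "\<bar>indicator {c} x * indicator {c} x'\<bar> \<le> (1::real)"
     "\<bar>indicator {c} x * (1 - bump c k x')\<bar> \<le> (1::real)" for k x x'
    using bump_bounds[where c=c and k=k and x=x] bump_bounds[where c=c and k=k and x=x'] by (auto simp: indicator_def)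
  have prob_ind: "(\<integral>\<omega>. indicator {c} (Z t (s, \<omega>)) \<partial>M) = prob {\<omega>\<in>space M. X (max 0 (s + t)) \<omega> = c}" for s t
  proof -
    have "(\<integral>\<omega>. indicator {c} (Z t (s, \<omega>)) \<partial>M) = (\<integral>\<omega>. (indicator {\<omega>\<in>space M. X (max 0 (s + t)) \<omega> = c} \<omega> :: real) \<partial>M)"
      by (intro Bochner_Integration.integral_cong) (auto simp: Z_def indicator_def)
    then show ?thesis by simp
  qed
  have U: "0 < U"
  proof (rule ccontr)
    assume "\<not> 0 < U"
    moreover have "0 \<le> U" unfolding U_def by (intro Bochner_Integration.integral_nonneg) simp
    ultimately have "U = 0" by simp
    have Ueq: "U = (\<integral>s. prob {\<omega>\<in>space M. X (max 0 s) \<omega> = c} \<partial>E1)"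
      unfolding U_def using prob_ind[of 0]
      by (subst Q.integral_fst'[symmetric]) (auto intro!: bint simp: b1)
    have m: "(\<lambda>s. prob {\<omega>\<in>space M. X (max 0 s) \<omega> = c}) \<in> borel_measurable E1"
    proof -
      have "(\<lambda>p. indicator {c} (Z 0 p) :: real) \<in> borel_measurable (E1 \<Otimes>\<^sub>M M)" by measurable
      then have "(\<lambda>s. \<integral>\<omega>. (indicator {c} (Z 0 (s, \<omega>)) :: real) \<partial>M) \<in> borel_measurable E1"
        using borel_measurable_lebesgue_integral[of "\<lambda>s \<omega>. indicator {c} (Z 0 (s, \<omega>))" E1] by (simp add: case_prod_beta)
      then show ?thesis unfolding prob_ind by simp
    qed
    have "AE s in E1. prob {\<omega>\<in>space M. X (max 0 s) \<omega> = c} = 0"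
    proof (subst integral_nonneg_eq_0_iff_AE[symmetric])
      show "integrable E1 (\<lambda>s. prob {\<omega>\<in>space M. X (max 0 s) \<omega> = c})"
        using m by (intro E.integrable_const_bound[where B=1]) auto
    qed (use \<open>U = 0\<close> Ueq in auto)
    then have "AE s in lborel. 0 < ennreal (exponential_density 1 s) \<longrightarrow> prob {\<omega>\<in>space M. X (max 0 s) \<omega> = c} = 0"
      unfolding E1_def by (subst (asm) AE_density) auto
    then have "AE s in lborel. 0 \<le> s \<longrightarrow> prob {\<omega>\<in>space M. X s \<omega> = c} = 0"
      by eventually_elim (auto simp: exponential_density_def)
    then show False using atom by simp
  qed
  have both: "(\<integral>p. (indicator {c} (Z 0 p) * indicator {c} (Z t p) :: real) \<partial>(E1 \<Otimes>\<^sub>M M)) = U * prob_zero t" if t: "0 < t" for t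
  proof -
    have m: "(\<lambda>p. indicator {c} (Z 0 p) * indicator {c} (Z t p) :: real) \<in> borel_measurable (E1 \<Otimes>\<^sub>M M)" by measurable
    have "(\<integral>p. (indicator {c} (Z 0 p) * indicator {c} (Z t p) :: real) \<partial>(E1 \<Otimes>\<^sub>M M)) =
      (\<integral>s. \<integral>\<omega>. (indicator {c} (Z 0 (s, \<omega>)) * indicator {c} (Z t (s, \<omega>)) :: real) \<partial>M \<partial>E1)"
      by (rule Q.integral_fst'[symmetric, OF bint[OF m b1(4)]])
    also have "\<dots> = (\<integral>s. (\<integral>\<omega>. indicator {c} (Z 0 (s, \<omega>)) \<partial>M) * prob_zero t \<partial>E1)"
    proof (rule integral_cong_AE)
      show "AE s in E1. (\<integral>\<omega>. (indicator {c} (Z 0 (s, \<omega>)) * indicator {c} (Z t (s, \<omega>)) :: real) \<partial>M) = (\<integral>\<omega>. indicator {c} (Z 0 (s, \<omega>)) \<partial>M) * prob_zero t"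
        using pos
      proof eventually_elim
        case (elim s)
        have "(\<integral>\<omega>. (indicator {c} (Z 0 (s, \<omega>)) * indicator {c} (Z t (s, \<omega>)) :: real) \<partial>M) =
           (\<integral>\<omega>. indicator {\<omega>\<in>space M. X s \<omega> \<in> {c} \<and> X (s + t) \<omega> - X s \<omega> \<in> {0}} \<omega> \<partial>M)"
          using elim t by (intro Bochner_Integration.integral_cong) (auto simp: Z_def indicator_def)
        also have "\<dots> = prob {\<omega>\<in>space M. X s \<omega> \<in> {c} \<and> X (s + t) \<omega> - X s \<omega> \<in> {0}}"
          by (simp, rule arg_cong[where f=prob]) auto
        also have "\<dots> = prob {\<omega>\<in>space M. X s \<omega> \<in> {c}} * prob_zero t"
          by (subst indep_increment_pair[OF elim t]) auto
        finally show ?case using prob_ind[of 0 s] elim by simp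
      qed
    qed measurable
    also have "\<dots> = (\<integral>s. \<integral>\<omega>. indicator {c} (Z 0 (s, \<omega>)) \<partial>M \<partial>E1) * prob_zero t" by simp
    also have "(\<integral>s. \<integral>\<omega>. indicator {c} (Z 0 (s, \<omega>)) \<partial>M \<partial>E1) = U"
      unfolding U_def by (subst Q.integral_fst'[symmetric]) (auto intro!: bint simp: b1)
    finally show ?thesis .
  qed
  (* Shifting time by t changes the exponential weight by a factor of at most exp t. *)
  have shift: "(\<integral>p. g (Z t p) \<partial>(E1 \<Otimes>\<^sub>M M)) \<le> exp t * (\<integral>p. g (Z 0 p) \<partial>(E1 \<Otimes>\<^sub>M M))"
    if t: "0 \<le> t" and g [measurable]: "g \<in> borel_measurable borel" and g0: "\<And>x. 0 \<le> g x" and g1: "\<And>x. \<bar>g x\<bar> \<le> 1" for t and g :: "real \<Rightarrow> real"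
  proof -
    define G where "G s = (\<integral>\<^sup>+\<omega>. ennreal (g (X (max 0 s) \<omega>)) \<partial>M)" for s
    have [measurable]: "(\<lambda>p. X (max 0 (fst p)) (snd p)) \<in> borel_measurable (borel \<Otimes>\<^sub>M M)" by (rule measurable_X_pair)
    have G [measurable]: "G \<in> borel_measurable borel"
    proof -
      have "(\<lambda>p. ennreal (g (X (max 0 (fst p)) (snd p)))) \<in> borel_measurable (borel \<Otimes>\<^sub>M M)" by measurable
      from borel_measurable_nn_integral_fst[OF this] show ?thesis unfolding G_def by simp
    qed
    have eq: "ennreal (\<integral>p. g (Z u p) \<partial>(E1 \<Otimes>\<^sub>M M)) = (\<integral>\<^sup>+s. ennreal (exponential_density 1 s) * G (s + u) \<partial>lborel)" for u
    proof -
      have "ennreal (\<integral>p. g (Z u p) \<partial>(E1 \<Otimes>\<^sub>M M)) = (\<integral>\<^sup>+p. ennreal (g (Z u p)) \<partial>(E1 \<Otimes>\<^sub>M M))"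
        by (rule nn_integral_eq_integral[symmetric]) (auto intro!: bint simp: g0 g1 abs_le_D1[OF g1])
      also have "\<dots> = (\<integral>\<^sup>+s. \<integral>\<^sup>+\<omega>. ennreal (g (Z u (s, \<omega>))) \<partial>M \<partial>E1)"
        by (rule nn_integral_fst[symmetric]) measurable
      also have "\<dots> = (\<integral>\<^sup>+s. G (s + u) \<partial>E1)" by (simp add: G_def Z_def)
      also have "\<dots> = (\<integral>\<^sup>+s. ennreal (exponential_density 1 s) * G (s + u) \<partial>lborel)"
        unfolding E1_def by (subst nn_integral_density) auto
      finally show ?thesis .
    qed
    have "ennreal (\<integral>p. g (Z t p) \<partial>(E1 \<Otimes>\<^sub>M M)) = (\<integral>\<^sup>+s. ennreal (exponential_density 1 s) * G (s + t) \<partial>lborel)" by (rule eq)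
    also have "\<dots> = (\<integral>\<^sup>+s. ennreal (exponential_density 1 (s - t)) * G s \<partial>lborel)"
      by (subst nn_integral_real_affine[where c=1 and t="-t"]) (auto simp: add.commute)
    also have "\<dots> \<le> (\<integral>\<^sup>+s. ennreal (exp t) * (ennreal (exponential_density 1 s) * G s) \<partial>lborel)"
    proof (rule nn_integral_mono)
      fix s
      have "exponential_density 1 (s - t) \<le> exp t * exponential_density 1 s"
        using t by (auto simp: exponential_density_def exp_add[symmetric])
      then have "ennreal (exponential_density 1 (s - t)) \<le> ennreal (exp t) * ennreal (exponential_density 1 s)"
        by (subst ennreal_mult[symmetric]) (auto simp: exponential_density_def intro!: ennreal_leI)
      then show "ennreal (exponential_density 1 (s - t)) * G s \<le> ennreal (exp t) * (ennreal (exponential_density 1 s) * G s)"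
        by (metis mult.assoc mult_right_mono zero_le)
    qed
    also have "\<dots> = ennreal (exp t) * ennreal (\<integral>p. g (Z 0 p) \<partial>(E1 \<Otimes>\<^sub>M M))"
      by (subst nn_integral_cmult) (auto simp: eq)
    also have "\<dots> = ennreal (exp t * (\<integral>p. g (Z 0 p) \<partial>(E1 \<Otimes>\<^sub>M M)))"
      by (rule ennreal_mult[symmetric]) (auto simp: g0)
    finally show ?thesis
      by (subst (asm) ennreal_le_iff) (auto simp: g0)
  qed
  define \<delta> where "\<delta> k = (\<integral>p. bump c k (Z 0 p) - indicator {c} (Z 0 p) \<partial>(E1 \<Otimes>\<^sub>M M))" for k
  have \<delta>: "\<delta> \<longlonglongrightarrow> 0"
  proof -
    have "\<delta> \<longlonglongrightarrow> (\<integral>p. indicator {c} (Z 0 p) - indicator {c} (Z 0 p) \<partial>(E1 \<Otimes>\<^sub>M M))"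
      unfolding \<delta>_def
    proof (rule integral_dominated_convergence[where w="\<lambda>_. 1"])
      show "AE p in E1 \<Otimes>\<^sub>M M. (\<lambda>k. bump c k (Z 0 p) - indicator {c} (Z 0 p)) \<longlonglongrightarrow> indicator {c} (Z 0 p) - indicator {c} (Z 0 p)"
        by (intro AE_I2 tendsto_diff bump_tendsto tendsto_const)
    qed (auto simp: b1)
    then show ?thesis by simp
  qed
  have "\<exists>n0. \<forall>s. 0 < s \<longrightarrow> s \<le> 1 / 2 ^ n0 \<longrightarrow> 3 / 4 \<le> prob_zero s"
  proof (rule ccontr)
    assume "\<not> ?thesis"
    then obtain t where t: "\<And>n. 0 < t n" "\<And>n. t n \<le> 1 / 2 ^ n" "\<And>n. prob_zero (t n) < 3 / 4"
      by (metis not_le)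
    have tl: "t \<longlonglongrightarrow> 0"
    proof (rule tendsto_sandwich[of "\<lambda>_. 0" _ _ "\<lambda>n. (1 / 2) ^ n"])
      show "(\<lambda>n. (1 / 2 :: real) ^ n) \<longlonglongrightarrow> 0" by (rule LIMSEQ_realpow_zero) auto
    qed (use t in \<open>auto simp: less_imp_le power_one_over\<close>)
    (* Since P(X_t = 0) < 3/4 along the sequence, at least a quarter of U must come from paths that leave c
       within time t; for small t these are seen by the bump. *)
    have "U / 4 \<le> \<delta> k" for k
    proof (rule LIMSEQ_le_const)
      let ?A = "\<lambda>n. \<integral>p. indicator {c} (Z 0 p) * (1 - bump c k (Z (t n) p)) \<partial>(E1 \<Otimes>\<^sub>M M)"
      have A: "?A \<longlonglongrightarrow> (\<integral>p. indicator {c} (Z 0 p) * (1 - bump c k (Z 0 p)) \<partial>(E1 \<Otimes>\<^sub>M M))"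
      proof (rule integral_dominated_convergence[where w="\<lambda>_. 1"])
        show "AE p in E1 \<Otimes>\<^sub>M M. (\<lambda>n. indicator {c} (Z 0 p) * (1 - bump c k (Z (t n) p))) \<longlonglongrightarrow> indicator {c} (Z 0 p) * (1 - bump c k (Z 0 p))"
        proof -
          have "AE p in E1 \<Otimes>\<^sub>M M. 0 < fst p" using pos by (subst Q.AE_pair_iff[symmetric]) auto
          then show ?thesis using AE_space
          proof eventually_elim
            case (elim p)
            have "(\<lambda>n. X (fst p + t n) (snd p)) \<longlonglongrightarrow> X (fst p) (snd p)"
            proof (rule right_continuous_sequentially[where x="\<lambda>s. X s (snd p)" and s="\<lambda>n. fst p + t n"])
              show "continuous (at_right (fst p)) (\<lambda>s. X s (snd p))"
                using elim by (intro right_continuous) (auto simp: space_pair_measure)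
              show "(\<lambda>n. fst p + t n) \<longlonglongrightarrow> fst p" using tendsto_add[OF tendsto_const tl] by simp
            qed (use t in \<open>simp add: less_imp_le\<close>)
            moreover have "Z (t n) p = X (fst p + t n) (snd p)" "Z 0 p = X (fst p) (snd p)" for n
              using elim t(1)[of n] by (auto simp: Z_def max_def)
            ultimately have "(\<lambda>n. Z (t n) p) \<longlonglongrightarrow> Z 0 p" by simp
            then show ?case
              by (intro tendsto_intros isCont_tendsto_compose[OF bump_tendsto_at])
          qed
        qed
      qed (auto simp: b1)
      moreover have "(\<integral>p. indicator {c} (Z 0 p) * (1 - bump c k (Z 0 p)) \<partial>(E1 \<Otimes>\<^sub>M M)) = 0"
      proof -
        have z: "indicator {c} x * (1 - bump c k x) = 0" for x by (auto simp: indicator_def)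
        show ?thesis unfolding z by simp
      qed
      ultimately have A0: "?A \<longlonglongrightarrow> 0" by simp
      have "(\<lambda>n. ?A n + exp (t n) * \<delta> k) \<longlonglongrightarrow> 0 + exp 0 * \<delta> k"
        by (intro tendsto_intros A0 tl)
      then show "(\<lambda>n. ?A n + exp (t n) * \<delta> k) \<longlonglongrightarrow> \<delta> k" by simp
      have "U / 4 \<le> ?A n + exp (t n) * \<delta> k" for n
      proof -
        have "U / 4 \<le> U - U * prob_zero (t n)"
          using mult_left_mono[OF less_imp_le[OF t(3)[of n]], of U] U by simp
        also have "\<dots> = (\<integral>p. indicator {c} (Z 0 p) - indicator {c} (Z 0 p) * indicator {c} (Z (t n) p) \<partial>(E1 \<Otimes>\<^sub>M M))"
          unfolding both[OF t(1), symmetric] unfolding U_def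
          by (rule Bochner_Integration.integral_diff[symmetric]; rule bint; (rule b1)?) measurable
        also have "\<dots> \<le> (\<integral>p. indicator {c} (Z 0 p) * (1 - bump c k (Z (t n) p)) + (bump c k (Z (t n) p) - indicator {c} (Z (t n) p)) \<partial>(E1 \<Otimes>\<^sub>M M))"
        proof (rule integral_mono)
          fix p
          show "indicator {c} (Z 0 p) - indicator {c} (Z 0 p) * indicator {c} (Z (t n) p)
              \<le> indicator {c} (Z 0 p) * (1 - bump c k (Z (t n) p)) + (bump c k (Z (t n) p) - indicator {c} (Z (t n) p))"
            using bump_bounds[where c=c and k=k and x="Z (t n) p"] by (auto simp: indicator_def)
        qed (intro Bochner_Integration.integrable_add Bochner_Integration.integrable_diff; rule bint; (rule b1)?; measurable)+
        also have "\<dots> = ?A n + (\<integral>p. bump c k (Z (t n) p) - indicator {c} (Z (t n) p) \<partial>(E1 \<Otimes>\<^sub>M M))"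
          by (rule Bochner_Integration.integral_add; rule bint; (rule b1)?; measurable)
        also have "(\<integral>p. bump c k (Z (t n) p) - indicator {c} (Z (t n) p) \<partial>(E1 \<Otimes>\<^sub>M M)) \<le> exp (t n) * \<delta> k"
          unfolding \<delta>_def
        proof (rule shift[of "t n" "\<lambda>x. bump c k x - indicator {c} x"])
          show "0 \<le> bump c k x - indicator {c} x" for x using bump_bounds(1)[of c x k] by simp
          show "\<bar>bump c k x - indicator {c} x\<bar> \<le> 1" for x by (rule b1)
        qed (use t(1)[of n] in auto)
        finally show ?thesis by simp
      qed
      then show "\<exists>N. \<forall>n\<ge>N. U / 4 \<le> ?A n + exp (t n) * \<delta> k" by blast
    qed
    then have "U / 4 \<le> 0" using \<delta> by (intro LIMSEQ_le_const[OF \<delta>]) auto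
    then show False using U by simp
  qed
  then show ?thesis using compound_poisson_if_stays_at_zero by blast
qed

end

definition atomless :: "real measure \<Rightarrow> bool" where
  "atomless m \<longleftrightarrow> (\<forall>x. measure m {x} = 0)"

lemma conv_op_indicator_singleton:
  assumes "real_distribution m"
  shows "conv_op m (indicator {a}) x = measure m {a - x}"
proof -
  interpret real_distribution m by fact
  have "conv_op m (indicator {a}) x = (\<integral>u. indicator {a - x} u \<partial>m)"
    unfolding conv_op_def by (intro Bochner_Integration.integral_cong) (auto simp: indicator_def)
  then show ?thesis by simp
qed

lemma atomless_conv_op: "real_distribution m \<Longrightarrow> atomless m \<longleftrightarrow> (\<forall>a x. conv_op m (indicator {a}) x = 0)"
  unfolding atomless_def by (simp add: conv_op_indicator_singleton) (metis diff_0_right)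

lemma atomless_convolution:
  assumes "real_distribution m" "real_distribution n" "atomless m"
  shows "atomless (convolution m n)" "atomless (convolution n m)"
proof -
  have b: "bdd_borel (indicator {a})" for a by (rule bdd_borel_indicator) simp
  have z: "conv_op m (indicator {a}) = (\<lambda>_. 0)" for a using assms(1,3) atomless_conv_op by auto
  show "atomless (convolution m n)" "atomless (convolution n m)"
    using conv_op_convolution[OF assms(1,2) b] conv_op_convolution[OF assms(2,1) b]
    by (auto simp: atomless_conv_op real_distribution_convolution assms z conv_op_def)
qed

text \<open>
  If both factors had an atom, then so would the convolution, at the sum of the two points.
\<close>

lemma atomless_factor:
  assumes "real_distribution m" "real_distribution n" "atomless (convolution m n)"
  shows "atomless m \<or> atomless n"
proof (rule ccontr)
  interpret m: real_distribution m by fact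
  interpret n: real_distribution n by fact
  interpret P: pair_prob_space m n ..
  assume "\<not> ?thesis"
  then obtain a b where a: "measure m {a} > 0" and b: "measure n {b} > 0"
    unfolding atomless_def by (auto simp: zero_less_measure_iff)
  have e: "emeasure (m \<Otimes>\<^sub>M n) ({a} \<times> {b}) = emeasure m {a} * emeasure n {b}"
    by (rule n.emeasure_pair_measure_Times) auto
  have "measure m {a} * measure n {b} = P.prob ({a} \<times> {b})"
    unfolding measure_def e enn2real_mult ..
  also have "\<dots> \<le> P.prob ((\<lambda>(x, y). x + y) -` {a + b} \<inter> space (m \<Otimes>\<^sub>M n))"
  proof (rule P.finite_measure_mono)
    have "(\<lambda>(x, y). x + y) \<in> borel_measurable (m \<Otimes>\<^sub>M n)" by (simp add: split_beta')
    then show "(\<lambda>(x, y). x + y) -` {a + b} \<inter> space (m \<Otimes>\<^sub>M n) \<in> P.events"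
      by (rule measurable_sets) simp
  qed (auto simp: space_pair_measure)
  also have "\<dots> = measure (convolution m n) {a + b}"
    unfolding convolution_def by (rule measure_distr[symmetric]) auto
  finally show False using assms(3) mult_pos_pos[OF a b] unfolding atomless_def by (metis not_le)
qed

context levy_clock begin

lemma T_law: "distr M borel T = density lborel (exponential_density r)"
  using distributed_distr_eq_density[OF T_distributed] by (simp cong: distr_cong)

text \<open>
  Evaluation at a random time is not a measurable functional of the trajectory in the product space, but
  evaluation at grid points is; the general case follows by right continuity.
\<close>

lemma expectation_end:
  fixes g :: "real \<Rightarrow> real"
  assumes g: "continuous_on UNIV g" "\<And>x. \<bar>g x\<bar> \<le> B"
  shows "(\<integral>\<omega>. g (X (T \<omega>) \<omega>) \<partial>M) = (\<integral>t. \<integral>\<omega>. g (X (max 0 t) \<omega>) \<partial>M \<partial>distr M borel T)"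
proof (rule LIMSEQ_unique)
  interpret D: prob_space "distr M borel T" by (rule prob_space_distr) simp
  interpret E: prob_space "distr M paths traj" by (rule prob_space_distr[OF traj_measurable])
  interpret P: pair_prob_space "distr M borel T" "distr M paths traj" ..
  have gm [measurable]: "g \<in> borel_measurable borel" using g(1) by (rule borel_measurable_continuous_onI)
  have gc: "isCont g x" for x using g(1) by (simp add: continuous_on_eq_continuous_at)
  have Xm: "X (grid_up n t) \<in> borel_measurable M" for n t by (rule X_measurable) (simp add: grid_up_def)
  let ?I = "\<lambda>n. \<integral>\<omega>. g (X (grid_up n (T \<omega>)) \<omega>) \<partial>M"
  have m1: "(\<lambda>\<omega>. X (grid_up n (T \<omega>)) \<omega>) \<in> borel_measurable M" for n
    unfolding grid_up_def
  proof (rule measurable_compose_countable[of "\<lambda>k \<omega>. X (real k * (1 / 2 ^ n)) \<omega>"])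
    show "X (real k * (1 / 2 ^ n)) \<in> borel_measurable M" for k by (rule X_measurable) simp
  qed measurable
  show "?I \<longlonglongrightarrow> (\<integral>\<omega>. g (X (T \<omega>) \<omega>) \<partial>M)"
  proof (rule integral_dominated_convergence[where w="\<lambda>_. B"])
    show "AE \<omega> in M. (\<lambda>n. g (X (grid_up n (T \<omega>)) \<omega>)) \<longlonglongrightarrow> g (X (T \<omega>) \<omega>)"
      using cadlag_grid_tendsto[of "T _" "\<lambda>s. X s _"] right_continuous T_nonneg
      by (intro AE_I2 isCont_tendsto_compose[OF gc]) blast
  qed (use g(2) in \<open>auto intro!: measurable_compose[OF _ gm] m1 end_measurable\<close>)
  have "?I n = (\<integral>t. \<integral>\<omega>. g (X (grid_up n t) \<omega>) \<partial>M \<partial>distr M borel T)" for n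
  proof -
    let ?f = "\<lambda>p. snd p (grid_up n (fst p)) :: real"
    have f: "?f \<in> borel_measurable (borel \<Otimes>\<^sub>M paths)"
      unfolding grid_up_def
    proof (rule measurable_compose_countable[of "\<lambda>k p. snd p (real k * (1 / 2 ^ n))"])
      show "(\<lambda>p. snd p (real k * (1 / 2 ^ n)) :: real) \<in> borel_measurable (borel \<Otimes>\<^sub>M paths)" for k
        by (rule measurable_compose[OF measurable_snd measurable_component_singleton]) simp
    qed measurable
    have pm: "(\<lambda>\<omega>. (T \<omega>, traj \<omega>)) \<in> M \<rightarrow>\<^sub>M borel \<Otimes>\<^sub>M paths"
      by (intro measurable_Pair T_measurable traj_measurable)
    have gf: "(\<lambda>p. g (?f p)) \<in> borel_measurable (borel \<Otimes>\<^sub>M paths)" by (rule measurable_compose[OF f gm])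
    have "(\<lambda>p. p (grid_up n t)) \<in> borel_measurable paths" for t
      by (rule measurable_component_singleton) (simp add: grid_up_def)
    from measurable_compose[OF this gm] have gf2: "(\<lambda>p. g (p (grid_up n t))) \<in> borel_measurable paths" for t .
    have trg: "traj \<omega> (grid_up n t) = X (grid_up n t) \<omega>" for \<omega> t by (simp add: grid_up_def)
    have "?I n = (\<integral>p. g (?f p) \<partial>distr M (borel \<Otimes>\<^sub>M paths) (\<lambda>\<omega>. (T \<omega>, traj \<omega>)))"
      by (subst integral_distr[OF pm gf]) (simp only: fst_conv snd_conv trg)
    also have "\<dots> = (\<integral>t. \<integral>p. g (?f (t, p)) \<partial>distr M paths traj \<partial>distr M borel T)"
      unfolding distr_T_traj
    proof (rule P.integral_fst'[symmetric], rule P.integrable_const_bound[where B=B])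
      show "(\<lambda>p. g (?f p)) \<in> borel_measurable (distr M borel T \<Otimes>\<^sub>M distr M paths traj)"
        using gf by (simp cong: measurable_cong_sets sets_pair_measure_cong)
    qed (use g in simp)
    also have "\<dots> = (\<integral>t. \<integral>\<omega>. g (X (grid_up n t) \<omega>) \<partial>M \<partial>distr M borel T)"
      unfolding fst_conv snd_conv
      by (subst integral_distr[OF traj_measurable gf2]) (simp only: trg)
    finally show ?thesis .
  qed
  moreover have "(\<lambda>n. \<integral>t. \<integral>\<omega>. g (X (grid_up n t) \<omega>) \<partial>M \<partial>distr M borel T) \<longlonglongrightarrow> (\<integral>t. \<integral>\<omega>. g (X (max 0 t) \<omega>) \<partial>M \<partial>distr M borel T)"
  proof (rule integral_dominated_convergence[where w="\<lambda>_. B"])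
    have nb: "norm (\<integral>\<omega>. g (h \<omega>) \<partial>M) \<le> B" for h using g by (intro norm_integral_prob_le prob_space_axioms) simp
    then show "AE t in distr M borel T. norm (\<integral>\<omega>. g (X (grid_up n t) \<omega>) \<partial>M) \<le> B" for n by simp
    have mm: "(\<lambda>p. X (max 0 (fst p)) (snd p)) \<in> borel_measurable (borel \<Otimes>\<^sub>M M)" by (rule measurable_X_pair)
    have "(\<lambda>t. \<integral>\<omega>. g (X (max 0 t) \<omega>) \<partial>M) \<in> borel_measurable borel"
      using borel_measurable_lebesgue_integral[of "\<lambda>t \<omega>. g (X (max 0 t) \<omega>)" borel] measurable_compose[OF mm gm]
      by (simp add: case_prod_beta)
    then show "(\<lambda>t. \<integral>\<omega>. g (X (max 0 t) \<omega>) \<partial>M) \<in> borel_measurable (distr M borel T)" by simp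
    have "(\<lambda>t. \<integral>\<omega>. g (X (grid_up n t) \<omega>) \<partial>M) \<in> borel_measurable borel" for n
      unfolding grid_up_def
      by (rule measurable_compose_countable[of "\<lambda>k t. \<integral>\<omega>. g (X (real k * (1 / 2 ^ n)) \<omega>) \<partial>M"]) auto
    then show "(\<lambda>t. \<integral>\<omega>. g (X (grid_up n t) \<omega>) \<partial>M) \<in> borel_measurable (distr M borel T)" for n by simp
    have "(\<lambda>n. \<integral>\<omega>. g (X (grid_up n t) \<omega>) \<partial>M) \<longlonglongrightarrow> (\<integral>\<omega>. g (X (max 0 t) \<omega>) \<partial>M)" if t: "0 \<le> t" for t
    proof (rule integral_dominated_convergence[where w="\<lambda>_. B"])
      show "AE \<omega> in M. (\<lambda>n. g (X (grid_up n t) \<omega>)) \<longlonglongrightarrow> g (X (max 0 t) \<omega>)"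
        using cadlag_grid_tendsto[of t "\<lambda>s. X s _"] right_continuous t
        by (intro AE_I2 isCont_tendsto_compose[OF gc]) (simp add: max_def)
    qed (use g(2) Xm in \<open>auto intro!: measurable_compose[OF _ gm]\<close>)
    moreover have "AE t in distr M borel T. 0 \<le> t" using T_nonneg by (subst AE_distr_iff) auto
    ultimately show "AE t in distr M borel T. (\<lambda>n. \<integral>\<omega>. g (X (grid_up n t) \<omega>) \<partial>M) \<longlonglongrightarrow> (\<integral>\<omega>. g (X (max 0 t) \<omega>) \<partial>M)"
      by (auto elim!: eventually_mono)
  qed simp
  ultimately show "?I \<longlonglongrightarrow> (\<integral>t. \<integral>\<omega>. g (X (max 0 t) \<omega>) \<partial>M \<partial>distr M borel T)" by simp
qed

lemma end_law_atomless:
  assumes "\<And>c. AE s in lborel. 0 \<le> s \<longrightarrow> prob {\<omega>\<in>space M. X s \<omega> = c} = 0"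
  shows "atomless (end_law T)"
  unfolding atomless_def
proof
  fix c
  interpret D: prob_space "distr M borel T" by (rule prob_space_distr) simp
  have bb: "\<bar>bump c k x\<bar> \<le> 1" for k x using bump_bounds[where c=c and k=k and x=x] by auto
  have mm: "(\<lambda>p. X (max 0 (fst p)) (snd p)) \<in> borel_measurable (borel \<Otimes>\<^sub>M M)" by (rule measurable_X_pair)
  have gm: "(\<lambda>t. \<integral>\<omega>. g (X (max 0 t) \<omega>) \<partial>M) \<in> borel_measurable borel" if "g \<in> borel_measurable borel" for g :: "real \<Rightarrow> real"
    using borel_measurable_lebesgue_integral[of "\<lambda>t \<omega>. g (X (max 0 t) \<omega>)" borel] measurable_compose[OF mm that]
    by (simp add: case_prod_beta)
  have Xm: "X (max 0 t) \<in> borel_measurable M" for t by (rule X_measurable) simp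
  have le: "measure (end_law T) {c} \<le> (\<integral>t. \<integral>\<omega>. bump c k (X (max 0 t) \<omega>) \<partial>M \<partial>distr M borel T)" for k
  proof -
    interpret R: real_distribution "end_law T" by simp
    have "measure (end_law T) {c} = (\<integral>x. indicator {c} x \<partial>end_law T)" by simp
    also have "\<dots> \<le> (\<integral>x. bump c k x \<partial>end_law T)"
      using bump_bounds bb
      by (intro integral_mono real_distribution_bounded_integrable[where B=1]) (auto simp: indicator_def)
    also have "\<dots> = (\<integral>\<omega>. bump c k (X (T \<omega>) \<omega>) \<partial>M)"
      unfolding end_law_def by (rule integral_distr[OF end_measurable]) simp
    also have "\<dots> = (\<integral>t. \<integral>\<omega>. bump c k (X (max 0 t) \<omega>) \<partial>M \<partial>distr M borel T)"
      by (rule expectation_end[where B=1]) (auto intro!: bump_continuous bb)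
    finally show ?thesis .
  qed
  have "(\<lambda>k. \<integral>t. \<integral>\<omega>. bump c k (X (max 0 t) \<omega>) \<partial>M \<partial>distr M borel T) \<longlonglongrightarrow>
    (\<integral>t. \<integral>\<omega>. indicator {c} (X (max 0 t) \<omega>) \<partial>M \<partial>distr M borel T)"
  proof (rule integral_dominated_convergence[where w="\<lambda>_. 1"])
    show "AE t in distr M borel T. norm (\<integral>\<omega>. bump c k (X (max 0 t) \<omega>) \<partial>M) \<le> 1" for k
      using bb by (intro AE_I2 norm_integral_prob_le prob_space_axioms) simp
    have "(\<lambda>k. \<integral>\<omega>. bump c k (X (max 0 t) \<omega>) \<partial>M) \<longlonglongrightarrow> (\<integral>\<omega>. indicator {c} (X (max 0 t) \<omega>) \<partial>M)" for t
      using bb bump_tendsto Xm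
      by (intro integral_dominated_convergence[where w="\<lambda>_. 1"]) (auto intro!: measurable_compose[OF Xm])
    then show "AE t in distr M borel T. (\<lambda>k. \<integral>\<omega>. bump c k (X (max 0 t) \<omega>) \<partial>M) \<longlonglongrightarrow> (\<integral>\<omega>. indicator {c} (X (max 0 t) \<omega>) \<partial>M)"
      by simp
  qed (auto intro!: gm)
  moreover have "(\<integral>t. \<integral>\<omega>. (indicator {c} (X (max 0 t) \<omega>) :: real) \<partial>M \<partial>distr M borel T) = 0"
  proof (rule integral_eq_zero_AE)
    have "(\<integral>\<omega>. indicator {c} (X (max 0 t) \<omega>) \<partial>M) = prob {\<omega>\<in>space M. X (max 0 t) \<omega> = c}" for t
    proof -
      have "(\<integral>\<omega>. indicator {c} (X (max 0 t) \<omega>) \<partial>M) = (\<integral>\<omega>. (indicator {\<omega>\<in>space M. X (max 0 t) \<omega> = c} \<omega> :: real) \<partial>M)"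
        by (intro Bochner_Integration.integral_cong) (auto simp: indicator_def)
      then show ?thesis by simp
    qed
    moreover have "AE t in distr M borel T. prob {\<omega>\<in>space M. X (max 0 t) \<omega> = c} = 0"
      unfolding T_law
    proof (subst AE_density)
      show "AE t in lborel. 0 < ennreal (exponential_density r t) \<longrightarrow> prob {\<omega>\<in>space M. X (max 0 t) \<omega> = c} = 0"
        using assms[of c] by eventually_elim (auto simp: exponential_density_def max_def split: if_splits)
    qed simp
    ultimately show "AE t in distr M borel T. (\<integral>\<omega>. (indicator {c} (X (max 0 t) \<omega>) :: real) \<partial>M) = 0" by simp
  qed
  ultimately have "measure (end_law T) {c} \<le> 0" using le by (intro LIMSEQ_le_const) auto
  then show "measure (end_law T) {c} = 0" by (simp add: measure_le_0_iff)
qed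

lemma end_law_convolution: "end_law T = convolution (sup_law T) (inf_law T)"
  by (rule Levy_uniqueness)
    (auto intro!: real_distribution_convolution simp: fun_eq_iff char_convolution wiener_hopf)

end

context two_clocks begin

lemma swap: "two_clocks M X q' q T S"
  by (intro two_clocks.intro B.levy_clock_axioms A.levy_clock_axioms)

text \<open>
  The law with distribution function K: infimum at rate q plus independent supremum at rate q'.
\<close>

definition K_law where "K_law = convolution (A.inf_law S) (A.sup_law T)"

lemma rd_laws [simp]:
  "real_distribution (A.inf_law S)" "real_distribution (A.sup_law S)" "real_distribution (A.inf_law T)"
  "real_distribution (A.sup_law T)" "real_distribution (A.end_law S)" "real_distribution K_law"
  unfolding K_law_def by (intro real_distribution_convolution A.rd_laws B.rd_laws)+

lemma rd_cross_law_clamp [simp]: "real_distribution (distr cross_law borel (max 0))" "real_distribution (distr cross_law borel (min 0))"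
  by (intro real_distribution_distr_borel rd_cross_law; simp)+

lemma conv_op_sup_law_relation:
  assumes g: "bdd_borel g"
  shows "q' * conv_op (A.sup_law S) g x = q * conv_op (A.sup_law T) g x + (q' - q) * conv_op (A.sup_law T) (conv_op (distr cross_law borel (max 0)) g) x"
proof -
  have "q' * conv_op (A.sup_law S) g x + (- q) * conv_op (A.sup_law T) g x
     + (- (q' - q)) * conv_op (convolution (A.sup_law T) (distr cross_law borel (max 0))) g x = 0"
    using sup_law_relation
    by (intro conv_op_relation real_distribution_convolution rd_laws rd_cross_law_clamp g)
      (simp add: char_convolution algebra_simps)
  then show ?thesis by (simp add: conv_op_convolution(1)[OF _ _ g] algebra_simps)
qed

lemma conv_op_inf_law_relation:
  assumes g: "bdd_borel g"
  shows "q * conv_op (A.inf_law T) g x = q' * conv_op (A.inf_law S) g x - (q' - q) * conv_op (A.inf_law S) (conv_op (distr cross_law borel (min 0)) g) x"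
proof -
  have "q * conv_op (A.inf_law T) g x + (- q') * conv_op (A.inf_law S) g x
     + (q' - q) * conv_op (convolution (A.inf_law S) (distr cross_law borel (min 0))) g x = 0"
    using inf_law_relation
    by (intro conv_op_relation real_distribution_convolution rd_laws rd_cross_law_clamp g)
      (simp add: char_convolution algebra_simps)
  then show ?thesis by (simp add: conv_op_convolution(1)[OF _ _ g] algebra_simps)
qed

text \<open>
  By sup_law_relation the law at rate q is a signed combination of convolutions with the law at rate q'.
\<close>

lemma sup_law_atomless:
  assumes "atomless (A.sup_law T)" shows "atomless (A.sup_law S)"
proof -
  have b: "bdd_borel (indicator {a})" for a by (rule bdd_borel_indicator) simp
  have "conv_op (A.sup_law T) (conv_op (distr cross_law borel (max 0)) (indicator {a})) x = 0" for a x
    using atomless_convolution(1)[OF rd_laws(4) rd_cross_law_clamp(1) assms]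
    by (simp add: conv_op_convolution(1)[OF _ _ b, symmetric] atomless_conv_op real_distribution_convolution)
  then show ?thesis
    using conv_op_sup_law_relation[OF b] assms B.r by (simp add: atomless_conv_op)
qed

lemma inf_law_atomless:
  assumes "atomless (A.inf_law S)" shows "atomless (A.inf_law T)"
proof -
  have b: "bdd_borel (indicator {a})" for a by (rule bdd_borel_indicator) simp
  have "conv_op (A.inf_law S) (conv_op (distr cross_law borel (min 0)) (indicator {a})) x = 0" for a x
    using atomless_convolution(1)[OF rd_laws(1) rd_cross_law_clamp(2) assms]
    by (simp add: conv_op_convolution(1)[OF _ _ b, symmetric] atomless_conv_op real_distribution_convolution)
  then show ?thesis
    using conv_op_inf_law_relation[OF b] assms A.r by (simp add: atomless_conv_op)
qed

lemma cross_law_K_law_atomless: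
  assumes "atomless (A.end_law S)"
  shows "atomless cross_law" "atomless K_law"
proof -
  interpret R: two_clocks M X q' q T S by (rule swap)
  have "atomless (A.sup_law S) \<or> atomless (A.inf_law S)"
    using assms unfolding A.end_law_convolution by (intro atomless_factor rd_laws)
  then have "atomless (A.sup_law S) \<and> atomless (A.sup_law T) \<or> atomless (A.inf_law S) \<and> atomless (A.inf_law T)"
    using R.sup_law_atomless inf_law_atomless by blast
  then show "atomless cross_law" "atomless K_law"
    unfolding cross_law_def K_law_def by (auto intro: atomless_convolution)
qed

end

section \<open>The value function of the skeleton\<close>

text \<open>
  The level is tested before each step and v is the extra factor for a step started at or below b, as
  in killed_walk_formula.
\<close>

primrec killed_payoff :: "real \<Rightarrow> real \<Rightarrow> real \<Rightarrow> nat \<Rightarrow> (nat \<Rightarrow> real) \<Rightarrow> real \<Rightarrow> real" where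
  "killed_payoff v b y 0 \<xi> x = indicator {y<..} x"
| "killed_payoff v b y (Suc n) \<xi> x = (if x \<le> b then v else 1) * killed_payoff v b y n (\<lambda>i. \<xi> (Suc i)) (x + \<xi> 0)"

lemma killed_payoff_exp:
  "killed_payoff (exp (- p * h)) b y n \<xi> x =
    exp (- p * (h * (\<Sum>k<n. indicator {..b} (x + (\<Sum>i<k. \<xi> i))))) * indicator {y<..} (x + (\<Sum>i<n. \<xi> i))"
proof (induction n arbitrary: \<xi> x)
  case (Suc n)
  have i: "(if x \<le> b then exp (- p * h) else 1) = exp (- p * (h * indicator {..b} x))" by simp
  have s: "(\<Sum>k<Suc n. indicator {..b} (x + (\<Sum>i<k. \<xi> i)) :: real) =
     indicator {..b} x + (\<Sum>k<n. indicator {..b} (x + \<xi> 0 + (\<Sum>i<k. \<xi> (Suc i))))"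
    by (simp add: sum.lessThan_Suc_shift add.assoc del: sum.lessThan_Suc)
  show ?case
    unfolding killed_payoff.simps Suc i s by (simp add: sum.lessThan_Suc_shift add.assoc distrib_left exp_add[symmetric] exp_minus del: sum.lessThan_Suc)
      (simp add: exp_minus[symmetric] mult_exp_exp algebra_simps)
qed simp

lemma killed_payoff_bounds:
  assumes "0 \<le> v" shows "0 \<le> killed_payoff v b y n \<xi> x" "killed_payoff v b y n \<xi> x \<le> max 1 v ^ n"
proof -
  show *: "0 \<le> killed_payoff v b y n \<xi> x" for n \<xi> x using assms by (induction n arbitrary: \<xi> x) auto
  show "killed_payoff v b y n \<xi> x \<le> max 1 v ^ n"
  proof (induction n arbitrary: \<xi> x)
    case (Suc n)
    have "(if x \<le> b then v else 1) * killed_payoff v b y n (\<lambda>i. \<xi> (Suc i)) (x + \<xi> 0) \<le> max 1 v * max 1 v ^ n"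
      using Suc * assms by (intro mult_mono) auto
    then show ?case by simp
  qed simp
qed

lemma measurable_killed_payoff_pair: "(\<lambda>p. killed_payoff v b y n (fst p) (snd p)) \<in> borel_measurable (seqs \<Otimes>\<^sub>M borel)"
proof (induction n)
  case (Suc n)
  have "(\<lambda>p. (\<lambda>i. fst p (Suc i), snd p + fst p 0)) \<in> seqs \<Otimes>\<^sub>M borel \<rightarrow>\<^sub>M seqs \<Otimes>\<^sub>M (borel :: real measure)"
    by (intro measurable_Pair measurable_compose[OF measurable_fst measurable_shift] borel_measurable_add
      measurable_snd measurable_compose[OF measurable_fst measurable_component_singleton]) auto
  from measurable_compose[OF this Suc]
  have [measurable]: "(\<lambda>p. killed_payoff v b y n (\<lambda>i. fst p (Suc i)) (snd p + fst p 0)) \<in> borel_measurable (seqs \<Otimes>\<^sub>M borel)"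
    by simp
  show ?case unfolding killed_payoff.simps by measurable
qed simp

lemma measurable_killed_payoff: "(\<lambda>\<xi>. killed_payoff v b y n \<xi> x) \<in> borel_measurable seqs"
proof -
  have "(\<lambda>\<xi>. (\<xi>, x)) \<in> seqs \<rightarrow>\<^sub>M seqs \<Otimes>\<^sub>M (borel :: real measure)" by measurable
  from measurable_compose[OF this measurable_killed_payoff_pair] show ?thesis by simp
qed

context step_law begin

primrec mean_payoff :: "real \<Rightarrow> real \<Rightarrow> real \<Rightarrow> nat \<Rightarrow> real \<Rightarrow> real" where
  "mean_payoff v b y 0 = (indicator {y<..} :: real \<Rightarrow> real)"
| "mean_payoff v b y (Suc n) = (\<lambda>x. (if x \<le> b then v else 1) * conv_op lam (mean_payoff v b y n) x)"

lemma bdd_borel_mean_payoff: "bdd_borel (mean_payoff v b y n)"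
proof (induction n)
  case (Suc n)
  have "bdd_borel (\<lambda>x. (v * indicator {..b} x + indicator {b<..} x) * conv_op lam (mean_payoff v b y n) x)"
    by (intro bdd_borel_intros Suc lam) auto
  also have "(\<lambda>x. (v * indicator {..b} x + indicator {b<..} x) * conv_op lam (mean_payoff v b y n) x) = mean_payoff v b y (Suc n)"
    by (auto simp: fun_eq_iff indicator_def)
  finally show ?case .
qed (simp add: bdd_borel_indicator)

lemma integral_killed_payoff:
  assumes v: "0 \<le> v"
  shows "(\<integral>\<xi>. killed_payoff v b y n \<xi> x \<partial>PiM UNIV (\<lambda>_. lam)) = mean_payoff v b y n x"
proof (induction n arbitrary: x)
  case 0
  interpret S: prob_space "PiM UNIV (\<lambda>_::nat. lam)" using prob_space_iid[OF lam] .
  show ?case by (simp add: S.prob_space)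
next
  case (Suc n)
  have "(\<integral>\<xi>. killed_payoff v b y (Suc n) \<xi> x \<partial>PiM UNIV (\<lambda>_. lam)) =
    (\<integral>s. \<integral>\<xi>. killed_payoff v b y (Suc n) (case_nat s \<xi>) x \<partial>PiM UNIV (\<lambda>_. lam) \<partial>lam)"
    using killed_payoff_bounds[OF v] by (intro integral_iid_first_step[OF lam measurable_killed_payoff, where B="max 1 v ^ Suc n"])
      (auto simp del: killed_payoff.simps power_Suc)
  then show ?case by (simp add: Suc conv_op_def)
qed

lemma mean_payoff_bounds: "0 \<le> v \<Longrightarrow> 0 \<le> mean_payoff v b y n x" "0 \<le> v \<Longrightarrow> mean_payoff v b y n x \<le> max 1 v ^ n"
proof -
  interpret S: prob_space "PiM UNIV (\<lambda>_::nat. lam)" using prob_space_iid[OF lam] .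
  assume v: "0 \<le> v"
  note kwb = killed_payoff_bounds[OF v]
  show "0 \<le> mean_payoff v b y n x" unfolding integral_killed_payoff[OF v, symmetric] by (simp add: kwb)
  have "norm (\<integral>\<xi>. killed_payoff v b y n \<xi> x \<partial>PiM UNIV (\<lambda>_. lam)) \<le> max 1 v ^ n"
    using kwb by (intro norm_integral_prob_le S.prob_space_axioms) auto
  then show "mean_payoff v b y n x \<le> max 1 v ^ n" unfolding integral_killed_payoff[OF v] by simp
qed

definition killed_value :: "real \<Rightarrow> real \<Rightarrow> real \<Rightarrow> real \<Rightarrow> real \<Rightarrow> real" where
  "killed_value z v b y x = (\<Sum>n. (1 - z) * z ^ n * mean_payoff v b y n x)"

text \<open>
  For v > 1 the payoffs are unbounded in n, and it is z v < 1 that makes the series converge; this is the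
  case of negative p, and z v < 1 is then the condition p > -q.
\<close>

lemma killed_value:
  assumes z: "0 < z" "z < 1" and v: "0 < v" "z * v < 1"
  shows bdd_borel_killed_value: "bdd_borel (killed_value z v b y)"
    and killed_value_eq: "killed_value z v b y x =
      (1 - z) * indicator {y<..} x + (if x \<le> b then z * v else z) * conv_op lam (killed_value z v b y) x"
    and killed_value_expectation: "killed_value z v b y x =
      (1 - z) * indicator {y<..} x + z * (\<integral>p. killed_payoff v b y (Suc (fst p)) (snd p) x \<partial>geo_seq z lam)"
proof -
  define m where "m = max 1 v"
  have zm: "0 < z * m" "z * m < 1" using z v by (auto simp: m_def max_def)
  have v0: "0 \<le> v" using v by simp
  let ?r = "mean_payoff v b y"
  have rb: "0 \<le> ?r n x" "?r n x \<le> m ^ n" for n x using mean_payoff_bounds[OF v0] by (auto simp: m_def)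
  have ab: "\<bar>(1 - z) * z ^ n * ?r n x\<bar> \<le> (1 - z) * (z * m) ^ n" for n x
    using rb[of n x] z by (simp add: abs_mult power_mult_distrib mult_left_mono)
  have sm: "summable (\<lambda>n. (1 - z) * (z * m) ^ n)" using zm by (intro summable_mult summable_geometric) auto
  have s: "summable (\<lambda>n. (1 - z) * z ^ n * ?r n x)" for x
    by (rule summable_comparison_test'[OF sm]) (use ab in auto)
  have s1: "summable (\<lambda>n. z ^ n * norm (?r (Suc n) x))" for x
  proof (rule summable_comparison_test')
    show "summable (\<lambda>n. m * (z * m) ^ n)" using zm by (intro summable_mult summable_geometric) auto
    show "norm (z ^ n * norm (?r (Suc n) x)) \<le> m * (z * m) ^ n" for n
    proof -
      have "norm (z ^ n * norm (?r (Suc n) x)) = z ^ n * ?r (Suc n) x"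
        using rb(1)[of "Suc n" x] z by (simp del: mean_payoff.simps)
      also have "\<dots> \<le> z ^ n * m ^ Suc n" using rb(2)[of "Suc n" x] z by (intro mult_left_mono) auto
      finally show ?thesis by (simp add: power_mult_distrib algebra_simps)
    qed
  qed
  let ?R = "killed_value z v b y"
  show bR: "bdd_borel ?R"
  proof (rule bdd_borelI)
    have [measurable]: "?r n \<in> borel_measurable borel" for n using bdd_borel_mean_payoff by (auto simp: bdd_borel_def)
    show "?R \<in> borel_measurable borel" unfolding killed_value_def[abs_def] by measurable
    show "\<bar>?R x\<bar> \<le> (\<Sum>n. (1 - z) * (z * m) ^ n)" for x
      unfolding killed_value_def
    proof -
      have sa: "summable (\<lambda>n. \<bar>(1 - z) * z ^ n * ?r n x\<bar>)"
        by (rule summable_comparison_test'[OF sm]) (use ab in auto)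
      show "\<bar>\<Sum>n. (1 - z) * z ^ n * ?r n x\<bar> \<le> (\<Sum>n. (1 - z) * (z * m) ^ n)"
        by (rule order_trans[OF summable_rabs[OF sa] suminf_le[OF ab sa sm]])
    qed
  qed
  have split: "?R x = (1 - z) * indicator {y<..} x + z * (\<Sum>n. (1 - z) * z ^ n * ?r (Suc n) x)" for x
  proof -
    have "?R x = (\<Sum>n. (1 - z) * z ^ Suc n * ?r (Suc n) x) + (1 - z) * z ^ 0 * ?r 0 x"
      unfolding killed_value_def using suminf_split_head[OF s, of x] by linarith
    also have "(\<Sum>n. (1 - z) * z ^ Suc n * ?r (Suc n) x) = (\<Sum>n. z * ((1 - z) * z ^ n * ?r (Suc n) x))"
      by (simp add: algebra_simps del: mean_payoff.simps(2))
    also have "\<dots> = z * (\<Sum>n. (1 - z) * z ^ n * ?r (Suc n) x)"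
    proof (rule suminf_mult)
      have "summable (\<lambda>n. (1 - z) * (z ^ n * norm (?r (Suc n) x)))" by (intro summable_mult s1)
      then show "summable (\<lambda>n. (1 - z) * z ^ n * ?r (Suc n) x)"
        using rb(1) by (simp add: mult.assoc del: mean_payoff.simps(2))
    qed
    finally show ?thesis by simp
  qed
  have trs: "conv_op lam ?R x = (\<Sum>n. (1 - z) * z ^ n * conv_op lam (?r n) x)" and trsum: "summable (\<lambda>n. (1 - z) * z ^ n * conv_op lam (?r n) x)" for x
  proof -
    have b: "bdd_borel (\<lambda>u. (1 - z) * z ^ n * ?r n (x + u))" for n
      by (intro bdd_borel_intros bdd_borel_shift bdd_borel_mean_payoff)
    have i: "integrable lam (\<lambda>u. (1 - z) * z ^ n * ?r n (x + u))" for n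
      by (rule bdd_borel_integrable[OF lam b])
    have ib: "(\<integral>u. norm ((1 - z) * z ^ n * ?r n (x + u)) \<partial>lam) \<le> (1 - z) * (z * m) ^ n" for n
      using norm_integral_prob_le[of lam "\<lambda>u. norm ((1 - z) * z ^ n * ?r n (x + u))" "(1 - z) * (z * m) ^ n"] ab
      by (simp add: prob_space_axioms)
    have 1: "AE u in lam. summable (\<lambda>n. norm ((1 - z) * z ^ n * ?r n (x + u)))"
      by (intro AE_I2 summable_comparison_test'[OF sm]) (use ab in auto)
    have 2: "summable (\<lambda>n. \<integral>u. norm ((1 - z) * z ^ n * ?r n (x + u)) \<partial>lam)"
      by (rule summable_comparison_test'[OF sm]) (use ib in simp)
    have "conv_op lam ?R x = (\<integral>u. (\<Sum>n. (1 - z) * z ^ n * ?r n (x + u)) \<partial>lam)"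
      by (simp add: conv_op_def killed_value_def)
    also have "\<dots> = (\<Sum>n. \<integral>u. (1 - z) * z ^ n * ?r n (x + u) \<partial>lam)"
      by (rule integral_suminf[OF i 1 2])
    finally show "conv_op lam ?R x = (\<Sum>n. (1 - z) * z ^ n * conv_op lam (?r n) x)" by (simp add: conv_op_def)
    show "summable (\<lambda>n. (1 - z) * z ^ n * conv_op lam (?r n) x)"
      using summable_integral[OF i 1 2] by (simp add: conv_op_def)
  qed
  show "?R x = (1 - z) * indicator {y<..} x + (if x \<le> b then z * v else z) * conv_op lam ?R x"
  proof -
    have "(\<Sum>n. (1 - z) * z ^ n * ?r (Suc n) x) = (\<Sum>n. (if x \<le> b then v else 1) * ((1 - z) * z ^ n * conv_op lam (?r n) x))"
      by (simp add: algebra_simps)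
    also have "\<dots> = (if x \<le> b then v else 1) * conv_op lam ?R x"
      unfolding trs by (rule suminf_mult[OF trsum])
    finally show ?thesis unfolding split[of x] by simp
  qed
  show "?R x = (1 - z) * indicator {y<..} x + z * (\<integral>p. killed_payoff v b y (Suc (fst p)) (snd p) x \<partial>geo_seq z lam)"
  proof -
    let ?S = "PiM UNIV (\<lambda>_::nat. lam)" and ?G = "measure_pmf (geometric_pmf (1 - z))"
    interpret S: prob_space ?S using prob_space_iid[OF lam] .
    interpret P: pair_prob_space ?G ?S ..
    let ?f = "\<lambda>p. killed_payoff v b y (Suc (fst p)) (snd p) x"
    have m: "?f \<in> borel_measurable (?G \<Otimes>\<^sub>M ?S)"
      unfolding geo_seq_def[symmetric]
      by (intro measurable_geo_seq[OF lam] measurable_nat_seq) (simp only: fst_conv snd_conv measurable_killed_payoff)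
    have km: "(\<lambda>\<xi>. killed_payoff v b y n \<xi> x) \<in> borel_measurable ?S" for n
      unfolding measurable_cong_sets[OF sets_iid[OF lam] refl] by (rule measurable_killed_payoff)
    have ki: "integrable ?S (\<lambda>\<xi>. killed_payoff v b y n \<xi> x)" for n
      using killed_payoff_bounds[OF v0] by (intro S.integrable_const_bound[where B="max 1 v ^ n"] km) auto
    have "integrable (?G \<Otimes>\<^sub>M ?S) ?f"
    proof (rule P.Fubini_integrable[OF m])
      have "(\<integral>\<xi>. norm (?f (n, \<xi>)) \<partial>?S) = ?r (Suc n) x" for n
        using killed_payoff_bounds(1)[OF v0] integral_killed_payoff[OF v0, of b y "Suc n" x] by (simp del: killed_payoff.simps mean_payoff.simps)
      then show "integrable ?G (\<lambda>n. \<integral>\<xi>. norm (?f (n, \<xi>)) \<partial>?S)"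
        using integrable_geometric_pmf[OF z s1[of x]] by (simp del: killed_payoff.simps mean_payoff.simps)
      show "AE n in ?G. integrable ?S (\<lambda>\<xi>. ?f (n, \<xi>))" using ki by (simp del: killed_payoff.simps)
    qed
    from P.integral_fst'[OF this]
    have "(\<integral>p. ?f p \<partial>geo_seq z lam) = (\<integral>n. ?r (Suc n) x \<partial>?G)"
      unfolding geo_seq_def using integral_killed_payoff[OF v0, of b y "Suc _" x] by (simp del: killed_payoff.simps mean_payoff.simps)
    also have "\<dots> = (\<Sum>n. (1 - z) * z ^ n * ?r (Suc n) x)"
      using sums_unique[OF sums_geometric_pmf[OF z s1[of x]]] by (simp del: mean_payoff.simps)
    finally show ?thesis unfolding split[of x] by simp
  qed
qed

end

section \<open>Occupation times as limits of Riemann sums\<close>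

lemma grid_up_cell:
  assumes "real k * (1 / 2 ^ n) < s" "s \<le> real (Suc k) * (1 / 2 ^ n)"
  shows "grid_up n s = real (Suc k) * (1 / 2 ^ n)"
proof -
  have "real k < s * 2 ^ n" "s * 2 ^ n \<le> real (Suc k)" using assms by (auto simp: field_simps)
  then have "\<lceil>s * 2 ^ n\<rceil> = int (Suc k)" by (intro ceiling_unique) auto
  then show ?thesis unfolding grid_up_def by (simp only: nat_int)
qed

lemma grid_sum_integral:
  fixes F :: "real \<Rightarrow> real"
  shows "has_bochner_integral lborel (\<lambda>s. indicator {0<..real N * (1 / 2 ^ n)} s * F (grid_up n s))
    (1 / 2 ^ n * (\<Sum>k<N. F (real (Suc k) * (1 / 2 ^ n))))"
proof (induction N)
  case 0
  then show ?case by (simp add: has_bochner_integral_zero)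
next
  case (Suc N)
  define h where "h = 1 / (2::real) ^ n"
  have h: "0 < h" by (simp add: h_def)
  have "has_bochner_integral lborel (indicator {real N * h<..real (Suc N) * h} :: real \<Rightarrow> real) (measure lborel {real N * h<..real (Suc N) * h})"
    using h by (intro has_bochner_integral_real_indicator) auto
  also have "measure lborel {real N * h<..real (Suc N) * h} = h" using h by (simp add: algebra_simps)
  finally have "has_bochner_integral lborel (\<lambda>s. indicator {real N * h<..real (Suc N) * h} s * F (real (Suc N) * h)) (h * F (real (Suc N) * h))"
    by (rule has_bochner_integral_mult_left)
  from has_bochner_integral_add[OF Suc[folded h_def] this]
  have "has_bochner_integral lborel (\<lambda>s. indicator {0<..real N * h} s * F (grid_up n s) + indicator {real N * h<..real (Suc N) * h} s * F (real (Suc N) * h))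
     (h * (\<Sum>k<Suc N. F (real (Suc k) * h)))" by (simp add: algebra_simps)
  also have "(\<lambda>s. indicator {0<..real N * h} s * F (grid_up n s) + indicator {real N * h<..real (Suc N) * h} s * F (real (Suc N) * h)) =
     (\<lambda>s. indicator {0<..real (Suc N) * h} s * F (grid_up n s))"
  proof
    fix s
    have Nh: "0 \<le> real N * h" "real N * h < real (Suc N) * h" using h by auto
    consider "s \<le> real N * h" | "real N * h < s" "s \<le> real (Suc N) * h" | "real (Suc N) * h < s" by linarith
    then show "indicator {0<..real N * h} s * F (grid_up n s) + indicator {real N * h<..real (Suc N) * h} s * F (real (Suc N) * h) =
     indicator {0<..real (Suc N) * h} s * F (grid_up n s)"
    proof cases
      case 2
      then have "grid_up n s = real (Suc N) * h" unfolding h_def by (rule grid_up_cell)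
      then show ?thesis using 2 Nh by (simp add: indicator_def del: of_nat_Suc)
    qed (use Nh in \<open>auto simp: indicator_def simp del: of_nat_Suc\<close>)
  qed
  finally show ?case unfolding h_def .
qed

text \<open>
  The indicator of a half-line is continuous off b, and the path takes the value b at almost no time.
  Right end points of the grid cells are used first, since they approach from the right; passing to left
  end points changes the sum by at most one mesh.
\<close>

lemma occupation_riemann_sum:
  fixes x :: "real \<Rightarrow> real"
  assumes rc: "\<And>t. 0 \<le> t \<Longrightarrow> continuous (at_right t) x" and T: "0 < T"
    and null: "AE s in lborel. 0 \<le> s \<longrightarrow> x s \<noteq> b"
  shows "(\<lambda>n. 1 / 2 ^ n * (\<Sum>k<nat \<lceil>(T::real) * 2 ^ n\<rceil>. indicator {..b} (x (real k * (1 / 2 ^ n)))))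
    \<longlonglongrightarrow> (LINT s:{0..T}|lborel. indicator {..b} (x s) :: real)"
proof -
  let ?N = "\<lambda>n. nat \<lceil>T * 2 ^ n\<rceil>"
  let ?F = "\<lambda>s. indicator {..b} (x s) :: real"
  have xm: "(\<lambda>s. x (max 0 s)) \<in> borel_measurable borel"
  proof (rule borel_measurable_LIMSEQ_real)
    show "(\<lambda>n. x (grid_up n (max 0 s))) \<longlonglongrightarrow> x (max 0 s)" for s
      by (intro cadlag_grid_tendsto rc) auto
    show "(\<lambda>s. x (grid_up n (max 0 s))) \<in> borel_measurable borel" for n
      unfolding grid_up_def
      by (rule measurable_compose_countable[of "\<lambda>k s. x (real k * (1 / 2 ^ n))"]) measurable
  qed
  have fm: "(\<lambda>s. indicator {0..T} s * ?F s) \<in> borel_measurable lborel"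
  proof -
    have "(\<lambda>s. indicator {0..T} s * (indicator {..b} (x (max 0 s)) :: real)) \<in> borel_measurable lborel"
      using measurable_compose[OF xm, of "indicator {..b}"] by measurable
    also have "(\<lambda>s. indicator {0..T} s * (indicator {..b} (x (max 0 s)) :: real)) = (\<lambda>s. indicator {0..T} s * ?F s)"
      by (auto simp: fun_eq_iff indicator_def max_def)
    finally show ?thesis .
  qed
  have 1: "(\<lambda>n. 1 / 2 ^ n * (\<Sum>k<?N n. ?F (real (Suc k) * (1 / 2 ^ n)))) \<longlonglongrightarrow> (\<integral>s. indicator {0..T} s * ?F s \<partial>lborel)"
  proof -
    have "1 / 2 ^ n * (\<Sum>k<?N n. ?F (real (Suc k) * (1 / 2 ^ n))) =
      (\<integral>s. indicator {0<..grid_up n T} s * ?F (grid_up n s) \<partial>lborel)" for n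
      using has_bochner_integral_integral_eq[OF grid_sum_integral[of "?N n" n ?F]]
      unfolding grid_up_def[of n T] by simp
    moreover have "(\<lambda>n. \<integral>s. indicator {0<..grid_up n T} s * ?F (grid_up n s) \<partial>lborel) \<longlonglongrightarrow> (\<integral>s. indicator {0..T} s * ?F s \<partial>lborel)"
    proof (rule integral_dominated_convergence[where w="indicator {0..T + 1}"])
      show "(\<lambda>s. indicator {0<..grid_up n T} s * ?F (grid_up n s)) \<in> borel_measurable lborel" for n
        using grid_sum_integral[of "?N n" n ?F] unfolding grid_up_def[of n T] by (auto simp: has_bochner_integral_iff)
      have g1: "grid_up n T \<le> T + 1" for n
      proof -
        have "1 / 2 ^ n \<le> (1::real)" by simp
        then show ?thesis using grid_up_bounds(2)[of T n] T by linarith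
      qed
      show "AE s in lborel. norm (indicator {0<..grid_up n T} s * ?F (grid_up n s)) \<le> indicator {0..T + 1} s" for n
        using g1[of n] by (intro AE_I2) (auto simp: indicator_def)
      have nz: "AE s in lborel. s \<noteq> (0::real)" by (rule AE_lborel_singleton)
      show "AE s in lborel. (\<lambda>n. indicator {0<..grid_up n T} s * ?F (grid_up n s)) \<longlonglongrightarrow> indicator {0..T} s * ?F s"
        using null nz
      proof eventually_elim
        case (elim s)
        consider "s < 0" | "0 < s" "s \<le> T" | "T < s" using elim by linarith
        then show ?case
        proof cases
          case 1 then show ?thesis by simp
        next
          case 2
          then have "indicator {0<..grid_up n T} s = (1::real)" for n
            using grid_up_bounds(1)[of T n] T by (auto simp: indicator_def)
          moreover have "(\<lambda>n. ?F (grid_up n s)) \<longlonglongrightarrow> ?F s"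
          proof -
            have l: "(\<lambda>n. x (grid_up n s)) \<longlonglongrightarrow> x s" using 2 by (intro cadlag_grid_tendsto rc) auto
            have "x s \<noteq> b" using elim 2 by simp
            then consider "x s < b" | "b < x s" by linarith
            then have "eventually (\<lambda>n. ?F (grid_up n s) = ?F s) sequentially"
            proof cases
              case 1
              from order_tendstoD(2)[OF l this] show ?thesis by eventually_elim (use 1 in auto)
            next
              case 2
              from order_tendstoD(1)[OF l this] show ?thesis by eventually_elim (use 2 in auto)
            qed
            then show ?thesis by (rule tendsto_eventually)
          qed
          ultimately show ?thesis using 2 by simp
        next
          case 3
          have "eventually (\<lambda>n. grid_up n T < s) sequentially"
            using grid_up_tendsto[of T] T 3 by (intro order_tendstoD) auto
          then have "eventually (\<lambda>n. indicator {0<..grid_up n T} s * ?F (grid_up n s) = 0) sequentially"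
            by eventually_elim auto
          then show ?thesis using 3 by (simp add: tendsto_eventually)
        qed
      qed
      show "integrable lborel (indicator {0..T + 1} :: real \<Rightarrow> real)"
        using T by (intro integrable_real_indicator) auto
    qed (rule fm)
    ultimately show ?thesis by simp
  qed
  have 2: "(\<lambda>n. 1 / 2 ^ n * (?F 0 - ?F (grid_up n T))) \<longlonglongrightarrow> 0"
  proof (rule Lim_null_comparison)
    show "eventually (\<lambda>n. norm (1 / 2 ^ n * (?F 0 - ?F (grid_up n T))) \<le> (1 / 2) ^ n) sequentially"
      by (intro always_eventually) (auto simp: indicator_def power_one_over)
    show "(\<lambda>n. (1 / 2 :: real) ^ n) \<longlonglongrightarrow> 0" by (rule LIMSEQ_realpow_zero) auto
  qed
  have tele: "(\<Sum>k<m. f k) = (\<Sum>k<m. f (Suc k)) + (f 0 - f m)" for f :: "nat \<Rightarrow> real" and m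
    by (induction m) auto
  have "1 / 2 ^ n * (\<Sum>k<?N n. ?F (real k * (1 / 2 ^ n))) =
     1 / 2 ^ n * (\<Sum>k<?N n. ?F (real (Suc k) * (1 / 2 ^ n))) + 1 / 2 ^ n * (?F 0 - ?F (grid_up n T))" for n
    by (subst tele[of "\<lambda>k. ?F (real k * (1 / 2 ^ n))"]) (simp add: grid_up_def distrib_left)
  then show ?thesis
    using tendsto_add[OF 1 2] by (simp add: set_lebesgue_integral_def)
qed

section \<open>The value function in the limit\<close>

text \<open>
  The extended continuous mapping theorem, by Skorohod representation.
\<close>

lemma weak_conv_extended_mapping:
  fixes G :: "nat \<Rightarrow> real \<Rightarrow> real"
  assumes \<mu>: "\<And>n. real_distribution (\<mu> n)" "real_distribution m" "weak_conv_m \<mu> m"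
    and G: "\<And>n. G n \<in> borel_measurable borel" "G' \<in> borel_measurable borel" "\<And>n x. \<bar>G n x\<bar> \<le> B"
    and lim: "AE u in m. \<forall>s. s \<longlonglongrightarrow> u \<longrightarrow> (\<lambda>n. G n (s n)) \<longlonglongrightarrow> G' u"
  shows "(\<lambda>n. integral\<^sup>L (\<mu> n) (G n)) \<longlonglongrightarrow> integral\<^sup>L m G'"
proof -
  obtain \<Omega> :: "real measure" and Yn Y where \<Omega>: "prob_space \<Omega>" "\<And>n. Yn n \<in> \<Omega> \<rightarrow>\<^sub>M borel"
    "\<And>n. distr \<Omega> borel (Yn n) = \<mu> n" "Y \<in> \<Omega> \<rightarrow>\<^sub>M borel" "distr \<Omega> borel Y = m"
    "\<And>x. x \<in> space \<Omega> \<Longrightarrow> (\<lambda>n. Yn n x) \<longlonglongrightarrow> Y x"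
    using Skorohod[OF \<mu>] unfolding measurable_lborel1 measurable_lborel2 by blast
  interpret prob_space \<Omega> by fact
  have "(\<lambda>n. \<integral>x. G n (Yn n x) \<partial>\<Omega>) \<longlonglongrightarrow> (\<integral>x. G' (Y x) \<partial>\<Omega>)"
  proof (rule integral_dominated_convergence[where w="\<lambda>_. B"])
    have "AE x in \<Omega>. \<forall>s. s \<longlonglongrightarrow> Y x \<longrightarrow> (\<lambda>n. G n (s n)) \<longlonglongrightarrow> G' (Y x)"
      using lim unfolding \<Omega>(5)[symmetric] by (rule AE_distrD[OF \<Omega>(4)])
    then show "AE x in \<Omega>. (\<lambda>n. G n (Yn n x)) \<longlonglongrightarrow> G' (Y x)"
      using AE_space by eventually_elim (use \<Omega>(6) in auto)
  qed (use G \<Omega> in \<open>auto intro: measurable_compose\<close>)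
  moreover have "integral\<^sup>L (\<mu> n) (G n) = (\<integral>x. G n (Yn n x) \<partial>\<Omega>)" for n
    unfolding \<Omega>(3)[symmetric] by (rule integral_distr[OF \<Omega>(2) G(1)])
  moreover have "integral\<^sup>L m G' = (\<integral>x. G' (Y x) \<partial>\<Omega>)"
    unfolding \<Omega>(5)[symmetric] by (rule integral_distr[OF \<Omega>(4) G(2)])
  ultimately show ?thesis by simp
qed

lemma indicator_Ioi_tendsto:
  fixes s :: "nat \<Rightarrow> real"
  assumes "s \<longlonglongrightarrow> u" "u \<noteq> y"
  shows "(\<lambda>n. indicator {y<..} (s n) :: real) \<longlonglongrightarrow> indicator {y<..} u"
proof (rule tendsto_eventually)
  consider "u < y" | "y < u" using assms(2) by linarith
  then show "eventually (\<lambda>n. indicator {y<..} (s n) = (indicator {y<..} u :: real)) sequentially"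
  proof cases
    case 1
    from order_tendstoD(2)[OF assms(1) this] show ?thesis by eventually_elim (use 1 in auto)
  next
    case 2
    from order_tendstoD(1)[OF assms(1) this] show ?thesis by eventually_elim (use 2 in auto)
  qed
qed

lemma atomless_AE:
  assumes "real_distribution m" "atomless m" shows "AE u in m. u \<noteq> c"
proof -
  interpret real_distribution m by fact
  show ?thesis using assms(2) by (intro AE_not_in[of "{c}", simplified]) (auto simp: null_sets_def emeasure_eq_measure atomless_def)
qed

context levy_clock begin

lemma exp_clock_integrable:
  assumes "a < r"
  shows "integrable M (\<lambda>\<omega>. exp (a * (T \<omega> + 1)))"
proof -
  have "prob_space (density lborel (exponential_density (r - a)))" by (rule prob_space_exponential_density) (use assms in simp)
  then have "(\<integral>\<^sup>+x. ennreal (exponential_density (r - a) x) \<partial>lborel) = 1"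
    using prob_space.emeasure_space_1 by (fastforce simp: emeasure_density)
  then have i: "integrable lborel (exponential_density (r - a))"
    using assms by (intro integrableI_nonneg) (auto simp: exponential_density_def)
  have eq: "exponential_density r x * exp (a * (x + 1)) = r / (r - a) * exp a * exponential_density (r - a) x" for x
    using assms by (auto simp: exponential_density_def exp_add[symmetric] exp_diff field_simps)
  have "integrable lborel (\<lambda>x. exponential_density r x * exp (a * (x + 1)))"
    unfolding eq by (intro integrable_mult_right i)
  then show ?thesis
    using r by (subst distributed_integrable[OF T_distributed, symmetric]) (auto simp: exponential_density_def)
qed

text \<open>
  The occupation time is an integral over time of a function that is jointly measurable in time and \<omega>.
\<close>

lemma V_integrand_measurable:
  "V_integrand (started_at x X) T p b y \<in> borel_measurable M"
proof -
  have X2: "(\<lambda>p. X (max 0 (snd p)) (fst p)) \<in> borel_measurable (M \<Otimes>\<^sub>M lborel)"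
    by (rule X_pair_measurable') measurable
  note X2[measurable]
  have "(\<lambda>p. indicator {0..T (fst p)} (snd p) * indicator {..b} (x + X (max 0 (snd p)) (fst p)) :: real) \<in> borel_measurable (M \<Otimes>\<^sub>M lborel)"
    by (intro borel_measurable_times) (auto simp: indicator_def)
  then have "(\<lambda>\<omega>. \<integral>s. (indicator {0..T \<omega>} s * indicator {..b} (x + X (max 0 s) \<omega>) :: real) \<partial>lborel) \<in> borel_measurable M"
    using lborel.borel_measurable_lebesgue_integral[of "\<lambda>\<omega> s. indicator {0..T \<omega>} s * indicator {..b} (x + X (max 0 s) \<omega>)" M]
    by (simp add: case_prod_beta)
  also have "(\<lambda>\<omega>. \<integral>s. (indicator {0..T \<omega>} s * indicator {..b} (x + X (max 0 s) \<omega>) :: real) \<partial>lborel) =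
      (\<lambda>\<omega>. occupation_time (started_at x X) b (T \<omega>) \<omega>)"
    unfolding occupation_time_def started_at_def set_lebesgue_integral_def
    by (intro ext Bochner_Integration.integral_cong) (auto simp: indicator_def max_def)
  finally have [measurable]: "(\<lambda>\<omega>. occupation_time (started_at x X) b (T \<omega>) \<omega>) \<in> borel_measurable M" .
  note end_measurable[measurable]
  have [measurable]: "(\<lambda>\<omega>. started_at x X (T \<omega>) \<omega>) \<in> borel_measurable M"
    unfolding started_at_def by measurable
  show ?thesis unfolding V_integrand_def[abs_def] by measurable
qed

end

lemma (in levy_process) AE_path_avoids:
  assumes "\<And>c. AE s in lborel. 0 \<le> s \<longrightarrow> prob {\<omega>\<in>space M. X s \<omega> = c} = 0"
  shows "AE \<omega> in M. AE s in lborel. 0 \<le> s \<longrightarrow> X s \<omega> \<noteq> c"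
proof -
  interpret L: pair_sigma_finite M lborel ..
  have X2: "(\<lambda>p. X (max 0 (snd p)) (fst p)) \<in> borel_measurable (M \<Otimes>\<^sub>M lborel)"
    by (rule X_pair_measurable') measurable
  note X2[measurable]
  have "AE s in lborel. AE \<omega> in M. 0 \<le> s \<longrightarrow> X (max 0 s) \<omega> \<noteq> c"
    using assms[of c]
  proof eventually_elim
    case (elim s)
    show ?case
    proof (cases "0 \<le> s")
      case True
      have [measurable]: "X s \<in> borel_measurable M" using True by simp
      have "prob {\<omega>\<in>space M. X s \<omega> = c} = 0" using elim True by simp
      then have "AE \<omega> in M. \<not> X s \<omega> = c" by (subst AE_iff_measurable[OF _ refl]) (auto simp: emeasure_eq_measure)
      then show ?thesis using True by (auto simp: max_def elim!: eventually_mono)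
    qed simp
  qed
  then have "AE \<omega> in M. AE s in lborel. 0 \<le> s \<longrightarrow> X (max 0 s) \<omega> \<noteq> c"
    by (subst L.AE_commute) measurable
  then show ?thesis
    by (auto elim!: eventually_mono simp: max_def)
qed

context two_clocks begin

definition grid_K_law where "grid_K_law n = convolution (A.grid_inf_law n) (B.grid_sup_law n)"

lemma rd_grid_K_law: "real_distribution (grid_K_law n)"
  unfolding grid_K_law_def by (intro real_distribution_convolution A.rd_grid_sup_law B.rd_grid_sup_law)

lemma grid_K_law_weak: "weak_conv_m grid_K_law K_law"
proof (rule levy_continuity)
  show "(\<lambda>n. char (grid_K_law n) t) \<longlonglongrightarrow> char K_law t" for t
    unfolding K_law_def grid_K_law_def
    unfolding char_convolution[OF A.rd_laws(2) B.rd_laws(1)] char_convolution[OF A.rd_grid_sup_law(2) B.rd_grid_sup_law(1)]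
    by (intro tendsto_mult A.grid_inf_law_tendsto B.grid_sup_law_tendsto)
qed (auto simp: rd_grid_K_law)

abbreviation "killed b y n \<equiv> step_law.killed_value (A.grid_step n) (A.disc q n) (exp (- (q' - q) * (1 / 2 ^ n))) b y"

lemma disc_mult: "A.disc q n * exp (- (q' - q) * (1 / 2 ^ n)) = A.disc q' n"
  by (simp add: exp_add[symmetric] algebra_simps diff_divide_distrib)

text \<open>
  The dominating function is exp (a (S + 1)) with a the negative part of p = q' - q; it is integrable as
  a < q.  Pathwise convergence fails only if X hits b - x on a set of times of positive measure, or if
  X at the clock equals y - x.
\<close>

lemma
  assumes na: "\<And>c. AE s in lborel. 0 \<le> s \<longrightarrow> A.prob {\<omega>\<in>space M. X s \<omega> = c} = 0"
  shows killed_tendsto: "(\<lambda>n. killed b y n x) \<longlonglongrightarrow> (\<integral>\<omega>. V_integrand (started_at x X) S (q' - q) b y \<omega> \<partial>M)"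
    and V_integrand_integrable: "integrable M (V_integrand (started_at x X) S (q' - q) b y)"
proof -
  define p where "p = q' - q"
  define a where "a = max 0 (- p)"
  have aq: "a < q" using A.r B.r by (auto simp: a_def p_def)
  let ?h = "\<lambda>n. 1 / (2::real) ^ n"
  let ?W = "\<lambda>n \<omega>. killed_payoff (exp (- p * ?h n)) b y (Suc (A.steps (?h n) (S \<omega>))) (A.increments (?h n) \<omega>) x"
  have Wm: "?W n \<in> borel_measurable M" for n
  proof (rule measurable_compose_countable[of "\<lambda>k \<omega>. killed_payoff (exp (- p * ?h n)) b y (Suc k) (A.increments (?h n) \<omega>) x"])
    show "(\<lambda>\<omega>. killed_payoff (exp (- p * ?h n)) b y (Suc k) (A.increments (?h n) \<omega>) x) \<in> borel_measurable M" for k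
      by (rule measurable_compose[OF A.increments_measurable measurable_killed_payoff]) simp
    show "(\<lambda>\<omega>. A.steps (?h n) (S \<omega>)) \<in> M \<rightarrow>\<^sub>M count_space UNIV"
      by (rule measurable_compose[OF A.T_measurable A.steps_measurable])
  qed
  have Weq: "?W n \<omega> = exp (- p * (?h n * (\<Sum>k<nat \<lceil>S \<omega> * 2 ^ n\<rceil>. indicator {..b} (x + X (real k * ?h n) \<omega>))))
     * indicator {y<..} (x + X (grid_up n (S \<omega>)) \<omega>)" if "0 < S \<omega>" "X 0 \<omega> = 0" for n \<omega>
    unfolding killed_payoff_exp A.steps_Suc[OF that(1)] A.sum_increments that(2) grid_up_def by simp
  have dom: "integrable M (\<lambda>\<omega>. exp (a * (S \<omega> + 1)))" by (rule A.exp_clock_integrable[OF aq])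
  have bound: "AE \<omega> in M. norm (?W n \<omega>) \<le> exp (a * (S \<omega> + 1))" for n
    using A.T_pos A.start_zero
  proof eventually_elim
    case (elim \<omega>)
    let ?A = "?h n * (\<Sum>k<nat \<lceil>S \<omega> * 2 ^ n\<rceil>. indicator {..b} (x + X (real k * ?h n) \<omega>))"
    have A0: "0 \<le> ?A" by (intro mult_nonneg_nonneg sum_nonneg) auto
    have "(\<Sum>k<nat \<lceil>S \<omega> * 2 ^ n\<rceil>. indicator {..b} (x + X (real k * ?h n) \<omega>)) \<le> (\<Sum>k<nat \<lceil>S \<omega> * 2 ^ n\<rceil>. 1 :: real)"
      by (intro sum_mono) (auto simp: indicator_def)
    then have "?A \<le> ?h n * real (nat \<lceil>S \<omega> * 2 ^ n\<rceil>)" by (intro mult_left_mono) auto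
    also have "\<dots> = grid_up n (S \<omega>)" by (simp add: grid_up_def)
    also have "\<dots> \<le> S \<omega> + 1"
    proof -
      have "1 / 2 ^ n \<le> (1::real)" by simp
      then show ?thesis using grid_up_bounds(2)[of "S \<omega>" n] elim by linarith
    qed
    finally have A1: "?A \<le> S \<omega> + 1" .
    have "- p * ?A \<le> a * ?A" using A0 by (intro mult_right_mono) (auto simp: a_def)
    also have "\<dots> \<le> a * (S \<omega> + 1)" using A1 by (intro mult_left_mono) (auto simp: a_def)
    finally have "exp (- p * ?A) \<le> exp (a * (S \<omega> + 1))" by simp
    then show ?case unfolding Weq[OF elim] by (auto simp: indicator_def)
  qed
  have lim: "AE \<omega> in M. (\<lambda>n. ?W n \<omega>) \<longlonglongrightarrow> V_integrand (started_at x X) S p b y \<omega>"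
  proof -
    have "AE u in A.end_law S. u \<noteq> y - x"
      using A.end_law_atomless[OF na] by (intro atomless_AE A.rd_laws)
    then have ny: "AE \<omega> in M. X (S \<omega>) \<omega> \<noteq> y - x"
      unfolding A.end_law_def by (rule AE_distrD[OF A.end_measurable])
    show ?thesis
      using A.T_pos A.start_zero A.AE_path_avoids[OF na, of "b - x"] ny AE_space
    proof eventually_elim
      case (elim \<omega>)
      have rc: "continuous (at_right t) (\<lambda>s. x + X s \<omega>)" if "0 \<le> t" for t
        using A.right_continuous[OF elim(5) that] by (intro continuous_intros)
      have o: "(\<lambda>n. ?h n * (\<Sum>k<nat \<lceil>S \<omega> * 2 ^ n\<rceil>. indicator {..b} (x + X (real k * ?h n) \<omega>)))
         \<longlonglongrightarrow> (LINT s:{0..S \<omega>}|lborel. indicator {..b} (x + X s \<omega>) :: real)"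
        using elim(3) by (intro occupation_riemann_sum[of "\<lambda>s. x + X s \<omega>", OF rc elim(1)]) (auto elim!: eventually_mono)
      have e: "(\<lambda>n. indicator {y<..} (x + X (grid_up n (S \<omega>)) \<omega>) :: real) \<longlonglongrightarrow> indicator {y<..} (x + X (S \<omega>) \<omega>)"
        using cadlag_grid_tendsto[of "S \<omega>" "\<lambda>s. x + X s \<omega>"] rc elim(1,4) by (intro indicator_Ioi_tendsto) auto
      show ?case
        unfolding Weq[OF elim(1,2)] V_integrand_def occupation_time_def started_at_def
        by (intro tendsto_mult tendsto_exp tendsto_const o e)
    qed
  qed
  note dc = A.V_integrand_measurable Wm dom lim bound
  show "integrable M (V_integrand (started_at x X) S (q' - q) b y)"
    using integrable_dominated_convergence[OF dc] by (simp add: p_def)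
  have E: "(\<lambda>n. \<integral>\<omega>. ?W n \<omega> \<partial>M) \<longlonglongrightarrow> (\<integral>\<omega>. V_integrand (started_at x X) S p b y \<omega> \<partial>M)"
    using integral_dominated_convergence[OF dc] .
  have "killed b y n x = (1 - A.disc q n) * indicator {y<..} x + A.disc q n * (\<integral>\<omega>. ?W n \<omega> \<partial>M)" for n
  proof -
    have m: "(\<lambda>p'. killed_payoff (exp (- p * ?h n)) b y (Suc (fst p')) (snd p') x) \<in> borel_measurable (count_space UNIV \<Otimes>\<^sub>M seqs)"
      by (intro measurable_nat_seq) (simp only: fst_conv snd_conv measurable_killed_payoff)
    show ?thesis
      using step_law.killed_value_expectation[OF A.step_law_grid_step A.disc_bounds, of "exp (- p * ?h n)" n n b y x]
        A.integral_geo_seq_M[OF _ m, of "?h n"] disc_mult[of n] B.disc_bounds[of n] unfolding p_def fst_conv snd_conv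
      by (simp del: killed_payoff.simps)
  qed
  moreover have "(\<lambda>n. (1 - A.disc q n) * indicator {y<..} x + A.disc q n * (\<integral>\<omega>. ?W n \<omega> \<partial>M)) \<longlonglongrightarrow>
     (1 - 1) * indicator {y<..} x + 1 * (\<integral>\<omega>. V_integrand (started_at x X) S p b y \<omega> \<partial>M)"
    by (intro tendsto_intros disc_tendsto E)
  ultimately show "(\<lambda>n. killed b y n x) \<longlonglongrightarrow> (\<integral>\<omega>. V_integrand (started_at x X) S (q' - q) b y \<omega> \<partial>M)"
    by (simp add: p_def)
qed

lemma conv_op_distr_max:
  assumes "real_distribution m" "g \<in> borel_measurable borel"
  shows "conv_op (distr m borel (max 0)) g u = (\<integral>x. g (u + max 0 x) \<partial>m)"
proof -
  interpret real_distribution m by fact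
  show ?thesis unfolding conv_op_def using assms(2) by (subst integral_distr) auto
qed

lemma conv_op_grid_cross_law_tendsto:
  assumes at: "atomless cross_law" and s: "s \<longlonglongrightarrow> u" and u: "u \<noteq> y"
  shows "(\<lambda>n. conv_op (distr (grid_cross_law n) borel (max 0)) (indicator {y<..}) (s n)) \<longlonglongrightarrow> conv_op (distr cross_law borel (max 0)) (indicator {y<..}) u"
proof -
  have "(\<lambda>n. \<integral>x. indicator {y<..} (s n + max 0 x) \<partial>grid_cross_law n) \<longlonglongrightarrow> (\<integral>x. (indicator {y<..} (u + max 0 x) :: real) \<partial>cross_law)"
  proof (rule weak_conv_extended_mapping[where B=1])
    show "AE x in cross_law. \<forall>r. r \<longlonglongrightarrow> x \<longrightarrow> (\<lambda>n. indicator {y<..} (s n + max 0 (r n)) :: real) \<longlonglongrightarrow> indicator {y<..} (u + max 0 x)"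
      using atomless_AE[OF rd_cross_law(1) at, of "y - u"]
    proof eventually_elim
      case (elim x)
      have "u + max 0 x \<noteq> y" using u elim by (auto simp: max_def)
      then show ?case by (auto intro!: indicator_Ioi_tendsto tendsto_intros s)
    qed
  qed (auto simp: grid_cross_law_weak indicator_def)
  then show ?thesis by (simp add: conv_op_distr_max)
qed

text \<open>
  The limit of killed_walk_formula, divided by the mesh.  The integrands of the skeletons converge
  continuously off the levels b and y, which the limiting law does not charge.
\<close>

theorem killed_value_formula:
  assumes na: "\<And>c. AE s in lborel. 0 \<le> s \<longrightarrow> A.prob {\<omega>\<in>space M. X s \<omega> = c} = 0" and y: "b \<le> y"
  shows "q' * (\<integral>\<omega>. V_integrand (started_at x X) S (q' - q) b y \<omega> \<partial>M) =
    conv_op K_law (\<lambda>u. indicator {b<..} u * (q * indicator {y<..} u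
       + (q' - q) * conv_op (distr cross_law borel (max 0)) (indicator {y<..}) u)) x"
proof -
  define c where "c n = (A.disc q' n / A.disc q n * (1 - A.disc q n)) * 2 ^ n" for n
  define d where "d n = (1 - A.disc q' n / A.disc q n) * 2 ^ n" for n
  define P where "P n = conv_op (distr (grid_cross_law n) borel (max 0)) (indicator {y<..})" for n
  define Q where "Q = conv_op (distr cross_law borel (max 0)) (indicator {y<..})"
  define G where "G n u = indicator {b<..} u * (c n * indicator {y<..} u + d n * P n u)" for n u
  define H where "H u = indicator {b<..} u * (q * indicator {y<..} u + (q' - q) * Q u)" for u
  have c: "c \<longlonglongrightarrow> q" and d: "d \<longlonglongrightarrow> q' - q" unfolding c_def d_def by (rule rates)+
  have at: "atomless cross_law" "atomless K_law" using cross_law_K_law_atomless[OF A.end_law_atomless[OF na]] by auto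
  have "Bseq c" "Bseq d" using c d convergentI convergent_imp_Bseq by blast+
  then obtain C D where "\<forall>n. norm (c n) \<le> C" "\<forall>n. norm (d n) \<le> D" by (meson BseqE)
  then have C: "\<bar>c n\<bar> \<le> C" and D: "\<bar>d n\<bar> \<le> D" for n by auto
  have rP: "real_distribution (distr (grid_cross_law n) borel (max 0))" for n
    by (intro real_distribution_distr_borel rd_cross_law) simp
  have P: "bdd_borel (P n)" and P1: "\<bar>P n u\<bar> \<le> 1" for n u
  proof -
    show "bdd_borel (P n)" unfolding P_def by (intro bdd_borel_intros rP) simp
    interpret R: real_distribution "distr (grid_cross_law n) borel (max 0)" by (rule rP)
    show "\<bar>P n u\<bar> \<le> 1" unfolding P_def conv_op_def real_norm_def[symmetric]
      by (intro norm_integral_prob_le R.prob_space_axioms) (auto simp: indicator_def)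
  qed
  have G: "bdd_borel (G n)" for n unfolding G_def by (intro bdd_borel_intros P) auto
  have H: "bdd_borel H" unfolding H_def Q_def by (intro bdd_borel_intros) auto
  have Gb: "\<bar>G n u\<bar> \<le> C + D" for n u
  proof -
    have "\<bar>c n * indicator {y<..} u\<bar> \<le> C * 1"
      using C[of n] by (intro order_trans[OF eq_refl[OF abs_mult] mult_mono]) (auto simp: indicator_def intro: order_trans[OF abs_ge_zero])
    moreover have "\<bar>d n * P n u\<bar> \<le> D * 1"
      using D[of n] P1[of n u] by (intro order_trans[OF eq_refl[OF abs_mult] mult_mono]) (auto intro: order_trans[OF abs_ge_zero])
    ultimately have "\<bar>c n * indicator {y<..} u + d n * P n u\<bar> \<le> C + D" by linarith
    moreover have "0 \<le> C + D" using C[of n] D[of n] by linarith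
    ultimately show ?thesis unfolding G_def by (auto simp: indicator_def)
  qed
  have eq: "((1 - A.disc q' n) * 2 ^ n) * killed b y n x = (\<integral>u. G n (x + u) \<partial>grid_K_law n)" for n
  proof -
    let ?z = "A.disc q n" and ?w = "A.disc q' n" and ?v = "exp (- (q' - q) * (1 / 2 ^ n))"
    have v: "0 < ?v" "?z * ?v < 1" using disc_mult[of n] B.disc_bounds[of n] by auto
    note kv = step_law.killed_value_eq[OF A.step_law_grid_step A.disc_bounds v, unfolded disc_mult]
      step_law.bdd_borel_killed_value[OF A.step_law_grid_step A.disc_bounds v]
    have "(1 - ?w) * killed b y n x = conv_op (A.grid_inf_law n) (conv_op (B.grid_sup_law n)
      (\<lambda>u. indicator {b<..} u * ((?w / ?z * (1 - ?z)) * indicator {y<..} u + (1 - ?w / ?z) * P n u))) x"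
      unfolding P_def grid_cross_law_def
      by (rule step_law.killed_walk_formula[OF A.step_law_grid_step A.disc_bounds B.disc_bounds y kv(2) kv(1)])
    also have "\<dots> = conv_op (grid_K_law n) (\<lambda>u. indicator {b<..} u * ((?w / ?z * (1 - ?z)) * indicator {y<..} u + (1 - ?w / ?z) * P n u)) x"
    proof -
      have "bdd_borel (\<lambda>u. indicator {b<..} u * ((?w / ?z * (1 - ?z)) * indicator {y<..} u + (1 - ?w / ?z) * P n u))"
        by (intro bdd_borel_intros P) auto
      then show ?thesis unfolding grid_K_law_def by (simp only: conv_op_convolution(1)[OF A.rd_grid_sup_law(2) B.rd_grid_sup_law(1)])
    qed
    finally have "2 ^ n * ((1 - ?w) * killed b y n x) =
      conv_op (grid_K_law n) (\<lambda>u. 2 ^ n * (indicator {b<..} u * ((?w / ?z * (1 - ?z)) * indicator {y<..} u + (1 - ?w / ?z) * P n u))) x"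
      unfolding conv_op_scale by simp
    also have "(\<lambda>u. 2 ^ n * (indicator {b<..} u * ((?w / ?z * (1 - ?z)) * indicator {y<..} u + (1 - ?w / ?z) * P n u))) = G n"
      by (simp add: fun_eq_iff G_def c_def d_def algebra_simps)
    finally show ?thesis by (simp add: conv_op_def mult.assoc mult.left_commute)
  qed
  have "(\<lambda>n. \<integral>u. G n (x + u) \<partial>grid_K_law n) \<longlonglongrightarrow> (\<integral>u. H (x + u) \<partial>K_law)"
  proof (rule weak_conv_extended_mapping[where B="C + D", OF rd_grid_K_law _ grid_K_law_weak])
    show "(\<lambda>u. G n (x + u)) \<in> borel_measurable borel" for n using bdd_borel_shift[OF G] by (auto simp: bdd_borel_def)
    show "(\<lambda>u. H (x + u)) \<in> borel_measurable borel" using bdd_borel_shift[OF H] by (auto simp: bdd_borel_def)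
    show "AE u in K_law. \<forall>s. s \<longlonglongrightarrow> u \<longrightarrow> (\<lambda>n. G n (x + s n)) \<longlonglongrightarrow> H (x + u)"
      using atomless_AE[OF rd_laws(6) at(2), of "b - x"] atomless_AE[OF rd_laws(6) at(2), of "y - x"]
    proof eventually_elim
      case (elim u)
      show ?case
      proof (intro allI impI)
        fix s assume "s \<longlonglongrightarrow> u"
        then have s: "(\<lambda>n. x + s n) \<longlonglongrightarrow> x + u" by (intro tendsto_intros)
        have n: "x + u \<noteq> b" "x + u \<noteq> y" using elim by auto
        show "(\<lambda>n. G n (x + s n)) \<longlonglongrightarrow> H (x + u)"
          unfolding G_def H_def P_def Q_def
          by (intro tendsto_mult tendsto_add c d indicator_Ioi_tendsto[OF s] n conv_op_grid_cross_law_tendsto at s)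
      qed
    qed
  qed (auto simp: Gb)
  moreover have "(\<lambda>n. \<integral>u. G n (x + u) \<partial>grid_K_law n) \<longlonglongrightarrow> q' * (\<integral>\<omega>. V_integrand (started_at x X) S (q' - q) b y \<omega> \<partial>M)"
    unfolding eq[symmetric] by (intro tendsto_mult rates killed_tendsto[OF na])
  ultimately have "q' * (\<integral>\<omega>. V_integrand (started_at x X) S (q' - q) b y \<omega> \<partial>M) = (\<integral>u. H (x + u) \<partial>K_law)"
    using LIMSEQ_unique by blast
  then show ?thesis by (simp add: conv_op_def H_def Q_def)
qed

end

section \<open>Uniqueness of Laplace transforms\<close>

text \<open>
  In the variable u = exp (-x) the transforms at the positive integers are the moments of a signed measure
  on [0, 1]; by the Weierstrass theorem it annihilates all continuous functions, among them a tent
  supported where F would be positive.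
\<close>

lemma laplace_zero_imp_nonpos:
  fixes F :: "real \<Rightarrow> real"
  assumes cont: "continuous_on {0<..} F"
    and int: "\<And>s. 0 < s \<Longrightarrow> set_integrable lborel {0<..} (\<lambda>x. exp (- s * x) * F x)"
    and zero: "\<And>s. 0 < s \<Longrightarrow> (LINT x:{0<..}|lborel. exp (- s * x) * F x) = 0"
    and x0: "0 < x0"
  shows "F x0 \<le> 0"
proof (rule ccontr)
  assume "\<not> F x0 \<le> 0"
  then have Fx0: "0 < F x0" by simp
  define g where "g x = indicator {0<..} x * (exp (- x) * F x)" for x
  have g: "integrable lborel g"
    using int[of 1] unfolding set_integrable_def g_def by simp
  have mom: "integrable lborel (\<lambda>x. g x * exp (- x) ^ n)" "(\<integral>x. g x * exp (- x) ^ n \<partial>lborel) = 0" for n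
  proof -
    have eq: "(\<lambda>x. g x * exp (- x) ^ n) = (\<lambda>x. indicator {0<..} x *\<^sub>R (exp (- real (Suc n) * x) * F x))"
    proof
      fix x :: real
      have "exp (- x) * exp (- x) ^ n = exp (- real (Suc n) * x)"
        by (simp add: exp_of_nat_mult[symmetric] mult_exp_exp algebra_simps)
      then show "g x * exp (- x) ^ n = indicator {0<..} x *\<^sub>R (exp (- real (Suc n) * x) * F x)"
        by (simp add: g_def mult.assoc mult.left_commute del: of_nat_Suc)
    qed
    show "integrable lborel (\<lambda>x. g x * exp (- x) ^ n)" "(\<integral>x. g x * exp (- x) ^ n \<partial>lborel) = 0"
      unfolding eq using int[of "real (Suc n)"] zero[of "real (Suc n)"]
      by (simp_all add: set_integrable_def set_lebesgue_integral_def del: of_nat_Suc)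
  qed
  have cts: "(\<integral>x. g x * \<phi> (exp (- x)) \<partial>lborel) = 0" if \<phi>: "continuous_on UNIV \<phi>" for \<phi> :: "real \<Rightarrow> real"
  proof -
    have \<phi>m: "\<phi> \<in> borel_measurable borel" using \<phi> by (rule borel_measurable_continuous_onI)
    have gm: "g \<in> borel_measurable lborel" using g by auto
    have fm: "(\<lambda>x. \<phi> (exp (- x))) \<in> borel_measurable lborel"
      by (rule measurable_compose[OF _ \<phi>m]) simp
    have "\<bar>\<integral>x. g x * \<phi> (exp (- x)) \<partial>lborel\<bar> \<le> \<epsilon> * (\<integral>x. \<bar>g x\<bar> \<partial>lborel)" if \<epsilon>: "0 < \<epsilon>" for \<epsilon>
    proof -
      obtain P where "real_polynomial_function P" and P: "\<And>u. u \<in> {0..1} \<Longrightarrow> \<bar>\<phi> u - P u\<bar> < \<epsilon>"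
        using Stone_Weierstrass_real_polynomial_function[of "{0..1}" \<phi> \<epsilon>] \<epsilon> continuous_on_subset[OF \<phi>] by auto
      then obtain a N where Pa: "P = (\<lambda>u. \<Sum>i\<le>N. a i * u ^ i)"
        unfolding real_polynomial_function_iff_sum by blast
      have Pm: "(\<lambda>x. g x * P (exp (- x))) = (\<lambda>x. \<Sum>i\<le>N. a i * (g x * exp (- x) ^ i))"
        by (auto simp: Pa sum_distrib_left fun_eq_iff intro!: sum.cong)
      have Pi: "integrable lborel (\<lambda>x. g x * P (exp (- x)))" "(\<integral>x. g x * P (exp (- x)) \<partial>lborel) = 0"
        unfolding Pm using mom by (auto intro!: Bochner_Integration.integrable_sum)
      have b: "\<bar>g x * (\<phi> (exp (- x)) - P (exp (- x)))\<bar> \<le> \<epsilon> * \<bar>g x\<bar>" for x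
      proof (cases "0 < x")
        case True
        then have "\<bar>\<phi> (exp (- x)) - P (exp (- x))\<bar> \<le> \<epsilon>" using P[of "exp (- x)"] by auto
        then show ?thesis unfolding abs_mult mult.commute[of \<epsilon>] by (intro mult_left_mono) auto
      qed (simp add: g_def)
      have Pmm: "(\<lambda>x. P (exp (- x))) \<in> borel_measurable lborel" unfolding Pa by measurable
      have di: "integrable lborel (\<lambda>x. g x * (\<phi> (exp (- x)) - P (exp (- x))))"
      proof (rule Bochner_Integration.integrable_bound)
        show "integrable lborel (\<lambda>x. \<epsilon> * \<bar>g x\<bar>)" using g by (intro integrable_mult_right integrable_abs)
        show "(\<lambda>x. g x * (\<phi> (exp (- x)) - P (exp (- x)))) \<in> borel_measurable lborel"
          by (intro borel_measurable_times borel_measurable_diff gm fm Pmm)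
      qed (use b \<epsilon> in \<open>auto simp: abs_mult\<close>)
      have "(\<integral>x. g x * \<phi> (exp (- x)) \<partial>lborel) = (\<integral>x. g x * (\<phi> (exp (- x)) - P (exp (- x))) + g x * P (exp (- x)) \<partial>lborel)"
        by (simp add: algebra_simps)
      also have "\<dots> = (\<integral>x. g x * (\<phi> (exp (- x)) - P (exp (- x))) \<partial>lborel)"
        by (subst Bochner_Integration.integral_add[OF di Pi(1)]) (simp add: Pi(2))
      also have "\<bar>\<dots>\<bar> \<le> (\<integral>x. \<bar>g x * (\<phi> (exp (- x)) - P (exp (- x)))\<bar> \<partial>lborel)"
        by (rule integral_abs_bound)
      also have "\<dots> \<le> (\<integral>x. \<epsilon> * \<bar>g x\<bar> \<partial>lborel)"
        using g di b by (intro integral_mono integrable_abs integrable_mult_right) auto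
      finally show ?thesis by simp
    qed
    note le = this
    have "\<bar>\<integral>x. g x * \<phi> (exp (- x)) \<partial>lborel\<bar> \<le> 0"
    proof (rule field_le_epsilon)
      fix \<epsilon> :: real assume \<epsilon>: "0 < \<epsilon>"
      let ?G = "\<integral>x. \<bar>g x\<bar> \<partial>lborel"
      have G: "0 \<le> ?G" "0 < ?G + 1"
        using Bochner_Integration.integral_nonneg[of lborel "\<lambda>x. \<bar>g x\<bar>"] by linarith+
      have "\<bar>\<integral>x. g x * \<phi> (exp (- x)) \<partial>lborel\<bar> \<le> \<epsilon> / (?G + 1) * ?G" using \<epsilon> G by (intro le divide_pos_pos)
      also have "\<dots> \<le> \<epsilon>" using \<epsilon> G by (simp add: field_simps)
      finally show "\<bar>\<integral>x. g x * \<phi> (exp (- x)) \<partial>lborel\<bar> \<le> 0 + \<epsilon>" by simp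
    qed
    then show ?thesis by simp
  qed
  have "isCont F x0" using cont x0 by (simp add: continuous_on_eq_continuous_at)
  then have "eventually (\<lambda>x. 0 < F x) (at x0)"
    using Fx0 by (intro order_tendstoD) (auto simp: isCont_def)
  then obtain \<delta>' where \<delta>': "0 < \<delta>'" "\<And>x. x \<noteq> x0 \<Longrightarrow> dist x x0 < \<delta>' \<Longrightarrow> 0 < F x"
    unfolding eventually_at by auto
  define \<delta> where "\<delta> = min \<delta>' x0"
  have \<delta>: "0 < \<delta>" "\<delta> \<le> x0" using \<delta>'(1) x0 by (auto simp: \<delta>_def)
  have Fpos: "0 < F x" if "\<bar>x - x0\<bar> < \<delta>" for x
    using that \<delta>'(2)[of x] Fx0 by (cases "x = x0") (auto simp: \<delta>_def dist_real_def)
  define u0 where "u0 = exp (- x0)"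
  (* If exp (-x) is within r of u0, then x is within \<delta> of x0. *)
  define r where "r = min (u0 - exp (- (x0 + \<delta>))) (exp (- (x0 - \<delta>)) - u0)"
  have r: "0 < r" using \<delta> by (auto simp: r_def u0_def)
  define \<phi> where "\<phi> u = max 0 (r - \<bar>u - u0\<bar>)" for u
  have near: "\<bar>x - x0\<bar> < \<delta>" if "\<bar>exp (- x) - u0\<bar> < r" for x
  proof -
    have "\<bar>exp (- x) - u0\<bar> < u0 - exp (- (x0 + \<delta>))" "\<bar>exp (- x) - u0\<bar> < exp (- (x0 - \<delta>)) - u0"
      using that unfolding r_def min_less_iff_conj by blast+
    then have "exp (- (x0 + \<delta>)) < exp (- x)" "exp (- x) < exp (- (x0 - \<delta>))" by linarith+
    then show ?thesis by auto
  qed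
  have nn: "0 \<le> g x * \<phi> (exp (- x))" for x
  proof (cases "\<bar>exp (- x) - u0\<bar> < r")
    case True
    then show ?thesis using Fpos[OF near[OF True]] by (auto simp: g_def \<phi>_def indicator_def)
  qed (simp add: \<phi>_def)
  have pos: "0 < g x * \<phi> (exp (- x))" if "\<bar>exp (- x) - u0\<bar> < r" for x
    using Fpos[OF near[OF that]] near[OF that] \<delta> that by (auto simp: g_def \<phi>_def indicator_def)
  have "continuous_on UNIV \<phi>" unfolding \<phi>_def by (intro continuous_intros)
  from cts[OF this] have z: "(\<integral>x. g x * \<phi> (exp (- x)) \<partial>lborel) = 0" .
  have "integrable lborel (\<lambda>x. g x * \<phi> (exp (- x)))"
  proof (rule Bochner_Integration.integrable_bound)
    show "integrable lborel (\<lambda>x. r * g x)" using g by (intro integrable_mult_right)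
    show "(\<lambda>x. g x * \<phi> (exp (- x))) \<in> borel_measurable lborel"
      using g unfolding \<phi>_def by (intro borel_measurable_times) auto
    have "0 \<le> \<phi> u" "\<phi> u \<le> r" for u using r by (auto simp: \<phi>_def)
    then show "AE x in lborel. norm (g x * \<phi> (exp (- x))) \<le> norm (r * g x)"
      using r by (intro AE_I2) (simp add: abs_mult mult.commute[of r] mult_left_mono)
  qed
  then have ae: "AE x in lborel. g x * \<phi> (exp (- x)) = 0"
    using z nn by (subst (asm) integral_nonneg_eq_0_iff_AE) auto
  have "continuous (at x0) (\<lambda>x. exp (- x))" by (intro continuous_intros)
  then have "eventually (\<lambda>x. dist (exp (- x)) u0 < r) (at x0)"
    using r unfolding u0_def continuous_at by (intro tendstoD)
  then obtain \<eta> where \<eta>: "0 < \<eta>" "\<And>x. x \<noteq> x0 \<Longrightarrow> dist x x0 < \<eta> \<Longrightarrow> dist (exp (- x)) u0 < r"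
    unfolding eventually_at by auto
  have "AE x in lborel. x \<notin> {x0<..<x0 + \<eta>}"
    using ae
  proof eventually_elim
    case (elim x)
    show ?case
    proof
      assume "x \<in> {x0<..<x0 + \<eta>}"
      then have "\<bar>exp (- x) - u0\<bar> < r" using \<eta>(2)[of x] by (auto simp: dist_real_def)
      from pos[OF this] show False using elim by simp
    qed
  qed
  then have "emeasure lborel {x0<..<x0 + \<eta>} = 0"
    by (subst (asm) AE_iff_measurable[of "{x0<..<x0 + \<eta>}"]) auto
  then show False using \<eta> by simp
qed

theorem laplace_transform_unique:
  fixes F G :: "real \<Rightarrow> real"
  assumes "continuous_on {0<..} F" "continuous_on {0<..} G"
    and F: "\<And>s. 0 < s \<Longrightarrow> set_integrable lborel {0<..} (\<lambda>x. exp (- s * x) * F x)"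
    and G: "\<And>s. 0 < s \<Longrightarrow> set_integrable lborel {0<..} (\<lambda>x. exp (- s * x) * G x)"
    and eq: "\<And>s. 0 < s \<Longrightarrow> (LINT x:{0<..}|lborel. exp (- s * x) * F x) = (LINT x:{0<..}|lborel. exp (- s * x) * G x)"
    and x: "0 < x"
  shows "F x = G x"
proof -
  have *: "H x - H' x \<le> 0" if "continuous_on {0<..} H" "continuous_on {0<..} H'"
    "\<And>s. 0 < s \<Longrightarrow> set_integrable lborel {0<..} (\<lambda>x. exp (- s * x) * H x)"
    "\<And>s. 0 < s \<Longrightarrow> set_integrable lborel {0<..} (\<lambda>x. exp (- s * x) * H' x)"
    "\<And>s. 0 < s \<Longrightarrow> (LINT x:{0<..}|lborel. exp (- s * x) * H x) = (LINT x:{0<..}|lborel. exp (- s * x) * H' x)"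
    for H H' :: "real \<Rightarrow> real"
  proof (rule laplace_zero_imp_nonpos[OF _ _ _ x, where F="\<lambda>x. H x - H' x"])
    show "continuous_on {0<..} (\<lambda>x. H x - H' x)" using that by (intro continuous_intros)
    fix s :: real assume s: "0 < s"
    have eq: "(\<lambda>x. exp (- s * x) * (H x - H' x)) = (\<lambda>x. exp (- s * x) * H x - exp (- s * x) * H' x)"
      by (simp add: algebra_simps)
    show "set_integrable lborel {0<..} (\<lambda>x. exp (- s * x) * (H x - H' x))"
      unfolding eq using that(3,4)[OF s] by (rule set_integral_diff(1))
    show "(LINT x:{0<..}|lborel. exp (- s * x) * (H x - H' x)) = 0"
      unfolding eq using set_integral_diff(2)[OF that(3)[OF s] that(4)[OF s]] that(5)[OF s] by simp
  qed
  show ?thesis using *[of F G] *[of G F] assms by force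
qed

section \<open>The functions F1 and K\<close>

lemma integral_exp_tail:
  fixes m :: "real measure"
  assumes m: "real_distribution m" and s: "0 < s"
  shows "set_integrable lborel {0<..} (\<lambda>x. exp (- s * x) * measure m {x<..})"
    and "(LINT x:{0<..}|lborel. exp (- s * x) * measure m {x<..}) = (1 - (\<integral>z. exp (- s * max 0 z) \<partial>m)) / s"
proof -
  interpret m: real_distribution m by fact
  interpret P: pair_sigma_finite m lborel ..
  let ?f = "\<lambda>z x. indicator {0<..<z} x * exp (- s * x) :: real"
  have inner: "has_bochner_integral lborel (?f z) ((1 - exp (- s * max 0 z)) / s)" for z
  proof (cases "0 < z")
    case True
    have "has_bochner_integral lborel (\<lambda>x. exp (- s * x) * indicator {0..z} x) (- exp (- s * z) / s - - exp (- s * 0) / s)"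
      using True s
      by (intro has_bochner_integral_FTC_Icc_real[where F="\<lambda>x. - exp (- s * x) / s"]) (auto intro!: derivative_eq_intros continuous_intros)
    also have "has_bochner_integral lborel (\<lambda>x. exp (- s * x) * indicator {0..z} x) (- exp (- s * z) / s - - exp (- s * 0) / s) \<longleftrightarrow>
      has_bochner_integral lborel (?f z) (- exp (- s * z) / s - - exp (- s * 0) / s)"
    proof (rule has_bochner_integral_cong_AE)
      have "AE x in lborel. x \<noteq> 0" "AE x in lborel. x \<noteq> z" by (rule AE_lborel_singleton)+
      then show "AE x in lborel. exp (- s * x) * indicator {0..z} x = ?f z x"
        by eventually_elim (auto simp: indicator_def)
    qed measurable
    finally show ?thesis using True by (simp add: max_def diff_divide_distrib)
  next
    case False
    then show ?thesis by (simp add: max_def has_bochner_integral_zero)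
  qed
  have meas: "(\<lambda>p. ?f (fst p) (snd p)) \<in> borel_measurable (m \<Otimes>\<^sub>M lborel)"
  proof -
    have "(\<lambda>p. ?f (fst p) (snd p)) = (\<lambda>p. (if 0 < snd p \<and> snd p < fst p then 1 else 0) * exp (- s * snd p))"
      by (auto simp: fun_eq_iff)
    also have "\<dots> \<in> borel_measurable (m \<Otimes>\<^sub>M lborel)" by measurable
    finally show ?thesis .
  qed
  have nz: "norm (?f z x) = ?f z x" for z x by simp
  have em: "(\<lambda>z. exp (- s * max 0 z)) \<in> borel_measurable borel" by measurable
  have ei: "integrable m (\<lambda>z. exp (- s * max 0 z))"
    using s by (intro m.integrable_const_bound[where B=1]) auto
  have int: "integrable (m \<Otimes>\<^sub>M lborel) (\<lambda>p. ?f (fst p) (snd p))"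
  proof (rule P.Fubini_integrable[OF meas])
    have "(\<integral>x. norm (?f z x) \<partial>lborel) = (1 - exp (- s * max 0 z)) / s" for z
      unfolding nz by (rule has_bochner_integral_integral_eq[OF inner])
    then show "integrable m (\<lambda>z. \<integral>x. norm (?f (fst (z, x)) (snd (z, x))) \<partial>lborel)"
      using ei by simp
    show "AE z in m. integrable lborel (\<lambda>x. ?f (fst (z, x)) (snd (z, x)))"
      using inner by (auto simp: has_bochner_integral_iff)
  qed
  have outer: "(\<integral>z. ?f z x \<partial>m) = indicator {0<..} x * (exp (- s * x) * measure m {x<..})" for x
  proof -
    have "(\<integral>z. ?f z x \<partial>m) = (\<integral>z. (indicator {0<..} x * exp (- s * x)) * indicator {x<..} z \<partial>m)"
      by (intro Bochner_Integration.integral_cong) (auto simp: indicator_def)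
    then show ?thesis by simp
  qed
  have int': "integrable (m \<Otimes>\<^sub>M lborel) (\<lambda>(z, x). ?f z x)" using int by (simp add: split_beta')
  have "integrable lborel (\<lambda>x. \<integral>z. ?f z x \<partial>m)" by (rule P.integrable_snd[OF int'])
  then show "set_integrable lborel {0<..} (\<lambda>x. exp (- s * x) * measure m {x<..})"
    unfolding outer set_integrable_def by simp
  have "(LINT x:{0<..}|lborel. exp (- s * x) * measure m {x<..}) = (\<integral>x. \<integral>z. ?f z x \<partial>m \<partial>lborel)"
    unfolding outer set_lebesgue_integral_def by simp
  also have "\<dots> = (\<integral>z. \<integral>x. ?f z x \<partial>lborel \<partial>m)" by (rule P.Fubini_integral[OF int'])
  also have "\<dots> = (\<integral>z. (1 - exp (- s * max 0 z)) / s \<partial>m)"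
    by (simp only: has_bochner_integral_integral_eq[OF inner])
  also have "\<dots> = (1 - (\<integral>z. exp (- s * max 0 z) \<partial>m)) / s"
    using ei by (simp add: m.prob_space[simplified])
  finally show "(LINT x:{0<..}|lborel. exp (- s * x) * measure m {x<..}) = (1 - (\<integral>z. exp (- s * max 0 z) \<partial>m)) / s" .
qed

lemma walk_max_nonneg: "0 \<le> walk (max 0) n \<xi>" and walk_min_nonpos: "walk (min 0) n \<xi> \<le> 0"
  by (cases n; simp)+

context levy_clock begin

lemma sup_nonneg: "AE \<omega> in M. 0 \<le> running_sup X (T \<omega>) \<omega>"
  using start_zero AE_space
proof eventually_elim
  case (elim \<omega>)
  show ?case
    using grid_sup[OF elim(2) T_nonneg[OF elim(2)]] elim(1) walk_max_nonneg by (intro LIMSEQ_le_const) auto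
qed

lemma inf_nonpos: "AE \<omega> in M. running_inf X (T \<omega>) \<omega> \<le> 0"
  using start_zero AE_space
proof eventually_elim
  case (elim \<omega>)
  show ?case
    using grid_inf[OF elim(2) T_nonneg[OF elim(2)]] elim(1) walk_min_nonpos by (intro LIMSEQ_le_const2) auto
qed

lemma AE_sup_law: "AE x in sup_law T. 0 \<le> x"
  unfolding sup_law_def using sup_nonneg sup_measurable by (subst AE_distr_iff) auto

lemma AE_inf_law: "AE x in inf_law T. x \<le> 0"
  unfolding inf_law_def using inf_nonpos inf_measurable by (subst AE_distr_iff) auto

lemma laplace_sup_law: "(LINT \<omega>|M. exp (- s * running_sup X (T \<omega>) \<omega>)) = (\<integral>x. exp (- s * max 0 x) \<partial>sup_law T)"
proof -
  have "(\<integral>x. exp (- s * max 0 x) \<partial>sup_law T) = (\<integral>\<omega>. exp (- s * max 0 (running_sup X (T \<omega>) \<omega>)) \<partial>M)"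
    unfolding sup_law_def by (rule integral_distr[OF sup_measurable]) measurable
  also have "\<dots> = (LINT \<omega>|M. exp (- s * running_sup X (T \<omega>) \<omega>))"
  proof (rule integral_cong_AE)
    note sup_measurable[measurable]
    show "(\<lambda>\<omega>. exp (- s * max 0 (running_sup X (T \<omega>) \<omega>))) \<in> borel_measurable M" by measurable
    show "(\<lambda>\<omega>. exp (- s * running_sup X (T \<omega>) \<omega>)) \<in> borel_measurable M" by measurable
    show "AE \<omega> in M. exp (- s * max 0 (running_sup X (T \<omega>) \<omega>)) = exp (- s * running_sup X (T \<omega>) \<omega>)"
      using sup_nonneg by eventually_elim simp
  qed
  finally show ?thesis ..
qed

end

context two_clocks begin

text \<open>
  Evaluates sup_law_relation at the exponential function, which is multiplicative on [0, \<infinity>).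
\<close>

lemma laplace_ratio:
  assumes s: "0 < s"
  defines "A \<equiv> \<integral>x. exp (- s * max 0 x) \<partial>A.sup_law S" and "B \<equiv> \<integral>x. exp (- s * max 0 x) \<partial>A.sup_law T"
    and "C \<equiv> \<integral>x. exp (- s * max 0 x) \<partial>cross_law"
  shows "A / B - 1 = (q' - q) / q' * (C - 1)"
proof -
  define g where "g = (\<lambda>u::real. exp (- s * max 0 u))"
  have g: "bdd_borel g"
    using s by (intro bdd_borelI[where B=1]) (auto simp: g_def)
  have gm: "g \<in> borel_measurable borel" using g by (auto simp: bdd_borel_def)
  let ?P = "distr cross_law borel (max 0)"
  interpret R: real_distribution "A.sup_law T" by simp
  have "conv_op (A.sup_law T) (conv_op ?P g) 0 = (\<integral>a. g a * C \<partial>A.sup_law T)"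
  proof -
    have "conv_op ?P g a = g a * C" if "0 \<le> a" for a
    proof -
      have "conv_op ?P g a = (\<integral>x. g (a + max 0 x) \<partial>cross_law)" by (rule conv_op_distr_max[OF rd_cross_law(1) gm])
      also have "\<dots> = (\<integral>x. g a * exp (- s * max 0 x) \<partial>cross_law)"
        using that by (intro Bochner_Integration.integral_cong) (auto simp: g_def exp_add[symmetric] algebra_simps)
      finally show ?thesis by (simp add: C_def)
    qed
    then have ae: "AE a in A.sup_law T. conv_op ?P g a = g a * C" using B.AE_sup_law by (auto elim!: eventually_mono)
    have "conv_op ?P g \<in> borel_measurable borel" using bdd_borel_conv_op[OF rd_cross_law_clamp(1) g] by (auto simp: bdd_borel_def)
    then show ?thesis unfolding conv_op_def[of "A.sup_law T"] using ae gm
      by (intro integral_cong_AE) auto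
  qed
  also have "\<dots> = B * C" by (simp add: B_def g_def)
  finally have "q' * A = q * B + (q' - q) * (B * C)"
    using conv_op_sup_law_relation[OF g, of 0] by (simp add: conv_op_def A_def B_def g_def)
  moreover have "B > 0"
  proof -
    have "integrable (A.sup_law T) g" by (rule bdd_borel_integrable[OF _ g]) simp
    moreover have "B = (\<integral>x. g x \<partial>A.sup_law T)" by (simp add: B_def g_def)
    moreover have "0 < (\<integral>x. g x \<partial>A.sup_law T)"
    proof (rule ccontr)
      assume "\<not> ?thesis"
      moreover have "0 \<le> (\<integral>x. g x \<partial>A.sup_law T)" by (simp add: g_def)
      ultimately have "(\<integral>x. g x \<partial>A.sup_law T) = 0" by simp
      then have "AE x in A.sup_law T. g x = 0"
        using \<open>integrable (A.sup_law T) g\<close> by (subst (asm) integral_nonneg_eq_0_iff_AE) (auto simp: g_def)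
      then have "AE x in A.sup_law T. False" by (simp add: g_def)
      then show False by simp
    qed
    ultimately show ?thesis by simp
  qed
  moreover have "0 < q'" by (rule B.r)
  ultimately show ?thesis by (simp add: field_simps)
qed

text \<open>
  A multiple of the tail of Z, decreasing in absolute value; laplace_ratio singles it out.
\<close>

definition F1_formula where "F1_formula x = - ((q' - q) / q') * measure cross_law {x<..}"

lemma F1_formula_continuous:
  assumes "atomless cross_law" shows "continuous_on U F1_formula"
proof -
  interpret R: real_distribution cross_law by simp
  have c: "measure cross_law {x<..} = 1 - cdf cross_law x" for x
    using R.prob_compl[of "{..x}"] by (simp add: cdf_def Compl_eq_Diff_UNIV[symmetric])
  have "isCont (\<lambda>x. - ((q' - q) / q') * (1 - cdf cross_law x)) x" for x
    using assms by (intro continuous_intros) (simp add: R.isCont_cdf atomless_def)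
  then show ?thesis unfolding F1_formula_def[abs_def] c by (intro continuous_at_imp_continuous_on) auto
qed

lemma F1_formula_laplace:
  assumes s: "0 < s"
  shows "set_integrable lborel {0<..} (\<lambda>x. exp (- s * x) * F1_formula x)"
    and "(LINT x:{0<..}|lborel. exp (- s * x) * F1_formula x) =
      (1 / s) * ((LINT \<omega>|M. exp (- s * running_sup X (S \<omega>) \<omega>)) / (LINT \<omega>|M. exp (- s * running_sup X (T \<omega>) \<omega>)) - 1)"
proof -
  have eq: "(\<lambda>x. exp (- s * x) * F1_formula x) = (\<lambda>x. - ((q' - q) / q') * (exp (- s * x) * measure cross_law {x<..}))"
    by (simp add: F1_formula_def fun_eq_iff)
  note t = integral_exp_tail[OF rd_cross_law(1) s]
  show "set_integrable lborel {0<..} (\<lambda>x. exp (- s * x) * F1_formula x)"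
    unfolding eq using t(1) by (intro set_integrable_mult_right) auto
  have "(LINT x:{0<..}|lborel. exp (- s * x) * F1_formula x) = - ((q' - q) / q') * ((1 - (\<integral>z. exp (- s * max 0 z) \<partial>cross_law)) / s)"
    unfolding eq set_integral_mult_right t(2) ..
  also have "\<dots> = 1 / s * ((q' - q) / q' * ((\<integral>z. exp (- s * max 0 z) \<partial>cross_law) - 1))"
    using s B.r by (simp add: field_simps)
  also have "\<dots> = (1 / s) * ((LINT \<omega>|M. exp (- s * running_sup X (S \<omega>) \<omega>)) / (LINT \<omega>|M. exp (- s * running_sup X (T \<omega>) \<omega>)) - 1)"
    unfolding A.laplace_sup_law B.laplace_sup_law laplace_ratio[OF s] ..
  finally show "(LINT x:{0<..}|lborel. exp (- s * x) * F1_formula x) =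
      (1 / s) * ((LINT \<omega>|M. exp (- s * running_sup X (S \<omega>) \<omega>)) / (LINT \<omega>|M. exp (- s * running_sup X (T \<omega>) \<omega>)) - 1)" .
qed

text \<open>
  The clamp is invisible below y: from u < y only a positive shift can exceed y.
\<close>

lemma conv_op_clamp_tail:
  assumes "u < y"
  shows "conv_op (distr cross_law borel (max 0)) (indicator {y<..}) u = measure cross_law {y - u<..}"
proof -
  interpret R: real_distribution cross_law by simp
  have "conv_op (distr cross_law borel (max 0)) (indicator {y<..}) u = (\<integral>x. indicator {y<..} (u + max 0 x) \<partial>cross_law)"
    by (rule conv_op_distr_max) auto
  also have "\<dots> = (\<integral>x. indicator {y - u<..} x \<partial>cross_law)"
    using assms by (intro Bochner_Integration.integral_cong) (auto simp: indicator_def max_def)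
  finally show ?thesis by simp
qed

text \<open>
  Both quantities are the average of one function H over the law of I + S, except that for the first one
  H is cut off at and below b.  There H is q' times -F1_formula at y minus the argument.
\<close>

theorem value_difference:
  assumes na: "\<And>c. AE s in lborel. 0 \<le> s \<longrightarrow> A.prob {\<omega>\<in>space M. X s \<omega> = c} = 0" and y: "b \<le> y"
  shows "(\<integral>\<omega>. V_integrand (started_at x X) S (q' - q) b y \<omega> \<partial>M) - A.prob {\<omega>\<in>space M. y < x + X (S \<omega>) \<omega>} =
    (\<integral>u. indicator {..<b - x} u * F1_formula (y - x - u) \<partial>K_law)"
proof -
  let ?f = "indicator {y<..} :: real \<Rightarrow> real" and ?Q = "conv_op (distr cross_law borel (max 0)) (indicator {y<..})"
  have bf: "bdd_borel ?f" by (rule bdd_borel_indicator) simp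
  have bQ: "bdd_borel ?Q" by (intro bdd_borel_conv_op bf) simp
  have at: "atomless K_law" using cross_law_K_law_atomless[OF A.end_law_atomless[OF na]] by simp
  have P: "A.prob {\<omega>\<in>space M. y < x + X (S \<omega>) \<omega>} = conv_op (A.end_law S) ?f x"
  proof -
    have "conv_op (A.end_law S) ?f x = (\<integral>\<omega>. ?f (x + X (S \<omega>) \<omega>) \<partial>M)"
      unfolding conv_op_def A.end_law_def by (rule integral_distr[OF A.end_measurable]) simp
    also have "\<dots> = (\<integral>\<omega>. indicator {\<omega>\<in>space M. y < x + X (S \<omega>) \<omega>} \<omega> \<partial>M)"
      by (intro Bochner_Integration.integral_cong) (auto simp: indicator_def)
    finally show ?thesis using A.end_measurable by (simp add: Int_def conj_commute)
  qed
  define H where "H u = q * ?f u + (q' - q) * ?Q u" for u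
  have bH: "bdd_borel H" unfolding H_def by (intro bdd_borel_intros bf bQ) auto
  have bH2: "bdd_borel (\<lambda>u. indicator {b<..} u * H u)" by (intro bdd_borel_intros bH) auto
  have supH: "q' * conv_op (A.sup_law S) ?f u = conv_op (A.sup_law T) H u" for u
  proof -
    have "conv_op (A.sup_law T) H u = q * conv_op (A.sup_law T) ?f u + (q' - q) * conv_op (A.sup_law T) ?Q u"
      unfolding H_def[abs_def] by (subst conv_op_add conv_op_scale; (intro bdd_borel_mult bdd_borel_const bf bQ rd_laws)?)+ simp
    then show ?thesis using conv_op_sup_law_relation[OF bf] by simp
  qed
  have "q' * conv_op (A.end_law S) ?f x = q' * conv_op (A.inf_law S) (conv_op (A.sup_law S) ?f) x"
    unfolding A.end_law_convolution by (simp add: conv_op_convolution(2) bf)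
  also have "\<dots> = conv_op (A.inf_law S) (\<lambda>u. q' * conv_op (A.sup_law S) ?f u) x" by (simp add: conv_op_scale)
  also have "\<dots> = conv_op K_law H x" unfolding supH K_law_def by (simp add: conv_op_convolution(1) bH)
  finally have 1: "q' * A.prob {\<omega>\<in>space M. y < x + X (S \<omega>) \<omega>} = conv_op K_law H x" unfolding P .
  have 2: "q' * (\<integral>\<omega>. V_integrand (started_at x X) S (q' - q) b y \<omega> \<partial>M) = conv_op K_law (\<lambda>u. indicator {b<..} u * H u) x"
    unfolding H_def by (rule killed_value_formula[OF na y])
  have "q' * ((\<integral>\<omega>. V_integrand (started_at x X) S (q' - q) b y \<omega> \<partial>M) - A.prob {\<omega>\<in>space M. y < x + X (S \<omega>) \<omega>}) =
     conv_op K_law (\<lambda>u. indicator {b<..} u * H u - H u) x"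
    unfolding right_diff_distrib 1 2 by (subst conv_op_diff[OF rd_laws(6) bH2 bH]) simp
  also have "\<dots> = (\<integral>u. q' * (indicator {..<b - x} u * F1_formula (y - x - u)) \<partial>K_law)"
    unfolding conv_op_def
  proof (rule integral_cong_AE)
    have Hm: "H \<in> borel_measurable borel" using bH by (auto simp: bdd_borel_def)
    interpret K: real_distribution cross_law by simp
    interpret R: real_distribution K_law by simp
    have "mono (\<lambda>u. measure cross_law {y - x - u<..})"
      by (intro monoI K.finite_measure_mono) auto
    then have Fm: "(\<lambda>u. measure cross_law {y - x - u<..}) \<in> borel_measurable borel" by (rule borel_measurable_mono)
    show "(\<lambda>u. indicator {b<..} (x + u) * H (x + u) - H (x + u)) \<in> borel_measurable K_law"
      using Hm by simp
    show "(\<lambda>u. q' * (indicator {..<b - x} u * F1_formula (y - x - u))) \<in> borel_measurable K_law"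
      unfolding F1_formula_def using Fm by simp
    show "AE u in K_law. indicator {b<..} (x + u) * H (x + u) - H (x + u) = q' * (indicator {..<b - x} u * F1_formula (y - x - u))"
      using atomless_AE[OF rd_laws(6) at, of "b - x"]
    proof eventually_elim
      case (elim u)
      show ?case
      proof (cases "u < b - x")
        case True
        then have "x + u < y" using y by simp
        then have "H (x + u) = (q' - q) * measure cross_law {y - x - u<..}"
          unfolding H_def conv_op_clamp_tail[OF \<open>x + u < y\<close>] by (simp add: algebra_simps)
        then show ?thesis using True B.r by (simp add: F1_formula_def)
      next
        case False
        then have "b < x + u" using elim by linarith
        then show ?thesis using False by simp
      qed
    qed
  qed
  finally show ?thesis using B.r by simp
qed

text \<open>
  The integration domain in K only leaves out values of the infimum for which the integrand or the law
  vanishes.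
\<close>

lemma cdf_K_law_eq: "K M X e q p x = cdf K_law x" if e: "e q = S" "e (p + q) = T"
proof -
  interpret I: real_distribution "A.inf_law S" by simp
  interpret J: real_distribution "A.sup_law T" by simp
  interpret R: real_distribution K_law by simp
  have P: "A.prob {\<omega>\<in>space M. running_sup X (T \<omega>) \<omega> \<le> v} = measure (A.sup_law T) {..v}" for v
    unfolding A.sup_law_def using B.sup_measurable by (subst measure_distr) (auto intro!: arg_cong[where f=A.prob])
  have neg: "measure (A.sup_law T) {..v} = 0" if "v < 0" for v
  proof -
    have "AE u in A.sup_law T. u \<notin> {..v}" using B.AE_sup_law that by (auto elim!: eventually_mono)
    then show ?thesis by (subst (asm) AE_iff_measurable[of "{..v}"]) (auto simp: measure_def)
  qed
  have "cdf K_law x = (\<integral>u. indicator {..x} u \<partial>K_law)" by (simp add: cdf_def)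
  also have "\<dots> = (\<integral>z. \<integral>u. indicator {..x} (z + u) \<partial>A.sup_law T \<partial>A.inf_law S)"
    unfolding K_law_def by (rule integral_convolution[where B=1]) (auto simp: indicator_def)
  also have "\<dots> = (\<integral>z. measure (A.sup_law T) {..x - z} \<partial>A.inf_law S)"
  proof -
    have "(\<integral>u. indicator {..x} (z + u) \<partial>A.sup_law T) = (\<integral>u. (indicator {..x - z} u :: real) \<partial>A.sup_law T)" for z
      by (intro Bochner_Integration.integral_cong) (auto simp: indicator_def)
    then show ?thesis by simp
  qed
  also have "\<dots> = (\<integral>z. indicator {..min 0 x} z * measure (A.sup_law T) {..x - z} \<partial>A.inf_law S)"
  proof (rule integral_cong_AE)
    have "antimono (\<lambda>z. measure (A.sup_law T) {..x - z})"
      by (intro antimonoI J.finite_measure_mono) auto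
    then have "mono (\<lambda>z. - measure (A.sup_law T) {..x - z})" by (auto simp: mono_def antimono_def)
    then have "(\<lambda>z. - (- measure (A.sup_law T) {..x - z})) \<in> borel_measurable borel"
      by (intro borel_measurable_uminus borel_measurable_mono)
    then have m: "(\<lambda>z. measure (A.sup_law T) {..x - z}) \<in> borel_measurable borel" by simp
    then show "(\<lambda>z. measure (A.sup_law T) {..x - z}) \<in> borel_measurable (A.inf_law S)" by simp
    show "(\<lambda>z. indicator {..min 0 x} z * measure (A.sup_law T) {..x - z}) \<in> borel_measurable (A.inf_law S)" using m by simp
    show "AE z in A.inf_law S. measure (A.sup_law T) {..x - z} = indicator {..min 0 x} z * measure (A.sup_law T) {..x - z}"
      using A.AE_inf_law
    proof eventually_elim
      case (elim z)
      then show ?case using neg[of "x - z"] by (cases "z \<le> x") (auto simp: indicator_def)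
    qed
  qed
  also have "\<dots> = K M X e q p x"
    unfolding K_def set_lebesgue_integral_def e P A.inf_law_def[symmetric] by simp
  finally show ?thesis ..
qed

lemma interval_measure_K_law: "interval_measure (cdf K_law) = K_law"
proof -
  interpret R: real_distribution K_law by simp
  note c = R.cdf_nondecreasing R.cdf_is_right_cont R.cdf_lim_at_bot
  show ?thesis
  proof (rule cdf_unique)
    show "real_distribution (interval_measure (cdf K_law))"
      using R.cdf_lim_at_top_prob c by (intro real_distribution_interval_measure) auto
    show "cdf (interval_measure (cdf K_law)) = cdf K_law" using c by (intro cdf_interval_measure) auto
  qed simp
qed

end

theorem theorem3p1:
  fixes M :: "'a measure" and X :: "real \<Rightarrow> 'a \<Rightarrow> real"
    and e :: "real \<Rightarrow> 'a \<Rightarrow> real" and q p b y :: real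
  assumes "levy_process M X"
    and "\<not> compound_poisson_process M X"
    and "\<And>r. r > 0 \<Longrightarrow> indep_exponential M X r (e r)"
    and "q > 0" and "p > - q" and "y \<ge> b"
  shows "(\<exists>F. is_F1 M X e q p F) \<and>
    (\<forall>F. is_F1 M X e q p F \<longrightarrow>
      (\<forall>x. integrable M (V_integrand (started_at x X) (e q) p b y) \<and>
           set_integrable (interval_measure (K M X e q p)) {..<b - x}
             (\<lambda>z. F (b - x - z + (y - b))) \<and>
           V M X e q p b y x - \<P>(\<omega> in M. started_at x X (e q \<omega>) \<omega> > y) =
             J1 M X e q p F (b - x) (y - b)))"
proof -
  have q': "p + q > 0" using assms(5) by simp
  interpret two_clocks M X q "p + q" "e q" "e (p + q)"
    using assms(1,3,4) q'
    by (intro two_clocks.intro levy_clock.intro levy_clock_axioms.intro) auto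
  have na: "AE s in lborel. 0 \<le> s \<longrightarrow> A.prob {\<omega>\<in>space M. X s \<omega> = c} = 0" for c
    using A.compound_poisson_if_atom assms(2) by blast
  have at: "atomless cross_law" "atomless K_law" using cross_law_K_law_atomless[OF A.end_law_atomless[OF na]] by auto
  have F1_formula: "is_F1 M X e q p F1_formula"
    unfolding is_F1_def using F1_formula_continuous[OF at(1)] F1_formula_laplace by auto
  have Kmix: "interval_measure (K M X e q p) = K_law"
    using interval_measure_K_law cdf_K_law_eq[of e p] by (metis ext)
  show ?thesis
  proof (intro conjI exI[of _ F1_formula] F1_formula allI impI)
    fix F x assume F: "is_F1 M X e q p F"
    have eq: "F u = F1_formula u" if "0 < u" for u
      using F F1_formula that unfolding is_F1_def by (intro laplace_transform_unique[of F F1_formula]) auto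
    have restr: "indicator {..<b - x} z *\<^sub>R F (b - x - z + (y - b)) = indicator {..<b - x} z * F1_formula (y - x - z)" for z
    proof (cases "z < b - x")
      case True
      then have "F (b - x - z + (y - b)) = F1_formula (b - x - z + (y - b))" using assms(6) by (intro eq) simp
      then show ?thesis by (simp add: algebra_simps)
    qed simp
    show "integrable M (V_integrand (started_at x X) (e q) p b y)"
      using V_integrand_integrable[OF na, of x b y] by simp
    show "set_integrable (interval_measure (K M X e q p)) {..<b - x} (\<lambda>z. F (b - x - z + (y - b)))"
      unfolding set_integrable_def Kmix restr
    proof (rule real_distribution_bounded_integrable)
      interpret R: real_distribution cross_law by simp
      have "F1_formula \<in> borel_measurable borel"
        using F1_formula_continuous[OF at(1)] by (rule borel_measurable_continuous_onI)
      then have [measurable]: "(\<lambda>z. F1_formula (y - x - z)) \<in> borel_measurable borel" by simp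
      show "(\<lambda>z. indicator {..<b - x} z * F1_formula (y - x - z)) \<in> borel_measurable borel" by measurable
      show "norm (indicator {..<b - x} z * F1_formula (y - x - z)) \<le> \<bar>p / (p + q)\<bar>" for z
        using mult_left_mono[OF R.prob_le_1, of "\<bar>p / (p + q)\<bar>" "{y - x - z<..}"]
        by (auto simp: F1_formula_def indicator_def abs_mult)
    qed simp
    show "V M X e q p b y x - \<P>(\<omega> in M. started_at x X (e q \<omega>) \<omega> > y) = J1 M X e q p F (b - x) (y - b)"
      using value_difference[OF na assms(6), of x]
      unfolding V_def J1_def set_lebesgue_integral_def Kmix restr started_at_def[of x X] by simp
  qed
qed

end
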